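(* Let $H$ be a real Hilbert space, $V\subset H$ an open neighborhood of the origin $\theta$, and let $\mathcal{L}\in C^1(V,\mathbb{R})$ with $\mathcal{L}'(\theta)=0$ satisfy Hypothesis (A) of the context, with $\dim H^0\ne0$. Let $\mathcal{G}_1,\dots,\mathcal{G}_n\in C^1(V,\mathbb{R})$ satisfy: (i) $\mathcal{G}_j'(\theta)=0$ for $j=1,\dots,n$; (ii) each gradient $\nabla\mathcal{G}_j$ has a Gâteaux derivative $\mathcal{G}_j''(u)\in\mathscr{L}_s(H)$ at every $u\in V$, and $\mathcal{G}_j'':V\to\mathscr{L}_s(H)$ is continuous at $\theta$. For $\vec\lambda=(\lambda_1,\dots,\lambda_n)\in\mathbb{R}^n$ put $\mathcal{L}_{\vec\lambda}=\mathcal{L}+\sum_{j=1}^n\lambda_j\mathcal{G}_j$. Then there exist (sufficiently small) $\delta,\epsilon,r,s>0$ such that there is a unique continuous map $$\psi:[-\delta,\delta]^n\times B_{H^0}(\theta,\epsilon)\to B_{H^+}(\theta,r)\oplus B_{H^-}(\theta,s)$$ with $\psi(\vec\lambda,\theta)=\theta$ and $(I-P^0)\nabla\mathcal{L}_{\vec\lambda}(z+\psi(\vec\lambda,z))=\theta$ for all $(\vec\lambda,z)$, and there are an open neighborhood $W$ of $\theta$ in $H$ and an origin-preserving homeomorphism $$[-\delta,\delta]^n\times B_{H^0}(\theta,\epsilon)\times\left(B_{H^+}(\theta,r)+B_{H^-}(\theta,s)\right)\to[-\delta,\delta]^n\times W,\quad(\vec\lambda,z,u^++u^-)\mapsto(\vec\lambda,\Phi_{\vec\lambda}(z,u^++u^-)),$$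 such that $$\mathcal{L}_{\vec\lambda}\circ\Phi_{\vec\lambda}(z,u^++u^-)=\|u^+\|^2-\|u^-\|^2+\mathcal{L}_{\vec\lambda}(z+\psi(\vec\lambda,z))$$ for all $(\vec\lambda,z,u^++u^-)\in[-\delta,\delta]^n\times B_{H^0}(\theta,\epsilon)\times\left(B_{H^+}(\theta,r)+B_{H^-}(\theta,s)\right)$. For each $\vec\lambda\in[-\delta,\delta]^n$ the functional $\mathcal{L}^\circ_{\vec\lambda}:B_{H^0}(\theta,\epsilon)\to\mathbb{R}$, $\mathcal{L}^\circ_{\vec\lambda}(z)=\mathcal{L}_{\vec\lambda}(z+\psi(\vec\lambda,z))$, is of class $C^1$ with differential $$D\mathcal{L}^\circ_{\vec\lambda}(z)[h]=D\mathcal{L}(z+\psi(\vec\lambda,z))[h]+\sum_{j=1}^n\lambda_jD\mathcal{G}_j(z+\psi(\vec\lambda,z))[h],\quad\forall h\in H^0.$$ Moreover: (i) if $\mathcal{L}$ and $\mathcal{G}_1,\dots,\mathcal{G}_n$ are of class $C^{2-0}$, then so is $\mathcal{L}^\circ_{\vec\lambda}$ for each $\vec\lambda\in[-\delta,\delta]^n$; (ii) if a compact Lie group $G$ acts on $H$ orthogonally and $V$, $\mathcal{L}$ and all $\mathcal{G}_j$ are $G$-invariant (and hence $H^0$ and $(H^0)^\bot$ are $G$-invariant subspaces), then for each $\vec\lambda\in[-\delta,\delta]^n$ the maps $\psi(\vec\lambda,\cdot)$ and $\Phi_{\vec\lambda}(\cdot,\cdot)$ are $G$-equivariant and $\mathcal{L}^\circ_{\vec\lambda}$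 is $G$-invariant.
   Context: Notation: $(\cdot,\cdot)_H$, $\|\cdot\|$ are the inner product and norm of $H$; $\mathscr{L}_s(H)$ is the space of bounded self-adjoint operators on $H$, $\mathscr{L}(H)$ that of bounded operators; $B_Y(\theta,r)$ is the open ball of radius $r$ centred at the origin of $Y$; $\nabla$ denotes gradients. $C^{2-0}$ means $C^1$ with locally Lipschitz derivative. Hypothesis (A): $\nabla\mathcal{L}:V\to H$ has a Gâteaux derivative $B(u)\in\mathscr{L}_s(H)$ at every $u\in V$, and $B=P+Q$, where for each $x\in V$, $P(x)\in\mathscr{L}_s(H)$ is positive definite (spectrum contained in $(0,\infty)$) and $Q(x)\in\mathscr{L}_s(H)$ is compact, and: (D2) for any sequence $(x_k)\subset V$ with $\|x_k\|\to0$, $\|P(x_k)u-P(\theta)u\|\to0$ for every $u\in H$; (D3) $Q:V\to\mathscr{L}(H)$ is continuous at $\theta$; (D4) for any sequence $(x_k)\subset V$ with $\|x_k\|\to0$ there exist $C_0>0$, $k_0\in\mathbb{N}$ with $(P(x_k)u,u)_H\ge C_0\|u\|^2$ for all $u\in H$, $k\ge k_0$. $H=H^+\oplus H^0\oplus H^-$ is the orthogonal decomposition into the positive definite, null and negative definite spaces of $B(\theta)$ ($H^0,H^-$ are finite dimensional under (A)); $P^0$ is the orthogonal projection onto $H^0$.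
   Formalization: The homeomorphism is onto a relatively open set Ω with [-δ,δ]^n×W ⊆ Ω ⊆ [-δ,δ]^n×V, not onto [-δ,δ]^n×W: with one fixed W the claim fails, e.g. for L=G_1=x² on R², where (1+λ)·sup_W x² = r² would have to hold for every λ. *)

theory Defs
  imports "HOL-Analysis.Analysis" "HOL-Algebra.Group"
begin

section \<open>Differentiability\<close>

text \<open>
  The next two notions are used for an open set \<open>S\<close> and for a relatively open subset \<open>S\<close> of a
  closed linear subspace \<open>Y\<close>.  In the second case only the restriction of \<open>f' x\<close> to \<open>Y\<close> is
  determined by \<open>f\<close>; composing with the orthogonal projection onto \<open>Y\<close> extends a derivative
  with values in the dual of \<open>Y\<close> without changing norms, so that the definitions express the
  usual notions for functions on open subsets of the Hilbert space \<open>Y\<close>.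
\<close>

definition C1_on :: "'a::real_normed_vector set \<Rightarrow> ('a \<Rightarrow> real) \<Rightarrow> bool" where
  "C1_on S f \<longleftrightarrow> (\<exists>f' :: 'a \<Rightarrow> 'a \<Rightarrow>\<^sub>L real.
     (\<forall>x\<in>S. (f has_derivative blinfun_apply (f' x)) (at x within S)) \<and> continuous_on S f')"

definition C2_0_on :: "'a::real_normed_vector set \<Rightarrow> ('a \<Rightarrow> real) \<Rightarrow> bool" where
  "C2_0_on S f \<longleftrightarrow> (\<exists>f' :: 'a \<Rightarrow> 'a \<Rightarrow>\<^sub>L real.
     (\<forall>x\<in>S. (f has_derivative blinfun_apply (f' x)) (at x within S)) \<and>
     (\<forall>x\<in>S. \<exists>\<rho>>0. \<exists>K. lipschitz_on K (S \<inter> ball x \<rho>) f'))"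

definition gradient :: "('a::real_inner \<Rightarrow> real) \<Rightarrow> 'a \<Rightarrow> 'a" where
  "gradient f x = (THE g. GDERIV f x :> g)"

definition has_gateaux_derivative ::
    "('a::real_normed_vector \<Rightarrow> 'b::real_normed_vector) \<Rightarrow> ('a \<Rightarrow>\<^sub>L 'b) \<Rightarrow> 'a \<Rightarrow> bool" where
  "has_gateaux_derivative F A x \<longleftrightarrow>
     (\<forall>h. ((\<lambda>t::real. (1 / t) *\<^sub>R (F (x + t *\<^sub>R h) - F x)) \<longlongrightarrow> A h) (at 0))"

section \<open>Operators on a real Hilbert space\<close>

definition self_adjoint :: "('a::real_inner \<Rightarrow>\<^sub>L 'a) \<Rightarrow> bool" where
  "self_adjoint A \<longleftrightarrow> (\<forall>x y. inner (A x) y = inner x (A y))"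

definition compact_operator :: "('a::real_normed_vector \<Rightarrow>\<^sub>L 'b::real_normed_vector) \<Rightarrow> bool" where
  "compact_operator A \<longleftrightarrow> (\<forall>S. bounded S \<longrightarrow> compact (closure (blinfun_apply A ` S)))"

text \<open>
  The real part of the spectrum; for self-adjoint operators this is the whole spectrum of the
  complexification.
\<close>

definition op_spectrum :: "('a::real_normed_vector \<Rightarrow>\<^sub>L 'a) \<Rightarrow> real set" where
  "op_spectrum A = {c. \<nexists>R. R o\<^sub>L (A - c *\<^sub>R id_blinfun) = id_blinfun \<and>
                            (A - c *\<^sub>R id_blinfun) o\<^sub>L R = id_blinfun}"

definition positive_definite_op :: "('a::real_inner \<Rightarrow>\<^sub>L 'a) \<Rightarrow> bool" where
  "positive_definite_op A \<longleftrightarrow> self_adjoint A \<and> op_spectrum A \<subseteq> {0<..}"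

definition null_space :: "('a::real_inner \<Rightarrow>\<^sub>L 'a) \<Rightarrow> 'a set" where
  "null_space A = {x. A x = 0}"

text \<open>
  For self-adjoint \<open>A\<close> the family below has a largest member, the spectral subspace of \<open>A\<close>
  belonging to \<open>{0<..}\<close>: on a closed invariant subspace \<open>M\<close> with positive definite form the
  spectral measure of \<open>A\<close> vanishes on \<open>{..0}\<close>.
\<close>

definition pos_space :: "('a::real_inner \<Rightarrow>\<^sub>L 'a) \<Rightarrow> 'a set" where
  "pos_space A = \<Union>{M. subspace M \<and> closed M \<and> blinfun_apply A ` M \<subseteq> M \<and>
                        (\<forall>x\<in>M. x \<noteq> 0 \<longrightarrow> 0 < inner (A x) x)}"

definition neg_space :: "('a::real_inner \<Rightarrow>\<^sub>L 'a) \<Rightarrow> 'a set" where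
  "neg_space A = \<Union>{M. subspace M \<and> closed M \<and> blinfun_apply A ` M \<subseteq> M \<and>
                        (\<forall>x\<in>M. x \<noteq> 0 \<longrightarrow> inner (A x) x < 0)}"

definition orth_proj :: "'a::real_inner set \<Rightarrow> 'a \<Rightarrow> 'a" where
  "orth_proj Y x = (THE y. y \<in> Y \<and> (\<forall>z\<in>Y. inner (x - y) z = 0))"

definition hypothesis_A ::
    "'a::{real_inner, banach} set \<Rightarrow> ('a \<Rightarrow> real) \<Rightarrow> ('a \<Rightarrow> 'a \<Rightarrow>\<^sub>L 'a) \<Rightarrow>
     ('a \<Rightarrow> 'a \<Rightarrow>\<^sub>L 'a) \<Rightarrow> ('a \<Rightarrow> 'a \<Rightarrow>\<^sub>L 'a) \<Rightarrow> bool" where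
  "hypothesis_A V L B P Q \<longleftrightarrow>
     (\<forall>u\<in>V. has_gateaux_derivative (gradient L) (B u) u \<and> self_adjoint (B u)) \<and>
     (\<forall>x\<in>V. B x = P x + Q x \<and> positive_definite_op (P x) \<and>
             self_adjoint (Q x) \<and> compact_operator (Q x)) \<and>
     \<comment> \<open>(D2)\<close>
     (\<forall>x :: nat \<Rightarrow> 'a. range x \<subseteq> V \<and> x \<longlonglongrightarrow> 0 \<longrightarrow> (\<forall>u. (\<lambda>k. P (x k) u) \<longlonglongrightarrow> P 0 u)) \<and>
     \<comment> \<open>(D3)\<close>
     continuous (at 0 within V) Q \<and>
     \<comment> \<open>(D4)\<close>
     (\<forall>x :: nat \<Rightarrow> 'a. range x \<subseteq> V \<and> x \<longlonglongrightarrow> 0 \<longrightarrow>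
        (\<exists>C0>0. \<exists>k0. \<forall>k\<ge>k0. \<forall>u. inner (P (x k) u) u \<ge> C0 * (norm u)\<^sup>2))"

section \<open>The perturbed functional and its reduction\<close>

definition perturbed ::
    "('a \<Rightarrow> real) \<Rightarrow> ('n::finite \<Rightarrow> 'a \<Rightarrow> real) \<Rightarrow> real ^ 'n \<Rightarrow> 'a \<Rightarrow> real" where
  "perturbed L G l x = L x + (\<Sum>j\<in>UNIV. l $ j * G j x)"

definition param_cube :: "real \<Rightarrow> (real ^ 'n) set" where
  "param_cube \<delta> = {l. \<forall>j. - \<delta> \<le> l $ j \<and> l $ j \<le> \<delta>}"

definition null_ball :: "('a::real_inner \<Rightarrow>\<^sub>L 'a) \<Rightarrow> real \<Rightarrow> 'a set" where
  "null_ball A \<epsilon> = null_space A \<inter> ball 0 \<epsilon>"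

definition pos_ball :: "('a::real_inner \<Rightarrow>\<^sub>L 'a) \<Rightarrow> real \<Rightarrow> 'a set" where
  "pos_ball A r = pos_space A \<inter> ball 0 r"

definition neg_ball :: "('a::real_inner \<Rightarrow>\<^sub>L 'a) \<Rightarrow> real \<Rightarrow> 'a set" where
  "neg_ball A s = neg_space A \<inter> ball 0 s"

definition pos_neg_ball :: "('a::real_inner \<Rightarrow>\<^sub>L 'a) \<Rightarrow> real \<Rightarrow> real \<Rightarrow> 'a set" where
  "pos_neg_ball A r s = {up + um | up um. up \<in> pos_ball A r \<and> um \<in> neg_ball A s}"

text \<open>
  \<open>A\<close> is the second derivative at the origin.  The last clause is
  \<open>(I - P\<^sup>0) \<nabla>L\<^sub>l (z + \<psi>(l, z)) = 0\<close>.
\<close>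

definition reduction_map ::
    "('a::{real_inner, banach} \<Rightarrow> real) \<Rightarrow> ('n::finite \<Rightarrow> 'a \<Rightarrow> real) \<Rightarrow> ('a \<Rightarrow>\<^sub>L 'a) \<Rightarrow>
     real \<Rightarrow> real \<Rightarrow> real \<Rightarrow> real \<Rightarrow> (real ^ 'n \<Rightarrow> 'a \<Rightarrow> 'a) \<Rightarrow> bool" where
  "reduction_map L G A \<delta> \<epsilon> r s \<psi> \<longleftrightarrow>
     continuous_on (param_cube \<delta> \<times> null_ball A \<epsilon>) (\<lambda>(l, z). \<psi> l z) \<and>
     (\<forall>l\<in>param_cube \<delta>. \<forall>z\<in>null_ball A \<epsilon>. \<psi> l z \<in> pos_neg_ball A r s) \<and>
     (\<forall>l\<in>param_cube \<delta>. \<psi> l 0 = 0) \<and>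
     (\<forall>l\<in>param_cube \<delta>. \<forall>z\<in>null_ball A \<epsilon>.
        gradient (perturbed L G l) (z + \<psi> l z)
        - orth_proj (null_space A) (gradient (perturbed L G l) (z + \<psi> l z)) = 0)"

text \<open>
  The parametrised homeomorphism \<open>(l, z, u) \<mapsto> (l, \<Phi> l z u)\<close> has an image \<open>\<Omega>\<close> whose fibres over
  the parameter cube genuinely vary with \<open>l\<close>, so \<open>\<Omega>\<close> cannot in general be a product of the cube
  with a fixed neighbourhood \<open>W\<close>: for \<open>L (z, x) = x\<^sup>2 = G (z, x)\<close> on the plane, \<open>\<psi> = 0\<close> and the normal
  form says that \<open>(1 + l) x\<^sup>2\<close> maps the fibre over \<open>l\<close> onto \<open>{0..<r\<^sup>2}\<close>, for every \<open>l\<close>.  What one has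
  is that \<open>\<Omega>\<close> is relatively open and contains the product of the cube with a fixed \<open>W\<close>.
\<close>

section \<open>Compact Lie groups and their orthogonal actions\<close>

text \<open>\<open>C\<^sup>k\<close> maps on an open subset \<open>S\<close> of a finite-dimensional space.\<close>

primrec Ck_on :: "nat \<Rightarrow> 'b::euclidean_space set \<Rightarrow> ('b \<Rightarrow> 'c::euclidean_space) \<Rightarrow> bool" where
  "Ck_on 0 S f \<longleftrightarrow> continuous_on S f"
| "Ck_on (Suc k) S f \<longleftrightarrow> (\<forall>x\<in>S. f differentiable (at x)) \<and>
     (\<forall>v. Ck_on k S (\<lambda>x. frechet_derivative f (at x) v))"

definition smooth_on :: "'b::euclidean_space set \<Rightarrow> ('b \<Rightarrow> 'c::euclidean_space) \<Rightarrow> bool" where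
  "smooth_on S f \<longleftrightarrow> (\<forall>k. Ck_on k S f)"

definition topological_group :: "('g, 'm) monoid_scheme \<Rightarrow> 'g topology \<Rightarrow> bool" where
  "topological_group K T \<longleftrightarrow> group K \<and> topspace T = carrier K \<and> Hausdorff_space T \<and>
     continuous_map (prod_topology T T) T (\<lambda>(a, b). a \<otimes>\<^bsub>K\<^esub> b) \<and>
     continuous_map T T (\<lambda>a. inv\<^bsub>K\<^esub> a)"

definition smooth_group_atlas ::
    "('g, 'm) monoid_scheme \<Rightarrow> 'g topology \<Rightarrow> ('g set \<times> ('g \<Rightarrow> 'e::euclidean_space)) set \<Rightarrow> bool" where
  "smooth_group_atlas K T \<A> \<longleftrightarrow>
     (\<Union>(U, \<phi>)\<in>\<A>. U) = carrier K \<and>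
     (\<forall>(U, \<phi>)\<in>\<A>. openin T U \<and> open (\<phi> ` U) \<and>
        homeomorphic_map (subtopology T U) (top_of_set (\<phi> ` U)) \<phi>) \<and>
     (\<forall>(U, \<phi>)\<in>\<A>. \<forall>(U', \<phi>')\<in>\<A>. smooth_on (\<phi> ` (U \<inter> U')) (\<lambda>x. \<phi>' (inv_into U \<phi> x))) \<and>
     (\<forall>(U, \<phi>)\<in>\<A>. \<forall>(U', \<phi>')\<in>\<A>. \<forall>(W, \<theta>)\<in>\<A>.
        smooth_on {(x, y). x \<in> \<phi> ` U \<and> y \<in> \<phi>' ` U' \<and> inv_into U \<phi> x \<otimes>\<^bsub>K\<^esub> inv_into U' \<phi>' y \<in> W}
          (\<lambda>(x, y). \<theta> (inv_into U \<phi> x \<otimes>\<^bsub>K\<^esub> inv_into U' \<phi>' y))) \<and>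
     (\<forall>(U, \<phi>)\<in>\<A>. \<forall>(W, \<theta>)\<in>\<A>.
        smooth_on {x. x \<in> \<phi> ` U \<and> inv\<^bsub>K\<^esub> (inv_into U \<phi> x) \<in> W}
          (\<lambda>x. \<theta> (inv\<^bsub>K\<^esub> (inv_into U \<phi> x))))"

text \<open>
  Types of class \<^class>\<open>euclidean_space\<close> have positive dimension; Lie groups of dimension 0 (when
  compact: finite groups) are therefore covered by the first disjunct.  Second countability is
  automatic for compact groups.
\<close>

definition compact_lie_group ::
    "'e::euclidean_space itself \<Rightarrow> ('g, 'm) monoid_scheme \<Rightarrow> 'g topology \<Rightarrow> bool" where
  "compact_lie_group E K T \<longleftrightarrow> topological_group K T \<and> compact_space T \<and>
     (T = discrete_topology (carrier K) \<or>
      (\<exists>\<A> :: ('g set \<times> ('g \<Rightarrow> 'e)) set. smooth_group_atlas K T \<A>))"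

definition orthogonal_action ::
    "('g, 'm) monoid_scheme \<Rightarrow> 'g topology \<Rightarrow> ('g \<Rightarrow> 'a::real_inner \<Rightarrow> 'a) \<Rightarrow> bool" where
  "orthogonal_action K T act \<longleftrightarrow>
     (\<forall>g\<in>carrier K. linear (act g) \<and> (\<forall>x y. inner (act g x) (act g y) = inner x y)) \<and>
     (\<forall>x. act \<one>\<^bsub>K\<^esub> x = x) \<and>
     (\<forall>g\<in>carrier K. \<forall>h\<in>carrier K. \<forall>x. act (g \<otimes>\<^bsub>K\<^esub> h) x = act g (act h x)) \<and>
     continuous_map (prod_topology T euclidean) euclidean (\<lambda>(g, x). act g x)"

end

(*
  A := B(0) is a compact perturbation of a coercive operator, so the space splits orthogonally into the
  null, positive and negative spaces N, H+, H- of A, and the unit sphere of N + H- is compact.  With weak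
  lower semicontinuity of the forms (P x h, h) on H+ and this compactness on H-, the form of B(x) stays
  uniformly definite on H+ and on H- for x near 0, and the small terms l_j G_j do not destroy this: near 0
  every functional of the family is strongly convex along H+ and strongly concave along H-, with Lipschitz
  gradient, uniformly in l.

  One then reduces twice.  Maximising along H- gives c(l, x) for x in N + H+, and the reduced functional
  x -> f_l (x + c(l, x)) is again strongly convex along H+ with Lipschitz gradient; minimising it along H+
  gives psi.  Along the fibre of each step the functional grows quadratically on the rays leaving the
  critical point, so that rescaling each ray radially turns it into the square of the norm; the inverse of
  the chart Phi is therefore explicit.  Uniqueness of the critical points gives uniqueness of psi and
  equivariance.
*)
theory Submission
  imports Defs
begin

section \<open>Projections, representation of functionals and weak cluster points\<close>

text \<open>The obstacle is weak regularity. By (D2) the operators \<open>P x\<close> tend to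
  \<open>P 0\<close> only strongly, and \<open>B x\<close> is only a Gateaux derivative, so
  \<open>gradient L\<close> need not be C^1 and neither the implicit function theorem nor a Morse
  lemma based on it is available. Everything is drawn from inequalities: the mean value theorem and
  Taylor's formula on segments turn bounds on the forms of \<open>B x\<close> into convexity,
  concavity and Lipschitz estimates. The Lipschitz bound rests on the uniform boundedness principle,
  because a strongly convergent sequence of operators is bounded in norm. The two directions are
  treated one after the other because away from the origin the form of \<open>B x\<close> may couple
  H+ and H-, whereas on a fibre along one of them the problem is definite. Maximising along H-
  preserves convexity along H+: the maximum lies above the value at any fixed competitor, and the
  full gradient at the maximiser serves as gradient of the reduced functional. Critical points come
  from a contraction and not from compactness, which H+ does not offer.\<close>

lemma orthogonal_projection_exists:
  fixes M :: "'a::{real_inner, banach} set"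
  assumes "closed M" and "subspace M"
  shows "\<exists>y\<in>M. \<forall>z\<in>M. inner (x - y) z = 0"
proof -
  define d where "d = (INF y\<in>M. (norm (x - y))\<^sup>2)"
  have bdd: "bdd_below ((\<lambda>y. (norm (x - y))\<^sup>2) ` M)"
    by (rule bdd_belowI[of _ 0]) auto
  have ne: "M \<noteq> {}" using assms(2) subspace_0 by auto
  have d_le: "d \<le> (norm (x - y))\<^sup>2" if "y \<in> M" for y
    unfolding d_def using bdd that by (rule cINF_lower)
  have "\<exists>y\<in>M. (norm (x - y))\<^sup>2 < d + 1 / real (Suc n)" for n
  proof -
    have "d < d + 1 / real (Suc n)" by simp
    thus ?thesis unfolding d_def using cINF_less_iff[OF ne bdd] by blast
  qed
  then obtain y where yM: "\<And>n. y n \<in> M"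
    and y: "\<And>n. (norm (x - y n))\<^sup>2 < d + 1 / real (Suc n)" by metis
  \<comment> \<open>Parallelogram identity: the midpoint lies in \<open>M\<close>, so its squared
    distance from \<open>x\<close> is at least \<open>d\<close>. This makes the minimising sequence
    Cauchy.\<close>
  have par: "(norm (y n - y m))\<^sup>2 \<le> 2 / real (Suc n) + 2 / real (Suc m)" for n m
  proof -
    have "(1/2) *\<^sub>R (y n + y m) \<in> M"
      using assms(2) yM by (simp add: subspace_add subspace_scale)
    hence "d \<le> (norm (x - (1/2) *\<^sub>R (y n + y m)))\<^sup>2" by (rule d_le)
    moreover have "(norm (y n - y m))\<^sup>2 = 2 * (norm (x - y n))\<^sup>2 + 2 * (norm (x - y m))\<^sup>2
        - 4 * (norm (x - (1/2) *\<^sub>R (y n + y m)))\<^sup>2"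
      unfolding power2_norm_eq_inner
      by (simp add: inner_simps inner_commute algebra_simps)
    ultimately show ?thesis using y[of n] y[of m] by simp
  qed
  have "Cauchy y"
  proof (rule metric_CauchyI)
    fix e :: real assume e: "0 < e"
    obtain N :: nat where N: "4 / e\<^sup>2 < real N" using reals_Archimedean2 by blast
    have "dist (y m) (y n) < e" if "m \<ge> N" "n \<ge> N" for m n
    proof -
      have N0: "0 < real N" using N e by (smt (verit) divide_pos_pos zero_less_power)
      have 1: "2 / real (Suc m) \<le> 2 / real N" "2 / real (Suc n) \<le> 2 / real N"
        using that N0 by (auto simp: frac_le)
      have "4 / real N < e\<^sup>2" using N N0 e by (simp add: field_simps)
      hence "(norm (y m - y n))\<^sup>2 < e\<^sup>2" using par[of m n] 1 by linarith
      thus ?thesis using e by (simp add: dist_norm power_less_imp_less_base)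
    qed
    thus "\<exists>M. \<forall>m\<ge>M. \<forall>n\<ge>M. dist (y m) (y n) < e" by blast
  qed
  then obtain p where p: "y \<longlonglongrightarrow> p" using Cauchy_convergent convergent_def by blast
  have pM: "p \<in> M" using closed_sequentially[OF assms(1)] yM p by blast
  have "(\<lambda>n. (norm (x - y n))\<^sup>2) \<longlonglongrightarrow> (norm (x - p))\<^sup>2"
    by (intro tendsto_intros p)
  moreover have "(\<lambda>n. d + 1 / real (Suc n)) \<longlonglongrightarrow> d + 0"
    by (intro tendsto_add tendsto_const) (use LIMSEQ_inverse_real_of_nat in \<open>simp add: inverse_eq_divide\<close>)
  ultimately have "(norm (x - p))\<^sup>2 \<le> d + 0"
    by (rule LIMSEQ_le) (use y less_imp_le in blast)
  hence pd: "(norm (x - p))\<^sup>2 \<le> d" by simp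
  have "inner (x - p) z = 0" if z: "z \<in> M" for z
  proof (cases "z = 0")
    case False
    \<comment> \<open>The step along \<open>z\<close> that lowers the distance most; it would lower
      its square by the square of \<open>inner (x - p) z\<close> divided by that of
      \<open>norm z\<close>.\<close>
    define t where "t = inner (x - p) z / (norm z)\<^sup>2"
    have nz: "(norm z)\<^sup>2 > 0" using False by simp
    have "p + t *\<^sub>R z \<in> M" using assms(2) pM z by (simp add: subspace_add subspace_scale)
    hence "(norm (x - p))\<^sup>2 \<le> (norm (x - (p + t *\<^sub>R z)))\<^sup>2"
      using d_le pd order_trans by blast
    also have "\<dots> = (norm (x - p))\<^sup>2 - 2 * t * inner (x - p) z + t\<^sup>2 * (norm z)\<^sup>2"
      unfolding power2_norm_eq_inner
      by (simp add: inner_simps inner_commute algebra_simps power2_eq_square)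
    also have "\<dots> = (norm (x - p))\<^sup>2 - (inner (x - p) z)\<^sup>2 / (norm z)\<^sup>2"
      using nz unfolding t_def by (simp add: field_simps power2_eq_square)
    finally have "(inner (x - p) z)\<^sup>2 / (norm z)\<^sup>2 \<le> 0" by simp
    thus ?thesis using nz by (simp add: divide_le_0_iff)
  qed simp
  thus ?thesis using pM by blast
qed

section \<open>Orthogonal projections, orthogonal complements and the Riesz representation\<close>

lemma orth_proj_unique:
  assumes "subspace M" "y \<in> M" "\<And>z. z \<in> M \<Longrightarrow> inner (x - y) z = 0"
  shows "orth_proj M x = y"
  unfolding orth_proj_def
proof (rule the_equality)
  fix y' assume y': "y' \<in> M \<and> (\<forall>z\<in>M. inner (x - y') z = 0)"
  have m: "y - y' \<in> M" using assms y' subspace_diff by blast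
  have "inner (y - y') (y - y') = inner (x - y') (y - y') - inner (x - y) (y - y')"
    by (simp add: inner_simps)
  also have "\<dots> = 0" using assms(3) y' m by simp
  finally show "y' = y" by simp
qed (use assms in auto)

lemma
  fixes M :: "'a::{real_inner, banach} set"
  assumes "closed M" and "subspace M"
  shows orth_proj_in: "orth_proj M x \<in> M"
    and orth_proj_orth: "z \<in> M \<Longrightarrow> inner (x - orth_proj M x) z = 0"
proof -
  obtain y where "y \<in> M" "\<forall>z\<in>M. inner (x - y) z = 0"
    using orthogonal_projection_exists[OF assms] by blast
  moreover from this have "orth_proj M x = y" using assms by (intro orth_proj_unique) auto
  ultimately show "orth_proj M x \<in> M" "z \<in> M \<Longrightarrow> inner (x - orth_proj M x) z = 0" by auto
qed

lemma linear_orth_proj: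
  fixes M :: "'a::{real_inner, banach} set"
  assumes "closed M" and "subspace M"
  shows "linear (orth_proj M)"
proof (rule linearI)
  fix x y :: 'a and c :: real
  show "orth_proj M (x + y) = orth_proj M x + orth_proj M y"
  proof (rule orth_proj_unique[OF assms(2)])
    show "orth_proj M x + orth_proj M y \<in> M" using assms orth_proj_in subspace_add by blast
    fix z assume "z \<in> M"
    thus "inner (x + y - (orth_proj M x + orth_proj M y)) z = 0"
      using orth_proj_orth[OF assms, of z x] orth_proj_orth[OF assms, of z y]
      by (simp add: inner_simps)
  qed
  show "orth_proj M (c *\<^sub>R x) = c *\<^sub>R orth_proj M x"
  proof (rule orth_proj_unique[OF assms(2)])
    show "c *\<^sub>R orth_proj M x \<in> M" using assms orth_proj_in subspace_scale by blast
    fix z assume "z \<in> M"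
    thus "inner (c *\<^sub>R x - c *\<^sub>R orth_proj M x) z = 0"
      using orth_proj_orth[OF assms, of z x]
      by (simp flip: scaleR_diff_right)
  qed
qed

lemma norm_orth_proj_le:
  fixes M :: "'a::{real_inner, banach} set"
  assumes "closed M" and "subspace M"
  shows "norm (orth_proj M x) \<le> norm x"
proof -
  have "inner (x - orth_proj M x) (orth_proj M x) = 0"
    using orth_proj_orth[OF assms] orth_proj_in[OF assms] by blast
  hence "(norm x)\<^sup>2 = (norm (x - orth_proj M x))\<^sup>2 + (norm (orth_proj M x))\<^sup>2"
    unfolding power2_norm_eq_inner by (simp add: inner_simps inner_commute algebra_simps)
  hence "(norm (orth_proj M x))\<^sup>2 \<le> (norm x)\<^sup>2" by simp
  thus ?thesis by simp
qed

lemma bounded_linear_orth_proj: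
  fixes M :: "'a::{real_inner, banach} set"
  assumes "closed M" and "subspace M"
  shows "bounded_linear (orth_proj M)"
  using linear_orth_proj[OF assms] norm_orth_proj_le[OF assms]
  by (intro bounded_linear_intro[of _ 1]) (auto simp: linear_add linear_scale)

lemma orth_proj_zero: "subspace M \<Longrightarrow> (\<And>z. z \<in> M \<Longrightarrow> inner x z = 0) \<Longrightarrow> orth_proj M x = 0"
  by (rule orth_proj_unique) (auto simp: subspace_0)

lemma inner_orth_proj:
  fixes M :: "'a::{real_inner, banach} set"
  assumes "closed M" and "subspace M" and "z \<in> M"
  shows "inner (orth_proj M x) z = inner x z"
  using orth_proj_orth[OF assms, of x] by (simp add: inner_simps)

lemma closed_orthogonal_comp: "closed (W\<^sup>\<bottom>)"
proof -
  have "W\<^sup>\<bottom> = (\<Inter>y\<in>W. {x. inner y x = 0})" by (auto simp: orthogonal_comp_def orthogonal_def)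
  moreover have "closed {x. inner y x = 0}" for y :: 'a
    by (rule closed_Collect_eq) (auto intro: continuous_intros)
  ultimately show ?thesis by auto
qed

lemma mem_orthogonal_comp: "x \<in> W\<^sup>\<bottom> \<longleftrightarrow> (\<forall>y\<in>W. inner x y = 0)"
  by (auto simp: orthogonal_comp_def orthogonal_def inner_commute)

lemma riesz_representation:
  fixes f :: "'a::{real_inner, banach} \<Rightarrow> real"
  assumes "bounded_linear f"
  obtains g where "\<And>x. f x = inner g x"
proof (cases "\<forall>x. f x = 0")
  case True
  thus ?thesis using that[of 0] by simp
next
  case False
  then obtain x where x: "f x \<noteq> 0" by blast
  interpret bounded_linear f by fact
  let ?M = "{x. f x = 0}"
  have cl: "closed ?M"
    by (rule closed_Collect_eq) (auto intro: continuous_on continuous_intros)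
  have sub: "subspace ?M" by (rule linear_subspace_kernel) (rule linear_axioms)
  obtain y where y: "y \<in> ?M" "\<forall>z\<in>?M. inner (x - y) z = 0"
    using orthogonal_projection_exists[OF cl sub] by blast
  define e where "e = x - y"
  have fe: "f e \<noteq> 0" using x y by (simp add: e_def diff)
  hence e0: "inner e e \<noteq> 0" using zero by auto
  have "f v = inner ((f e / inner e e) *\<^sub>R e) v" for v
  proof -
    have "v - (f v / f e) *\<^sub>R e \<in> ?M" using fe by (simp add: diff scale)
    hence "inner e (v - (f v / f e) *\<^sub>R e) = 0" using y(2) by (auto simp: e_def)
    thus ?thesis using fe e0 by (simp add: inner_simps field_simps)
  qed
  thus ?thesis using that by blast
qed

section \<open>Compactness along filters, weak limits and uniform boundedness\<close>

lemma compact_imp_convergent_subfilter: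
  fixes f :: "'i \<Rightarrow> 'b::topological_space"
  assumes "compact S" "F \<noteq> bot" and S: "\<And>i. f i \<in> S"
  obtains x F' where "x \<in> S" "F' \<le> F" "F' \<noteq> bot" "filterlim f (nhds x) F'"
proof -
  have "filtermap f F \<noteq> bot" using assms(2) by (simp add: filtermap_bot_iff)
  moreover have "eventually (\<lambda>y. y \<in> S) (filtermap f F)" using S by (simp add: eventually_filtermap)
  ultimately obtain x where x: "x \<in> S" "inf (nhds x) (filtermap f F) \<noteq> bot"
    using assms(1) unfolding compact_filter by blast
  \<comment> \<open>The coarsest filter below \<open>F\<close> along which \<open>f\<close> tends to
    \<open>x\<close>; it is proper exactly because \<open>x\<close> is a cluster point.\<close>
  define F' where "F' = inf (filtercomap f (nhds x)) F"
  have "F' \<noteq> bot"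
  proof
    assume "F' = bot"
    hence "eventually (\<lambda>_. False) F'" by simp
    then obtain A B where A: "eventually A (filtercomap f (nhds x))" and B: "eventually B F"
      and AB: "\<And>i. A i \<Longrightarrow> B i \<Longrightarrow> False" unfolding F'_def eventually_inf by metis
    then obtain D where D: "eventually D (nhds x)" "\<And>i. D (f i) \<Longrightarrow> A i"
      unfolding eventually_filtercomap by blast
    have "eventually (\<lambda>y. \<not> D y) (filtermap f F)"
      unfolding eventually_filtermap by (rule eventually_mono[OF B]) (use D AB in blast)
    hence "eventually (\<lambda>_. False) (inf (nhds x) (filtermap f F))"
      unfolding eventually_inf using D(1) by blast
    thus False using x(2) by (simp add: trivial_limit_def)
  qed
  moreover have "filterlim f (nhds x) F'"
    unfolding F'_def by (rule filterlim_mono[OF filterlim_filtercomap order_refl]) simp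
  ultimately show ?thesis using that[OF x(1), of F'] by (simp add: F'_def)
qed

text \<open>Banach-Alaoglu combined with Riesz: the functionals \<open>inner (h i)\<close> lie in a
  product of compact intervals, and a pointwise limit of them is again linear and bounded. The
  product need not be first countable, hence a finer filter in place of a subsequence; such a filter
  can be refined once more by a second compactness argument.\<close>

lemma weak_cluster_point:
  fixes h :: "'i \<Rightarrow> 'a::{real_inner, banach}"
  assumes "F \<noteq> bot" and bnd: "\<And>i. norm (h i) \<le> r"
  obtains F' x where "F' \<le> F" "F' \<noteq> bot" "\<And>y. ((\<lambda>i. inner (h i) y) \<longlongrightarrow> inner x y) F'"
proof -
  let ?U = "PiE UNIV (\<lambda>y::'a. {- (r * norm y)..r * norm y})"
  let ?G = "\<lambda>i y. inner (h i) y"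
  have "compactin (product_topology (\<lambda>_. euclidean) UNIV) ?U"
    by (subst compactin_PiE) auto
  hence cpt: "compact ?U" by (simp add: euclidean_product_topology)
  have inU: "?G i \<in> ?U" for i
  proof -
    have "\<bar>inner (h i) y\<bar> \<le> r * norm y" for y
      by (rule order_trans[OF Cauchy_Schwarz_ineq2]) (simp add: bnd mult_right_mono)
    thus ?thesis by (auto simp: abs_le_iff minus_le_iff)
  qed
  obtain \<phi> F' where \<phi>: "\<phi> \<in> ?U" and F': "F' \<le> F" and nb: "F' \<noteq> bot" and *: "filterlim ?G (nhds \<phi>) F'"
    by (rule compact_imp_convergent_subfilter[OF cpt assms(1) inU]) (rule that)
  have lim: "((\<lambda>i. inner (h i) y) \<longlongrightarrow> \<phi> y) F'" for y
    by (rule continuous_on_tendsto_compose[OF continuous_on_product_coordinates *]) auto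
  have "bounded_linear \<phi>"
  proof (rule bounded_linear_intro[of _ r])
    fix x y :: 'a and c :: real
    show "\<phi> (x + y) = \<phi> x + \<phi> y"
      by (rule tendsto_unique[OF nb lim]) (simp add: inner_simps tendsto_add lim)
    show "\<phi> (c *\<^sub>R x) = c *\<^sub>R \<phi> x"
      by (rule tendsto_unique[OF nb lim]) (simp add: tendsto_mult_left lim)
    have "\<phi> x \<in> {- (r * norm x)..r * norm x}" using \<phi> by blast
    thus "norm (\<phi> x) \<le> norm x * r" by (simp add: abs_le_iff mult.commute)
  qed
  then obtain x where "\<And>y. \<phi> y = inner x y" using riesz_representation by blast
  thus ?thesis using that[OF F' nb, of x] lim by simp
qed

text \<open>Baire category applied to the closed sets \<open>E n\<close>, which cover the space: one
  of them contains a ball, and differences of points of that ball reach every direction.\<close>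

lemma pointwise_bounded_imp_uniformly_bounded:
  fixes T :: "'i \<Rightarrow> 'a::banach \<Rightarrow>\<^sub>L 'b::real_normed_vector"
  assumes "\<And>u. \<exists>c. \<forall>i. norm (T i u) \<le> c"
  shows "\<exists>K. \<forall>i. norm (T i) \<le> K"
proof -
  define E where "E n = {u. \<forall>i. norm (T i u) \<le> real n}" for n
  have cl: "closed (E n)" for n
  proof -
    have "E n = (\<Inter>i. {u. norm (T i u) \<le> real n})" by (auto simp: E_def)
    moreover have "closed {u. norm (T i u) \<le> real n}" for i
      by (rule closed_Collect_le) (intro continuous_intros)+
    ultimately show ?thesis by auto
  qed
  have un: "\<Union>(range E) = UNIV"
  proof -
    have "\<exists>n. u \<in> E n" for u
    proof -
      obtain c where c: "\<forall>i. norm (T i u) \<le> c" using assms by blast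
      obtain n where "c \<le> real n" using real_arch_simple by blast
      thus ?thesis using c by (auto simp: E_def intro: order_trans)
    qed
    thus ?thesis by auto
  qed
  have "\<exists>n. interior (E n) \<noteq> {}"
  proof (rule ccontr)
    assume "\<not> ?thesis"
    hence "Met_TC.mtopology interior_of \<Union>(range E) = {}"
      using cl by (intro Met_TC.metric_Baire_category_alt) (auto simp: complete_UNIV)
    thus False using un by simp
  qed
  then obtain n u0 e where e: "e > 0" "ball u0 e \<subseteq> E n"
    by (metis all_not_in_conv mem_interior)
  have "norm (T i) \<le> 4 * real n / e" for i
  proof (rule norm_blinfun_bound)
    show "0 \<le> 4 * real n / e" using e by simp
    fix v :: 'a
    show "norm (T i v) \<le> 4 * real n / e * norm v"
    proof (cases "v = 0")
      case False
      \<comment> \<open>Scaled to length \<open>e / 2\<close>, so that \<open>u0\<close> and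
        \<open>u0 + w\<close> both lie in the ball; the bound \<open>2 * n\<close> at this length
        gives the constant \<open>4 * n / e\<close>.\<close>
      define w where "w = (e / (2 * norm v)) *\<^sub>R v"
      have "norm w = e / 2" using False e by (simp add: w_def)
      hence "u0 + w \<in> E n" "u0 \<in> E n" using e by (auto simp: dist_norm)
      hence "norm (T i (u0 + w)) \<le> real n" "norm (T i u0) \<le> real n" by (auto simp: E_def)
      hence "norm (T i w) \<le> 2 * real n"
        using norm_triangle_ineq4[of "T i (u0 + w)" "T i u0"] by (simp add: blinfun.add_right)
      hence "e / (2 * norm v) * norm (T i v) \<le> 2 * real n"
        using e by (simp add: w_def blinfun.scaleR_right)
      thus ?thesis using False e by (simp add: field_simps)
    qed simp
  qed
  thus ?thesis by blast
qed

section \<open>Spectral splitting of a compact perturbation of a coercive operator\<close>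

text \<open>Weak lower semicontinuity of the forms: expand \<open>(p\<^sub>k (h\<^sub>k - h), h\<^sub>k - h) \<ge> 0\<close> along a
  filter on which \<open>h\<^sub>k\<close> converges weakly to \<open>h\<close> and \<open>Q\<^sub>0 h\<^sub>k\<close> converges in norm.\<close>

lemma weak_limit_of_forms:
  fixes p q :: "nat \<Rightarrow> 'a::{real_inner, banach} \<Rightarrow>\<^sub>L 'a" and P0 Q0 :: "'a \<Rightarrow>\<^sub>L 'a"
  assumes p: "\<And>u. (\<lambda>k. p k u) \<longlonglongrightarrow> P0 u" and q: "q \<longlonglongrightarrow> Q0"
    and sa: "\<And>k. self_adjoint (p k)" "self_adjoint Q0" and cpt: "compact_operator Q0"
    and coercive: "\<And>k v. C * (norm v)\<^sup>2 \<le> inner (p k v) v" "0 \<le> C"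
    and h: "\<And>k. norm (h k) = 1" and c: "\<And>k. inner ((p k + q k) (h k)) (h k) \<le> c k" "c \<longlonglongrightarrow> m"
  obtains x where "\<And>M. closed M \<Longrightarrow> subspace M \<Longrightarrow> (\<And>k. h k \<in> M) \<Longrightarrow> x \<in> M"
    and "norm x \<le> 1" and "inner ((P0 + Q0) x) x \<le> m" and "x = 0 \<Longrightarrow> C \<le> m"
proof -
  obtain F1 x where F1: "F1 \<le> sequentially" "F1 \<noteq> bot"
    and x1: "\<And>y. ((\<lambda>i. inner (h i) y) \<longlongrightarrow> inner x y) F1"
    using weak_cluster_point[of sequentially h 1] h by auto
  let ?S = "closure (blinfun_apply Q0 ` cball 0 1)"
  have S: "compact ?S" using cpt unfolding compact_operator_def by simp
  have QS: "Q0 (h i) \<in> ?S" for i by (rule subsetD[OF closure_subset]) (simp add: h)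
  obtain y F where FF1: "F \<le> F1" and nb: "F \<noteq> bot" and Qy: "((\<lambda>i. Q0 (h i)) \<longlongrightarrow> y) F"
    by (rule compact_imp_convergent_subfilter[OF S F1(2) QS]) (rule that)
  have F: "F \<le> sequentially" using FF1 F1 by auto
  have xl: "((\<lambda>i. inner (h i) z) \<longlongrightarrow> inner x z) F" for z
    using x1 FF1 by (rule tendsto_mono[rotated])
  \<comment> \<open>The norm limit supplied by compactness must agree with the weak limit, which
    self-adjointness identifies.\<close>
  have "y = Q0 x"
  proof -
    have "inner y z = inner (Q0 x) z" for z
    proof (rule tendsto_unique[OF nb])
      show "((\<lambda>i. inner (Q0 (h i)) z) \<longlongrightarrow> inner y z) F" by (intro tendsto_intros Qy)
      show "((\<lambda>i. inner (Q0 (h i)) z) \<longlongrightarrow> inner (Q0 x) z) F"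
        using xl[of "Q0 z"] sa(2) unfolding self_adjoint_def by simp
    qed
    thus ?thesis by (metis inner_eq_zero_iff inner_diff_left eq_iff_diff_eq_0)
  qed
  have bnd: "\<bar>inner u (h k)\<bar> \<le> norm u" for u k
    using Cauchy_Schwarz_ineq2[of u "h k"] h by simp
  have small: "((\<lambda>k. inner (u k) (h k)) \<longlongrightarrow> 0) F" if "(u \<longlongrightarrow> 0) F" for u :: "nat \<Rightarrow> 'a"
    by (rule tendsto_0_le[OF that, where K=1]) (use bnd in auto)
  have Qlim: "((\<lambda>k. inner (Q0 (h k)) (h k)) \<longlongrightarrow> inner (Q0 x) x) F"
  proof -
    have "((\<lambda>k. inner (Q0 (h k) - Q0 x) (h k) + inner (h k) (Q0 x)) \<longlongrightarrow> 0 + inner x (Q0 x)) F"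
      using Qy unfolding \<open>y = Q0 x\<close>
      by (intro tendsto_add small xl) (simp add: LIM_zero)
    thus ?thesis by (simp add: inner_simps inner_commute)
  qed
  have qlim: "((\<lambda>k. inner ((q k - Q0) (h k)) (h k)) \<longlongrightarrow> 0) F"
  proof (rule small, rule tendsto_0_le[where K=1])
    show "((\<lambda>k. q k - Q0) \<longlongrightarrow> 0) F" using tendsto_mono[OF F q] by (simp add: LIM_zero)
    show "\<forall>\<^sub>F k in F. norm ((q k - Q0) (h k)) \<le> norm (q k - Q0) * 1"
      using norm_blinfun[of "q _ - Q0" "h _"] h by (intro always_eventually allI) (metis mult_1_right)
  qed
  \<comment> \<open>Strong convergence suffices here, since \<open>p k\<close> acts on the fixed
    vector \<open>x\<close>; the moving vector \<open>h k\<close> stands only in the other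
    slot.\<close>
  have plim: "((\<lambda>k. inner (p k x) (h k)) \<longlongrightarrow> inner (P0 x) x) F"
  proof -
    have "((\<lambda>k. inner (p k x - P0 x) (h k) + inner (h k) (P0 x)) \<longlongrightarrow> 0 + inner x (P0 x)) F"
      using tendsto_mono[OF F p[of x]] by (intro tendsto_add small xl) (simp add: LIM_zero)
    thus ?thesis by (simp add: inner_simps inner_commute)
  qed
  have pxx: "((\<lambda>k. inner (p k x) x) \<longlongrightarrow> inner (P0 x) x) F"
    using tendsto_mono[OF F p[of x]] by (intro tendsto_inner tendsto_const)
  have cF: "(c \<longlongrightarrow> m) F" using tendsto_mono[OF F c(2)] .
  have c': "inner (p k (h k)) (h k) + inner ((q k - Q0) (h k)) (h k) + inner (Q0 (h k)) (h k) \<le> c k" for k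
    using c(1)[of k] by (simp add: blinfun.add_left blinfun.diff_left inner_simps)
  show ?thesis
  proof (rule that)
    fix M :: "'a set" assume M: "closed M" "subspace M" "\<And>k. h k \<in> M"
    \<comment> \<open>Closed subspaces are weakly closed: every \<open>h k\<close> is orthogonal to
      the part of \<open>x\<close> normal to \<open>M\<close>, and orthogonality passes to the weak
      limit.\<close>
    have "inner x (x - orth_proj M x) = 0"
    proof (rule tendsto_unique[OF nb xl])
      have "inner (h k) (x - orth_proj M x) = 0" for k
        using orth_proj_orth[OF M(1,2) M(3), of x] by (simp add: inner_commute)
      thus "((\<lambda>i. inner (h i) (x - orth_proj M x)) \<longlongrightarrow> 0) F" by simp
    qed
    moreover have "inner (x - orth_proj M x) (orth_proj M x) = 0"
      using orth_proj_orth[OF M(1,2) orth_proj_in[OF M(1,2)]] .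
    ultimately have "inner (x - orth_proj M x) (x - orth_proj M x) = 0"
      by (simp add: inner_simps inner_commute)
    thus "x \<in> M" using orth_proj_in[OF M(1,2), of x] by simp
  next
    have "inner x x \<le> norm x"
      by (rule tendsto_le[OF nb tendsto_const xl]) (use bnd in \<open>auto intro!: always_eventually simp: abs_le_iff inner_commute\<close>)
    hence "norm x * norm x \<le> norm x * 1" by (simp add: power2_norm_eq_inner flip: power2_eq_square)
    thus "norm x \<le> 1" by (metis linorder_not_less mult_less_cancel_left_pos norm_le_zero_iff not_le zero_le_one order_trans)
  next
    have "((\<lambda>k. 2 * inner (p k x) (h k) - inner (p k x) x + inner ((q k - Q0) (h k)) (h k) + inner (Q0 (h k)) (h k))
       \<longlongrightarrow> 2 * inner (P0 x) x - inner (P0 x) x + 0 + inner (Q0 x) x) F"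
      by (intro tendsto_intros plim pxx qlim Qlim)
    moreover have "2 * inner (p k x) (h k) - inner (p k x) x \<le> inner (p k (h k)) (h k)" for k
    proof -
      have "0 \<le> inner (p k (h k - x)) (h k - x)"
        using coercive(1)[of "h k - x" k] coercive(2) by (smt (verit) mult_nonneg_nonneg zero_le_power2)
      moreover have "inner (p k (h k)) x = inner (p k x) (h k)"
        using sa(1)[of k] by (simp add: self_adjoint_def inner_commute)
      ultimately show ?thesis by (simp add: blinfun.diff_right inner_simps)
    qed
    hence "2 * inner (p k x) (h k) - inner (p k x) x + inner ((q k - Q0) (h k)) (h k) + inner (Q0 (h k)) (h k) \<le> c k" for k
      using c'[of k] by (smt (verit))
    ultimately have "2 * inner (P0 x) x - inner (P0 x) x + 0 + inner (Q0 x) x \<le> m"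
      by (intro tendsto_le[OF nb cF]) auto
    thus "inner ((P0 + Q0) x) x \<le> m" by (simp add: blinfun.add_left inner_simps)
  next
    \<comment> \<open>If the weak limit vanishes, the contributions of \<open>q k\<close> vanish in
      the limit, and coercivity on the unit vectors \<open>h k\<close> is what remains.\<close>
    assume "x = 0"
    hence "((\<lambda>k. C + inner ((q k - Q0) (h k)) (h k) + inner (Q0 (h k)) (h k)) \<longlongrightarrow> C + 0 + 0) F"
      using Qlim by (intro tendsto_intros qlim) (simp add: blinfun.zero_right)
    moreover have "C + inner ((q k - Q0) (h k)) (h k) + inner (Q0 (h k)) (h k) \<le> c k" for k
      using c'[of k] coercive(1)[of "h k" k] h by simp
    ultimately have "C + 0 + 0 \<le> m" by (intro tendsto_le[OF nb cF]) auto
    thus "C \<le> m" by simp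
  qed
qed

text \<open>Serves as the Euler equation of extremal problems, with \<open>t\<close> the parameter
  of the variation. At \<open>t = - a / d\<close>, where \<open>d\<close> is positive and at least
  \<open>b\<close>, the quadratic is at most \<open>- a^2 / d\<close>.\<close>

lemma linear_coefficient_zero:
  fixes a b :: real
  assumes "\<And>t. 0 \<le> 2 * t * a + t\<^sup>2 * b"
  shows "a = 0"
proof -
  define d where "d = \<bar>b\<bar> + 1"
  have d: "d > 0" "b \<le> d" by (auto simp: d_def)
  have "0 \<le> 2 * (- a / d) * a + (- a / d)\<^sup>2 * b" by (rule assms)
  also have "\<dots> \<le> 2 * (- a / d) * a + (- a / d)\<^sup>2 * d"
    using d by (intro add_left_mono mult_left_mono) auto
  also have "\<dots> = - (a\<^sup>2 / d)" using d by (simp add: field_simps power2_eq_square)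
  finally show ?thesis using d by (simp add: divide_le_0_iff)
qed

text \<open>Test the Euler equation of a maximiser \<open>w\<close> of \<open>|\<pi> w|\<close> on the unit sphere of \<open>M1\<close>, with \<open>\<pi>\<close> the
  projection onto \<open>M2\<close>, against \<open>T w\<close>.\<close>

lemma invariant_subspaces_orthogonal:
  fixes T :: "'a::{real_inner, banach} \<Rightarrow>\<^sub>L 'a"
  assumes T: "self_adjoint T"
    and M1: "subspace M1" "T ` M1 \<subseteq> M1" "compact (M1 \<inter> sphere 0 1)" "\<And>x. x \<in> M1 \<Longrightarrow> inner (T x) x \<le> 0"
    and M2: "closed M2" "subspace M2" "T ` M2 \<subseteq> M2" "\<And>x. x \<in> M2 \<Longrightarrow> x \<noteq> 0 \<Longrightarrow> 0 < inner (T x) x"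
    and x: "x \<in> M1" and y: "y \<in> M2"
  shows "inner x y = 0"
proof (cases "x = 0")
  case False
  let ?\<pi> = "orth_proj M2"
  interpret \<pi>: bounded_linear ?\<pi> by (rule bounded_linear_orth_proj[OF M2(1,2)])
  have "(1 / norm x) *\<^sub>R x \<in> M1 \<inter> sphere 0 1" using x False M1(1) by (simp add: subspace_scale)
  moreover have "continuous_on (M1 \<inter> sphere 0 1) (\<lambda>v. (norm (?\<pi> v))\<^sup>2)"
    by (intro continuous_intros \<pi>.continuous_on)
  ultimately have "\<exists>w\<in>M1 \<inter> sphere 0 1. \<forall>v\<in>M1 \<inter> sphere 0 1. (norm (?\<pi> v))\<^sup>2 \<le> (norm (?\<pi> w))\<^sup>2"
    by (intro continuous_attains_sup[OF M1(3)]) auto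
  then obtain w where w: "w \<in> M1" "norm w = 1"
    and sup: "\<And>v. v \<in> M1 \<Longrightarrow> norm v = 1 \<Longrightarrow> (norm (?\<pi> v))\<^sup>2 \<le> (norm (?\<pi> w))\<^sup>2"
    by (metis IntD1 IntD2 IntI mem_sphere_0)
  define c where "c = (norm (?\<pi> w))\<^sup>2"
  have le: "(norm (?\<pi> v))\<^sup>2 \<le> c * (norm v)\<^sup>2" if "v \<in> M1" for v
  proof (cases "v = 0")
    case False
    have "(norm (?\<pi> ((1 / norm v) *\<^sub>R v)))\<^sup>2 \<le> c"
      unfolding c_def using False that M1(1) by (intro sup) (auto simp: subspace_scale)
    thus ?thesis using False by (simp add: \<pi>.scaleR power_mult_distrib field_simps)
  qed (simp add: \<pi>.zero)
  have Tw: "T w \<in> M1" using M1(2) w by blast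
  have "c * inner w (T w) - inner (?\<pi> w) (?\<pi> (T w)) = 0"
  proof (rule linear_coefficient_zero)
    fix t :: real
    have "(norm (?\<pi> (w + t *\<^sub>R T w)))\<^sup>2 \<le> c * (norm (w + t *\<^sub>R T w))\<^sup>2"
      using w(1) Tw M1(1) by (intro le) (simp add: subspace_add subspace_scale)
    hence "0 \<le> c * (norm w)\<^sup>2 - (norm (?\<pi> w))\<^sup>2 + 2 * t * (c * inner w (T w) - inner (?\<pi> w) (?\<pi> (T w)))
        + t\<^sup>2 * (c * (norm (T w))\<^sup>2 - (norm (?\<pi> (T w)))\<^sup>2)"
      unfolding power2_norm_eq_inner
      by (simp add: \<pi>.add \<pi>.scaleR inner_simps inner_commute algebra_simps power2_eq_square)
    thus "0 \<le> 2 * t * (c * inner w (T w) - inner (?\<pi> w) (?\<pi> (T w)))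
        + t\<^sup>2 * (c * (norm (T w))\<^sup>2 - (norm (?\<pi> (T w)))\<^sup>2)"
      using w(2) by (simp add: c_def)
  qed
  moreover have "inner (?\<pi> w) (?\<pi> (T w)) = inner (T (?\<pi> w)) (?\<pi> w)"
  proof -
    have \<pi>w: "?\<pi> w \<in> M2" "T (?\<pi> w) \<in> M2" using orth_proj_in[OF M2(1,2)] M2(3) by blast+
    have "inner (?\<pi> w) (?\<pi> (T w)) = inner (T w) (?\<pi> w)"
      by (metis inner_orth_proj[OF M2(1,2) \<pi>w(1)] inner_commute)
    also have "\<dots> = inner w (T (?\<pi> w))" using T by (simp add: self_adjoint_def)
    also have "\<dots> = inner (T (?\<pi> w)) (?\<pi> w)"
      by (metis inner_orth_proj[OF M2(1,2) \<pi>w(2)] inner_commute)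
    finally show ?thesis .
  qed
  \<comment> \<open>The Euler equation equates this nonpositive number with the form of
    \<open>T\<close> at \<open>?\<pi> w\<close>, which is positive unless
    \<open>?\<pi> w = 0\<close>. As \<open>w\<close> is a maximiser, the projection then annihilates
    all of \<open>M1\<close>.\<close>
  moreover have "c * inner w (T w) \<le> 0"
    using M1(4)[OF w(1)] by (simp add: c_def inner_commute mult_nonneg_nonpos)
  ultimately have "?\<pi> w = 0"
    using M2(4)[of "?\<pi> w"] orth_proj_in[OF M2(1,2)] by force
  hence "?\<pi> x = 0" using le[OF x] by (simp add: c_def)
  thus ?thesis using inner_orth_proj[OF M2(1,2) y, of x] by simp
qed simp

section \<open>Eigenvectors and sign-definite invariant subspaces of \<open>P + Q\<close>\<close>

locale coercive_plus_compact =
  fixes P Q :: "'a::{real_inner, banach} \<Rightarrow>\<^sub>L 'a" and C :: real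
  assumes sa_P: "self_adjoint P" and sa_Q: "self_adjoint Q" and cpt_Q: "compact_operator Q"
    and C_pos: "0 < C" and coercive_P: "\<And>u. C * (norm u)\<^sup>2 \<le> inner (P u) u"
begin

abbreviation "A \<equiv> P + Q"

lemma inner_A_commute: "inner (A x) y = inner x (A y)"
  using sa_P sa_Q by (simp add: self_adjoint_def blinfun.add_left inner_simps)

text \<open>The infimum \<open>m\<close> of the form on the unit sphere of \<open>M\<close> is
  attained without compactness of the sphere: a vanishing weak limit of a minimising sequence would
  give \<open>C \<le> m\<close>, against \<open>m \<le> 0\<close>. Invariance of \<open>M\<close>
  turns the Euler equation of the minimiser into an eigenvalue equation.\<close>

lemma nonpositive_eigenvector:
  assumes M: "closed M" "subspace M" "A ` M \<subseteq> M" and u: "u \<in> M" "u \<noteq> 0" "inner (A u) u \<le> 0"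
  obtains e l where "e \<in> M" "e \<noteq> 0" "A e = l *\<^sub>R e" "l \<le> 0"
proof -
  let ?S = "M \<inter> sphere 0 1"
  define m where "m = (INF v\<in>?S. inner (A v) v)"
  have bdd: "bdd_below ((\<lambda>v. inner (A v) v) ` ?S)"
  proof (rule bdd_belowI2)
    fix v assume "v \<in> ?S"
    hence "\<bar>inner (A v) v\<bar> \<le> norm A"
      using Cauchy_Schwarz_ineq2[of "A v" v] norm_blinfun[of A v] by simp
    thus "- norm A \<le> inner (A v) v" by simp
  qed
  have uS: "(1 / norm u) *\<^sub>R u \<in> ?S" using u M by (simp add: subspace_scale)
  hence ne: "?S \<noteq> {}" by blast
  have m_le: "m * (norm v)\<^sup>2 \<le> inner (A v) v" if "v \<in> M" for v
  proof (cases "v = 0")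
    case False
    have "(1 / norm v) *\<^sub>R v \<in> ?S" using that False M by (simp add: subspace_scale)
    hence "m \<le> inner (A ((1 / norm v) *\<^sub>R v)) ((1 / norm v) *\<^sub>R v)"
      unfolding m_def by (rule cINF_lower[OF bdd])
    thus ?thesis using False by (simp add: blinfun.scaleR_right field_simps power2_eq_square)
  qed (simp add: blinfun.zero_right)
  have m0: "m \<le> 0"
  proof -
    have "m * (norm u)\<^sup>2 \<le> 0" using m_le[OF u(1)] u(3) by simp
    thus ?thesis using u(2) by (simp add: mult_le_0_iff)
  qed
  have "\<exists>v\<in>?S. inner (A v) v \<le> m + 1 / real (Suc k)" for k
  proof -
    have "m < m + 1 / real (Suc k)" by simp
    thus ?thesis unfolding m_def using cINF_less_iff[OF ne bdd] less_imp_le by blast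
  qed
  then obtain h where h: "\<And>k. h k \<in> ?S" "\<And>k. inner (A (h k)) (h k) \<le> m + 1 / real (Suc k)" by metis
  have lim: "(\<lambda>k. m + 1 / real (Suc k)) \<longlonglongrightarrow> m"
    using tendsto_add[OF tendsto_const[of m] LIMSEQ_inverse_real_of_nat] by (simp add: inverse_eq_divide)
  have h1: "norm (h k) = 1" for k using h(1)[of k] by simp
  obtain e where e: "\<And>M. closed M \<Longrightarrow> subspace M \<Longrightarrow> (\<And>k. h k \<in> M) \<Longrightarrow> e \<in> M"
    "norm e \<le> 1" "inner (A e) e \<le> m" "e = 0 \<Longrightarrow> C \<le> m"
    using weak_limit_of_forms[of "\<lambda>_. P" P "\<lambda>_. Q" Q C h "\<lambda>k. m + 1 / real (Suc k)" m]
      sa_P sa_Q cpt_Q coercive_P C_pos h1 h(2) lim by (metis less_imp_le tendsto_const)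
  have eM: "e \<in> M" using e(1) M h(1) by blast
  have e0: "e \<noteq> 0" using e(4) m0 C_pos by auto
  \<comment> \<open>A weak limit is only known to have norm at most 1; as \<open>m\<close> is not
    positive, the inequality still goes the right way.\<close>
  have "m * 1 \<le> m * (norm e)\<^sup>2"
    using m0 e(2) by (intro mult_left_mono_neg) (simp_all add: power_le_one)
  hence nul: "inner (A e) e - m * (norm e)\<^sup>2 \<le> 0" using e(3) by simp
  have "inner (A e - m *\<^sub>R e) w = 0" if w: "w \<in> M" for w
  proof -
    have pos: "0 \<le> 2 * t * inner (A e - m *\<^sub>R e) w + t\<^sup>2 * (inner (A w) w - m * (norm w)\<^sup>2)" for t
    proof -
      have "m * (norm (e + t *\<^sub>R w))\<^sup>2 \<le> inner (A (e + t *\<^sub>R w)) (e + t *\<^sub>R w)"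
        using M eM w by (intro m_le) (simp add: subspace_add subspace_scale)
      moreover have "inner (A w) e = inner (A e) w" by (metis inner_A_commute inner_commute)
      ultimately have "0 \<le> (inner (A e) e - m * (norm e)\<^sup>2) + 2 * t * inner (A e - m *\<^sub>R e) w + t\<^sup>2 * (inner (A w) w - m * (norm w)\<^sup>2)"
        unfolding power2_norm_eq_inner
        by (simp add: blinfun.add_right blinfun.scaleR_right inner_simps inner_commute algebra_simps power2_eq_square)
      thus ?thesis using nul by linarith
    qed
    show ?thesis by (rule linear_coefficient_zero[OF pos])
  qed
  moreover have "A e - m *\<^sub>R e \<in> M" using M eM by (meson image_subset_iff subspace_diff subspace_scale)
  ultimately have "A e = m *\<^sub>R e" by (metis eq_iff_diff_eq_0 inner_eq_zero_iff)
  thus ?thesis using that eM e0 m0 by blast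
qed

text \<open>Where the form is nonpositive, coercivity of \<open>P\<close> forces
  \<open>C * norm u \<le> norm (Q u)\<close>. So \<open>Q\<close> is bounded below on
  \<open>M\<close>, and a sequence there is Cauchy as soon as its images under \<open>Q\<close>
  are.\<close>

lemma compact_sphere_nonpositive:
  assumes M: "closed M" "subspace M" and nonpos: "\<And>u. u \<in> M \<Longrightarrow> inner (A u) u \<le> 0"
  shows "compact (M \<inter> sphere 0 1)"
proof -
  have bound: "C * norm u \<le> norm (Q u)" if "u \<in> M" for u
  proof -
    have "C * (norm u)\<^sup>2 \<le> - inner (Q u) u"
      using nonpos[OF that] coercive_P[of u] by (simp add: blinfun.add_left inner_simps)
    also have "\<dots> \<le> norm (Q u) * norm u" using Cauchy_Schwarz_ineq2[of "Q u" u] by linarith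
    finally have "C * norm u * norm u \<le> norm (Q u) * norm u" by (simp add: power2_eq_square mult.assoc)
    thus ?thesis by (cases "u = 0") auto
  qed
  show ?thesis unfolding compact_eq_seq_compact_metric
  proof (rule seq_compactI)
    fix f :: "nat \<Rightarrow> 'a" assume f: "\<forall>n. f n \<in> M \<inter> sphere 0 1"
    let ?K = "closure (blinfun_apply Q ` cball 0 1)"
    have "compact ?K" using cpt_Q unfolding compact_operator_def by simp
    moreover have "\<forall>n. Q (f n) \<in> ?K" using f by (intro allI subsetD[OF closure_subset]) auto
    ultimately obtain r l where r: "strict_mono r" "((\<lambda>n. Q (f n)) \<circ> r) \<longlonglongrightarrow> l"
      unfolding compact_eq_seq_compact_metric seq_compact_def by metis
    hence cau: "Cauchy ((\<lambda>n. Q (f n)) \<circ> r)" using LIMSEQ_imp_Cauchy by blast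
    have "Cauchy (f \<circ> r)"
    proof (rule metric_CauchyI)
      fix e :: real assume "0 < e"
      hence "0 < C * e" using C_pos by simp
      then obtain N where N: "\<And>m n. m \<ge> N \<Longrightarrow> n \<ge> N \<Longrightarrow> dist (((\<lambda>n. Q (f n)) \<circ> r) m) (((\<lambda>n. Q (f n)) \<circ> r) n) < C * e"
        using metric_CauchyD[OF cau] by blast
      have "dist ((f \<circ> r) m) ((f \<circ> r) n) < e" if "m \<ge> N" "n \<ge> N" for m n
      proof -
        have "f (r m) - f (r n) \<in> M" using f M by (meson IntD1 subspace_diff)
        hence "C * norm (f (r m) - f (r n)) \<le> norm (Q (f (r m)) - Q (f (r n)))"
          using bound by (simp flip: blinfun.diff_right)
        also have "\<dots> < C * e" using N[OF that] by (simp add: dist_norm)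
        finally show ?thesis using C_pos by (simp add: dist_norm)
      qed
      thus "\<exists>M. \<forall>m\<ge>M. \<forall>n\<ge>M. dist ((f \<circ> r) m) ((f \<circ> r) n) < e" by blast
    qed
    then obtain p where p: "(f \<circ> r) \<longlonglongrightarrow> p" using Cauchy_convergent convergent_def by blast
    have "closed {u::'a. norm u = 1}" by (rule closed_Collect_eq) (intro continuous_intros)+
    moreover have "sphere 0 1 = {u::'a. norm u = 1}" by auto
    ultimately have "closed (M \<inter> sphere 0 1)" using M by auto
    hence "p \<in> M \<inter> sphere 0 1" using closed_sequentially p f by (metis comp_apply)
    thus "\<exists>l\<in>M \<inter> sphere 0 1. \<exists>r. strict_mono r \<and> (f \<circ> r) \<longlonglongrightarrow> l" using p r by blast
  qed
qed

text \<open>Zorn's lemma takes the place of a spectral projection. If the form were not positive on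
  the complement, \<open>nonpositive_eigenvector\<close> would supply there an eigenvector with
  eigenvalue at most 0, and adjoining it would enlarge \<open>W\<close>.\<close>

lemma maximal_nonpositive_subspace:
  obtains W where "closed W" "subspace W" "A ` W \<subseteq> W" "\<And>x. x \<in> W \<Longrightarrow> inner (A x) x \<le> 0"
    and "\<And>x. x \<in> W\<^sup>\<bottom> \<Longrightarrow> x \<noteq> 0 \<Longrightarrow> 0 < inner (A x) x"
proof -
  define \<F> where "\<F> = {M. subspace M \<and> A ` M \<subseteq> M \<and> (\<forall>x\<in>M. inner (A x) x \<le> 0)}"
  have z: "{0} \<in> \<F>" by (simp add: \<F>_def blinfun.zero_right)
  have "\<exists>M\<in>\<F>. \<forall>X\<in>\<F>. M \<subseteq> X \<longrightarrow> X = M"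
  proof (rule subset_Zorn_nonempty)
    fix \<C> assume ne: "\<C> \<noteq> {}" and ch: "subset.chain \<F> \<C>"
    have sub: "\<And>M. M \<in> \<C> \<Longrightarrow> subspace M \<and> A ` M \<subseteq> M \<and> (\<forall>x\<in>M. inner (A x) x \<le> 0)"
      using ch unfolding subset.chain_def \<F>_def by blast
    have "subspace (\<Union>\<C>)"
    proof (rule subspaceI)
      show "0 \<in> \<Union>\<C>" using ne sub subspace_0 by blast
      show "c *\<^sub>R x \<in> \<Union>\<C>" if "x \<in> \<Union>\<C>" for c x using that sub subspace_scale by blast
      fix x y assume "x \<in> \<Union>\<C>" "y \<in> \<Union>\<C>"
      then obtain X Y where XY: "x \<in> X" "X \<in> \<C>" "y \<in> Y" "Y \<in> \<C>" by blast
      hence "X \<subseteq> Y \<or> Y \<subseteq> X" using ch unfolding subset.chain_def by blast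
      thus "x + y \<in> \<Union>\<C>" using XY sub subspace_add by (metis UnionI subsetD)
    qed
    thus "\<Union>\<C> \<in> \<F>" unfolding \<F>_def using sub by fast
  qed (use z in blast)
  then obtain W where W: "W \<in> \<F>" and max: "\<And>X. X \<in> \<F> \<Longrightarrow> W \<subseteq> X \<Longrightarrow> X = W" by blast
  have W': "subspace W" "A ` W \<subseteq> W" "\<And>x. x \<in> W \<Longrightarrow> inner (A x) x \<le> 0"
    using W by (auto simp: \<F>_def)
  \<comment> \<open>Closedness is not part of \<open>\<F>\<close>, because a union of a chain of
    closed subspaces need not be closed; it is recovered from maximality.\<close>
  have "closure W \<in> \<F>"
    unfolding \<F>_def
  proof (intro CollectI conjI ballI)
    show "subspace (closure W)"
    proof (rule subspaceI)
      show "0 \<in> closure W" using subspace_0[OF W'(1)] closure_subset by blast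
      fix x y c assume x: "x \<in> closure W"
      obtain f where f: "\<And>n. f n \<in> W" "f \<longlonglongrightarrow> x" using x closure_sequential by metis
      show "c *\<^sub>R x \<in> closure W" unfolding closure_sequential
        using f W'(1) by (intro exI[of _ "\<lambda>n. c *\<^sub>R f n"]) (auto intro!: subspace_scale tendsto_intros)
      assume y: "y \<in> closure W"
      obtain g where g: "\<And>n. g n \<in> W" "g \<longlonglongrightarrow> y" using y closure_sequential by metis
      show "x + y \<in> closure W" unfolding closure_sequential
        using f g W'(1) by (intro exI[of _ "\<lambda>n. f n + g n"]) (auto intro!: subspace_add tendsto_intros)
    qed
    have "A ` closure W \<subseteq> closure (A ` W)"
      by (rule image_closure_subset) (auto intro!: continuous_intros simp: closure_subset)
    thus "A ` closure W \<subseteq> closure W" using closure_mono[OF W'(2)] by blast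
    have "closed {x. inner (A x) x \<le> 0}"
      by (rule closed_Collect_le) (intro continuous_intros)+
    moreover have "W \<subseteq> {x. inner (A x) x \<le> 0}" using W'(3) by blast
    ultimately have "closure W \<subseteq> {x. inner (A x) x \<le> 0}" by (rule closure_minimal[rotated])
    thus "inner (A x) x \<le> 0" if "x \<in> closure W" for x using that by blast
  qed
  hence "closure W = W" using max closure_subset by blast
  hence cl: "closed W" by (metis closed_closure)
  have inv: "A ` (W\<^sup>\<bottom>) \<subseteq> W\<^sup>\<bottom>"
    using W'(2) by (auto simp: mem_orthogonal_comp inner_A_commute image_subset_iff)
  have "0 < inner (A x) x" if x: "x \<in> W\<^sup>\<bottom>" "x \<noteq> 0" for x
  proof (rule ccontr)
    assume "\<not> ?thesis"
    then obtain e l where e: "e \<in> W\<^sup>\<bottom>" "e \<noteq> 0" "A e = l *\<^sub>R e" "l \<le> 0"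
      using nonpositive_eigenvector[OF closed_orthogonal_comp subspace_orthogonal_comp inv x] by auto
    define X where "X = {w + v | w v. w \<in> W \<and> v \<in> span {e}}"
    have X: "x \<in> X \<longleftrightarrow> (\<exists>w t. w \<in> W \<and> x = w + t *\<^sub>R e)" for x
      unfolding X_def span_singleton by auto
    have "X \<in> \<F>"
      unfolding \<F>_def
    proof (intro CollectI conjI ballI)
      show "subspace X" unfolding X_def using W'(1) by (intro subspace_sums) auto
      show "A ` X \<subseteq> X"
      proof
        fix y assume "y \<in> A ` X"
        then obtain w t where "w \<in> W" "y = A (w + t *\<^sub>R e)" using X by auto
        hence "A w \<in> W" "y = A w + (t * l) *\<^sub>R e"
          using W'(2) e(3) by (auto simp: blinfun.add_right blinfun.scaleR_right)
        thus "y \<in> X" using X by blast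
      qed
      fix y assume "y \<in> X"
      then obtain w t where w: "w \<in> W" "y = w + t *\<^sub>R e" using X by auto
      have "A w \<in> W" using w W'(2) by blast
      hence o: "inner (A w) e = 0" "inner e w = 0"
        using e(1) w(1) by (auto simp: mem_orthogonal_comp inner_commute)
      have "inner (A y) y = inner (A w) w + t\<^sup>2 * l * inner e e"
        using o unfolding w(2) blinfun.add_right blinfun.scaleR_right e(3)
        by (simp add: inner_simps inner_commute algebra_simps power2_eq_square)
      also have "\<dots> \<le> 0"
        using W'(3)[OF w(1)] e(4) by (simp add: add_nonpos_nonpos mult_nonneg_nonpos mult_nonpos_nonneg)
      finally show "inner (A y) y \<le> 0" .
    qed
    moreover have "W \<subseteq> X" using X by (metis add.right_neutral scaleR_zero_left subsetI)
    ultimately have "X = W" by (rule max)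
    moreover have "e \<in> X" using X[of e] subspace_0[OF W'(1)] by (metis add_0 scaleR_one)
    ultimately have "inner e e = 0" using e(1) by (simp add: mem_orthogonal_comp)
    thus False using e(2) by simp
  qed
  thus ?thesis using that cl W' by blast
qed

text \<open>Identifies the unions \<open>pos_space A\<close> and \<open>neg_space A\<close> with
  concrete closed subspaces: the complement of the maximal nonpositive \<open>W\<close>, and the
  part of \<open>W\<close> orthogonal to the null space. Those subspaces are members of the defining
  families; that no member reaches further is the orthogonality of invariant subspaces of opposite
  sign.\<close>

lemma
  shows closed_null_space: "closed (null_space A)" and subspace_null_space: "subspace (null_space A)"
    and closed_pos_space: "closed (pos_space A)" and subspace_pos_space: "subspace (pos_space A)"
    and closed_neg_space: "closed (neg_space A)" and subspace_neg_space: "subspace (neg_space A)"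
    and pos_space_pos: "x \<in> pos_space A \<Longrightarrow> x \<noteq> 0 \<Longrightarrow> 0 < inner (A x) x"
    and neg_space_neg: "x \<in> neg_space A \<Longrightarrow> x \<noteq> 0 \<Longrightarrow> inner (A x) x < 0"
    and null_pos_orthogonal: "x \<in> null_space A \<Longrightarrow> y \<in> pos_space A \<Longrightarrow> inner x y = 0"
    and null_neg_orthogonal: "x \<in> null_space A \<Longrightarrow> y \<in> neg_space A \<Longrightarrow> inner x y = 0"
    and pos_neg_orthogonal: "x \<in> pos_space A \<Longrightarrow> y \<in> neg_space A \<Longrightarrow> inner x y = 0"
    and splitting: "\<exists>z u v. z \<in> null_space A \<and> u \<in> pos_space A \<and> v \<in> neg_space A \<and> w = z + u + v"
proof -
  let ?N = "null_space A"
  have sa: "self_adjoint A" "self_adjoint (- A)"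
    unfolding self_adjoint_def blinfun.minus_left inner_minus_left inner_minus_right
    using inner_A_commute by auto
  have A_N: "A x = 0" if "x \<in> ?N" for x using that by (simp add: null_space_def)
  show clN: "closed ?N" unfolding null_space_def
    by (rule closed_Collect_eq) (intro continuous_intros)+
  show subN: "subspace ?N" unfolding null_space_def
    by (rule subspaceI) (auto simp: blinfun.zero_right blinfun.add_right blinfun.scaleR_right)
  obtain W where W: "closed W" "subspace W" "A ` W \<subseteq> W" "\<And>x. x \<in> W \<Longrightarrow> inner (A x) x \<le> 0"
    and Wp: "\<And>x. x \<in> W\<^sup>\<bottom> \<Longrightarrow> x \<noteq> 0 \<Longrightarrow> 0 < inner (A x) x"
    using maximal_nonpositive_subspace by blast
  have W_inv: "A ` (W\<^sup>\<bottom>) \<subseteq> W\<^sup>\<bottom>"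
    using W(3) by (auto simp: mem_orthogonal_comp inner_A_commute image_subset_iff)
  have NW: "?N \<subseteq> W"
  proof
    fix x assume x: "x \<in> ?N"
    \<comment> \<open>\<open>A\<close> maps this normal component into \<open>W\<close>, since
      \<open>A x = 0\<close> and \<open>W\<close> is invariant. So the form vanishes at
      \<open>p\<close>, and positivity on the complement gives \<open>p = 0\<close>.\<close>
    define p where "p = x - orth_proj W x"
    have pW: "p \<in> W\<^sup>\<bottom>" using orth_proj_orth[OF W(1,2)] by (auto simp: p_def mem_orthogonal_comp)
    have "A p = - A (orth_proj W x)" using A_N[OF x] by (simp add: p_def blinfun.diff_right)
    moreover have "A (orth_proj W x) \<in> W" using W orth_proj_in by blast
    moreover have "inner p (A (orth_proj W x)) = 0"
      using pW calculation(2) by (simp add: mem_orthogonal_comp)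
    ultimately have "inner (A p) p = 0" by (metis inner_commute inner_minus_right neg_0_equal_iff_equal)
    hence "p = 0" using Wp[OF pW] by auto
    thus "x \<in> W" using orth_proj_in[OF W(1,2), of x] by (simp add: p_def)
  qed
  define D where "D = W \<inter> ?N\<^sup>\<bottom>"
  have D: "closed D" "subspace D" unfolding D_def
    using W by (auto intro: closed_Int closed_orthogonal_comp subspace_inter subspace_orthogonal_comp)
  have D_inv: "A ` D \<subseteq> D"
    using W(3) A_N by (auto simp: D_def mem_orthogonal_comp inner_A_commute image_subset_iff)
  \<comment> \<open>A zero of the form in \<open>W\<close> is a maximum of the form on
    \<open>W\<close>; the Euler equation in the direction \<open>A x\<close> yields
    \<open>A x = 0\<close>.\<close>
  have D_neg: "inner (A x) x < 0" if x: "x \<in> D" "x \<noteq> 0" for x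
  proof (rule ccontr)
    have xW: "x \<in> W" "A x \<in> W" using x W(3) by (auto simp: D_def)
    assume "\<not> ?thesis"
    hence 0: "inner (A x) x = 0" using W(4)[OF xW(1)] by simp
    have "- inner (A x) (A x) = 0"
    proof (rule linear_coefficient_zero)
      fix t :: real
      have "inner (A (x + t *\<^sub>R A x)) (x + t *\<^sub>R A x) \<le> 0"
        using xW W(2) by (intro W(4)) (simp add: subspace_add subspace_scale)
      moreover have "inner (A (A x)) x = inner (A x) (A x)" by (rule inner_A_commute)
      ultimately show "0 \<le> 2 * t * - inner (A x) (A x) + t\<^sup>2 * - inner (A (A x)) (A x)"
        using 0 unfolding blinfun.add_right blinfun.scaleR_right
        by (simp add: inner_add_left inner_add_right power2_eq_square algebra_simps)
    qed
    hence "x \<in> ?N" by (simp add: null_space_def)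
    thus False using x by (auto simp: D_def mem_orthogonal_comp)
  qed
  have split: "\<exists>z u v. z \<in> ?N \<and> u \<in> W\<^sup>\<bottom> \<and> v \<in> D \<and> w = z + u + v" for w
  proof -
    define a where "a = orth_proj W w"
    define z where "z = orth_proj ?N a"
    have "a \<in> W" using W orth_proj_in by (auto simp: a_def)
    moreover have z: "z \<in> ?N" unfolding z_def using clN subN by (rule orth_proj_in)
    moreover have "a - z \<in> ?N\<^sup>\<bottom>"
      using orth_proj_orth[OF clN subN] by (auto simp: z_def mem_orthogonal_comp)
    ultimately have "a - z \<in> D" using NW W(2) by (auto simp: D_def subspace_diff)
    moreover have "w - a \<in> W\<^sup>\<bottom>"
      using orth_proj_orth[OF W(1,2)] by (auto simp: a_def mem_orthogonal_comp)
    moreover have "w = z + (w - a) + (a - z)" by simp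
    ultimately show ?thesis using z by blast
  qed
  have cptW: "compact (W \<inter> sphere 0 1)" by (rule compact_sphere_nonpositive[OF W(1,2,4)])
  have cptN: "compact (?N \<inter> sphere 0 1)"
    by (rule compact_sphere_nonpositive[OF clN subN]) (simp add: A_N)
  have pos: "pos_space A = W\<^sup>\<bottom>"
  proof
    show "W\<^sup>\<bottom> \<subseteq> pos_space A" unfolding pos_space_def
      using Wp W_inv closed_orthogonal_comp subspace_orthogonal_comp by blast
    have "inner x y = 0" if M: "subspace M" "closed M" "A ` M \<subseteq> M" "\<forall>x\<in>M. x \<noteq> 0 \<longrightarrow> 0 < inner (A x) x"
      "x \<in> M" and y: "y \<in> W" for M x y
      using invariant_subspaces_orthogonal[OF sa(1) W(2,3) cptW W(4) M(2,1,3) _ y M(5)] M(4)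
      by (simp add: inner_commute)
    thus "pos_space A \<subseteq> W\<^sup>\<bottom>" unfolding pos_space_def by (auto simp: mem_orthogonal_comp)
  qed
  have neg: "neg_space A = D"
  proof
    show "D \<subseteq> neg_space A" unfolding neg_space_def using D D_inv D_neg by blast
    show "neg_space A \<subseteq> D"
    proof
      fix x assume "x \<in> neg_space A"
      then obtain M where M: "subspace M" "closed M" "A ` M \<subseteq> M" "\<forall>x\<in>M. x \<noteq> 0 \<longrightarrow> inner (A x) x < 0"
        "x \<in> M" unfolding neg_space_def by blast
      have Mle: "inner (A v) v \<le> 0" if "v \<in> M" for v
        using M(4) that by (cases "v = 0") (auto simp: blinfun.zero_right less_imp_le)
      have cptM: "compact (M \<inter> sphere 0 1)" by (rule compact_sphere_nonpositive[OF M(2,1) Mle])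
      have 1: "inner x y = 0" if "y \<in> W\<^sup>\<bottom>" for y
        using invariant_subspaces_orthogonal[OF sa(1) M(1,3) cptM Mle closed_orthogonal_comp
            subspace_orthogonal_comp W_inv Wp M(5) that] .
      \<comment> \<open>Applied to \<open>- A\<close>, for which the null space is the nonpositive
        and \<open>M\<close> the positive subspace.\<close>
      have 2: "inner y x = 0" if "y \<in> ?N" for y
      proof (rule invariant_subspaces_orthogonal[OF sa(2) subN _ cptN _ M(2,1) _ _ that M(5)])
        show "(- A) ` ?N \<subseteq> ?N" using A_N subspace_0[OF subN] unfolding image_subset_iff blinfun.minus_left by simp
        show "(- A) ` M \<subseteq> M" using M(1,3) unfolding image_subset_iff blinfun.minus_left by (blast intro: subspace_neg)
      qed (unfold blinfun.minus_left inner_minus_left, use A_N M(4) in auto)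
      obtain z u v where zuv: "z \<in> ?N" "u \<in> W\<^sup>\<bottom>" "v \<in> D" "x = z + u + v" using split by blast
      have "inner z u = 0" "inner z v = 0" "inner u v = 0"
        using zuv NW by (auto simp: mem_orthogonal_comp D_def inner_commute)
      hence "inner z z = 0" "inner u u = 0"
        using 1[OF zuv(2)] 2[OF zuv(1)] zuv(4) by (auto simp: inner_simps inner_commute)
      thus "x \<in> D" using zuv by simp
    qed
  qed
  show "closed (pos_space A)" "subspace (pos_space A)"
    unfolding pos by (rule closed_orthogonal_comp, rule subspace_orthogonal_comp)
  show "closed (neg_space A)" "subspace (neg_space A)" unfolding neg by (rule D)+
  show "x \<in> pos_space A \<Longrightarrow> x \<noteq> 0 \<Longrightarrow> 0 < inner (A x) x" unfolding pos by (rule Wp)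
  show "x \<in> neg_space A \<Longrightarrow> x \<noteq> 0 \<Longrightarrow> inner (A x) x < 0" unfolding neg by (rule D_neg)
  show "x \<in> null_space A \<Longrightarrow> y \<in> pos_space A \<Longrightarrow> inner x y = 0"
    unfolding pos using NW by (auto simp: mem_orthogonal_comp inner_commute)
  show "x \<in> null_space A \<Longrightarrow> y \<in> neg_space A \<Longrightarrow> inner x y = 0"
    unfolding neg by (auto simp: D_def mem_orthogonal_comp inner_commute)
  show "x \<in> pos_space A \<Longrightarrow> y \<in> neg_space A \<Longrightarrow> inner x y = 0"
    unfolding pos neg by (auto simp: D_def mem_orthogonal_comp)
  show "\<exists>z u v. z \<in> null_space A \<and> u \<in> pos_space A \<and> v \<in> neg_space A \<and> w = z + u + v"
    unfolding pos neg by (rule split)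
qed

end

section \<open>Local estimates\<close>

text \<open>Converts the sequential conditions (D2) and (D4) into statements on a ball. The index
  \<open>n\<close> plays two roles, constant to be found and position in the sequence:
  counterexamples to \<open>R n\<close> within distance \<open>1 / Suc n\<close> of the origin would
  form a null sequence violating \<open>R n (x n)\<close> for every \<open>n\<close>.\<close>

lemma ball_if_all_null_sequences:
  fixes V :: "'a::real_normed_vector set" and R :: "nat \<Rightarrow> 'a \<Rightarrow> bool"
  assumes "open V" "0 \<in> V"
    and "\<And>x. range x \<subseteq> V \<Longrightarrow> x \<longlonglongrightarrow> 0 \<Longrightarrow> \<exists>n. R n (x n)"
  obtains n \<rho> where "0 < \<rho>" "ball 0 \<rho> \<subseteq> V" "\<And>x. x \<in> ball 0 \<rho> \<Longrightarrow> R n x"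
proof -
  obtain \<rho>0 where \<rho>0: "0 < \<rho>0" "ball 0 \<rho>0 \<subseteq> V" using assms(1,2) openE by blast
  have "\<exists>n. \<forall>x\<in>ball 0 (min \<rho>0 (1 / real (Suc n))). R n x"
  proof (rule ccontr)
    assume "\<not> ?thesis"
    then obtain x where x: "\<And>n. x n \<in> ball 0 (min \<rho>0 (1 / real (Suc n)))" "\<And>n. \<not> R n (x n)" by metis
    have "x \<longlonglongrightarrow> 0"
    proof (rule metric_LIMSEQ_I)
      fix r :: real assume "0 < r"
      then obtain N where N: "1 / real (Suc N) < r" using nat_approx_posE by blast
      have "dist (x n) 0 < r" if "n \<ge> N" for n
      proof -
        have "dist (x n) 0 < 1 / real (Suc n)" using x(1)[of n] by (simp add: dist_commute)
        also have "\<dots> \<le> 1 / real (Suc N)" using that by (simp add: frac_le)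
        finally show ?thesis using N by simp
      qed
      thus "\<exists>no. \<forall>n\<ge>no. dist (x n) 0 < r" by blast
    qed
    moreover have "range x \<subseteq> V" using x(1) \<rho>0 by fastforce
    ultimately show False using assms(3) x(2) by blast
  qed
  then obtain n where n: "\<And>x. x \<in> ball 0 (min \<rho>0 (1 / real (Suc n))) \<Longrightarrow> R n x" by blast
  show ?thesis
    using \<rho>0 by (intro that[of "min \<rho>0 (1 / real (Suc n))" n] n) auto
qed

lemma form_bound_homogeneous:
  fixes T :: "'a::real_inner \<Rightarrow>\<^sub>L 'a"
  assumes "subspace M" and "\<And>u. u \<in> M \<Longrightarrow> norm u = 1 \<Longrightarrow> c \<le> inner (T u) u" and "u \<in> M"
  shows "c * (norm u)\<^sup>2 \<le> inner (T u) u"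
proof (cases "u = 0")
  case False
  have "c \<le> inner (T ((1 / norm u) *\<^sub>R u)) ((1 / norm u) *\<^sub>R u)"
    using False assms by (intro assms(2)) (auto simp: subspace_scale)
  thus ?thesis using False by (simp add: blinfun.scaleR_right field_simps power2_eq_square)
qed (simp add: blinfun.zero_right)

text \<open>All bounds come from null sequences by contradiction. On H+ a lower bound for the form
  is wanted, and weak lower semicontinuity delivers it. On H- an upper bound is wanted, for which
  weak limits do not suffice; there the compact unit sphere gives norm convergence.\<close>

lemma hypothesis_A_local_bounds:
  fixes V :: "'a::{real_inner, banach} set"
  assumes V: "open V" "0 \<in> V" and A: "hypothesis_A V L B P Q"
  obtains C \<rho> a K where "coercive_plus_compact (P 0) (Q 0) C" "0 < \<rho>" "0 < a" "ball 0 \<rho> \<subseteq> V"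
    and "\<And>x. x \<in> ball 0 \<rho> \<Longrightarrow> norm (B x) \<le> K"
    and "\<And>x h. x \<in> ball 0 \<rho> \<Longrightarrow> h \<in> pos_space (B 0) \<Longrightarrow> a * (norm h)\<^sup>2 \<le> inner (B x h) h"
    and "\<And>x h. x \<in> ball 0 \<rho> \<Longrightarrow> h \<in> neg_space (B 0) \<Longrightarrow> inner (B x h) h \<le> - a * (norm h)\<^sup>2"
proof -
  have BPQ: "B x = P x + Q x" if "x \<in> V" for x using A that by (simp add: hypothesis_A_def)
  have sa: "self_adjoint (P x)" "self_adjoint (Q x)" "compact_operator (Q x)" if "x \<in> V" for x
    using A that by (simp_all add: hypothesis_A_def positive_definite_op_def)
  have D2: "\<And>x u. range x \<subseteq> V \<Longrightarrow> x \<longlonglongrightarrow> 0 \<Longrightarrow> (\<lambda>k::nat. P (x k) u) \<longlonglongrightarrow> P 0 u"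
    using A by (simp add: hypothesis_A_def)
  have D3: "continuous (at 0 within V) Q" using A by (simp add: hypothesis_A_def)
  have D4: "\<exists>C0>0. \<exists>k0. \<forall>k\<ge>k0. \<forall>u. inner (P (x k) u) u \<ge> C0 * (norm u)\<^sup>2"
    if "range x \<subseteq> V" "x \<longlonglongrightarrow> 0" for x :: "nat \<Rightarrow> 'a" using A that by (simp add: hypothesis_A_def)
  have Qlim: "(\<lambda>k. Q (x k)) \<longlonglongrightarrow> Q 0" if "range x \<subseteq> V" "x \<longlonglongrightarrow> 0" for x :: "nat \<Rightarrow> 'a"
    using continuous_within_sequentially[THEN iffD1, OF D3] that by (auto simp: comp_def image_subset_iff)
  obtain n1 \<rho>1 where \<rho>1: "0 < \<rho>1" "ball 0 \<rho>1 \<subseteq> V"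
    and C: "\<And>x u. x \<in> ball 0 \<rho>1 \<Longrightarrow> 1 / real (Suc n1) * (norm u)\<^sup>2 \<le> inner (P x u) u"
  proof (rule ball_if_all_null_sequences[OF V, where R = "\<lambda>n x. \<forall>u. 1 / real (Suc n) * (norm u)\<^sup>2 \<le> inner (P x u) u"])
    fix x :: "nat \<Rightarrow> 'a" assume "range x \<subseteq> V" "x \<longlonglongrightarrow> 0"
    then obtain c k0 where c: "0 < c" "\<forall>k\<ge>k0. \<forall>u. c * (norm u)\<^sup>2 \<le> inner (P (x k) u) u"
      using D4 by blast
    obtain N where N: "1 / real (Suc N) < c" using nat_approx_posE[OF c(1)] by blast
    \<comment> \<open>One index has to serve both as denominator below \<open>c\<close> and as
      position beyond \<open>k0\<close>.\<close>
    define n where "n = max N k0"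
    have "1 / real (Suc n) \<le> 1 / real (Suc N)" by (simp add: n_def frac_le)
    hence "1 / real (Suc n) \<le> c" using N by linarith
    hence "1 / real (Suc n) * (norm u)\<^sup>2 \<le> inner (P (x n) u) u" for u
      using c(2) mult_right_mono[of "1 / real (Suc n)" c "(norm u)\<^sup>2"]
      by (metis max.cobounded2 n_def order_trans zero_le_power2)
    thus "\<exists>n. \<forall>u. 1 / real (Suc n) * (norm u)\<^sup>2 \<le> inner (P (x n) u) u" by blast
  qed blast
  define C0 where "C0 = 1 / real (Suc n1)"
  have C0: "0 < C0" by (simp add: C0_def)
  have coer: "C0 * (norm u)\<^sup>2 \<le> inner (P x u) u" if "x \<in> ball 0 \<rho>1" for x u
    using C[OF that] by (simp add: C0_def)
  interpret coercive_plus_compact "P 0" "Q 0" C0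
    using sa[OF V(2)] C0 coer[of 0] \<rho>1 by unfold_locales auto
  have B0: "B 0 = P 0 + Q 0" using BPQ[OF V(2)] .
  note spaces = closed_pos_space subspace_pos_space closed_neg_space subspace_neg_space
    pos_space_pos neg_space_neg
  have bdP: "\<exists>K. \<forall>n. norm (P (x n)) \<le> K" if x: "range x \<subseteq> V" "x \<longlonglongrightarrow> 0" for x :: "nat \<Rightarrow> 'a"
  proof (rule pointwise_bounded_imp_uniformly_bounded)
    fix u
    have "Bseq (\<lambda>n. P (x n) u)" using D2[OF x] by (rule convergent_imp_Bseq[OF convergentI])
    thus "\<exists>c. \<forall>n. norm (P (x n) u) \<le> c" unfolding Bseq_def by blast
  qed
  obtain n2 \<rho>2 where \<rho>2: "0 < \<rho>2" and K: "\<And>x. x \<in> ball 0 \<rho>2 \<Longrightarrow> norm (B x) \<le> real n2"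
  proof (rule ball_if_all_null_sequences[OF V, where R = "\<lambda>n x. norm (B x) \<le> real n"])
    fix x :: "nat \<Rightarrow> 'a" assume x: "range x \<subseteq> V" "x \<longlonglongrightarrow> 0"
    obtain K1 where K1: "\<And>n. norm (P (x n)) \<le> K1" using bdP[OF x] by blast
    have "Bseq (\<lambda>n. Q (x n))" using Qlim[OF x] by (rule convergent_imp_Bseq[OF convergentI])
    then obtain K2 where K2: "\<And>n. norm (Q (x n)) \<le> K2" unfolding Bseq_def by blast
    obtain n where "K1 + K2 \<le> real n" using real_arch_simple by blast
    moreover have "norm (B (x n)) \<le> norm (P (x n)) + norm (Q (x n))"
      using BPQ x(1) norm_triangle_ineq by (metis rangeI subsetD)
    ultimately have "norm (B (x n)) \<le> real n" using K1[of n] K2[of n] by linarith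
    thus "\<exists>n. norm (B (x n)) \<le> real n" by blast
  qed blast
  \<comment> \<open>The sequences are taken in \<open>ball 0 \<rho>1\<close>, where coercivity holds
    with the single constant \<open>C0\<close>, as the weak limit argument requires.\<close>
  obtain n3 \<rho>3 where \<rho>3: "0 < \<rho>3" and pos: "\<And>x h. x \<in> ball 0 \<rho>3 \<Longrightarrow> h \<in> pos_space (B 0) \<Longrightarrow>
      norm h = 1 \<Longrightarrow> 1 / real (Suc n3) \<le> inner (B x h) h"
  proof (rule ball_if_all_null_sequences[of "ball 0 \<rho>1", where R = "\<lambda>n x. \<forall>h\<in>pos_space (B 0).
        norm h = 1 \<longrightarrow> 1 / real (Suc n) \<le> inner (B x h) h"])
    fix x :: "nat \<Rightarrow> 'a" assume x1: "range x \<subseteq> ball 0 \<rho>1" and x2: "x \<longlonglongrightarrow> 0"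
    have x: "range x \<subseteq> V" using x1 \<rho>1 by blast
    show "\<exists>n. \<forall>h\<in>pos_space (B 0). norm h = 1 \<longrightarrow> 1 / real (Suc n) \<le> inner (B (x n) h) h"
    proof (rule ccontr)
      assume "\<not> ?thesis"
      hence "\<forall>n. \<exists>h\<in>pos_space (B 0). norm h = 1 \<and> inner (B (x n) h) h < 1 / real (Suc n)"
        by (meson linorder_not_le)
      then obtain h where h: "\<And>n. h n \<in> pos_space (B 0)" "\<And>n. norm (h n) = 1"
        "\<And>n. inner (B (x n) (h n)) (h n) < 1 / real (Suc n)" by metis
      have 1: "inner ((P (x k) + Q (x k)) (h k)) (h k) \<le> 1 / real (Suc k)" for k
      proof -
        have "B (x k) = P (x k) + Q (x k)" using BPQ x by blast
        thus ?thesis using less_imp_le[OF h(3)[of k]] by simp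
      qed
      have 2: "(\<lambda>k. 1 / real (Suc k)) \<longlonglongrightarrow> 0"
        using LIMSEQ_inverse_real_of_nat by (simp add: inverse_eq_divide)
      obtain e where e: "\<And>M. closed M \<Longrightarrow> subspace M \<Longrightarrow> (\<And>k. h k \<in> M) \<Longrightarrow> e \<in> M"
        "norm e \<le> 1" "inner ((P 0 + Q 0) e) e \<le> 0" "e = 0 \<Longrightarrow> C0 \<le> 0"
      proof (rule weak_limit_of_forms[of "\<lambda>k. P (x k)" "P 0" "\<lambda>k. Q (x k)" "Q 0" C0 h "\<lambda>k. 1 / real (Suc k)" 0])
        show "self_adjoint (P (x k))" for k using sa x by blast
        show "C0 * (norm v)\<^sup>2 \<le> inner (P (x k) v) v" for k v using coer x1 by blast
      qed (use D2[OF x x2] Qlim[OF x x2] sa[OF V(2)] C0 h(2) 1 2 in auto)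
      have "e \<in> pos_space (B 0)" using e(1) spaces(1,2) h(1) unfolding B0 by blast
      thus False using e(3,4) C0 spaces(5)[of e] unfolding B0 by fastforce
    qed
  qed (simp, simp add: \<rho>1(1), blast)
  obtain n4 \<rho>4 where \<rho>4: "0 < \<rho>4" and neg: "\<And>x h. x \<in> ball 0 \<rho>4 \<Longrightarrow> h \<in> neg_space (B 0) \<Longrightarrow>
      norm h = 1 \<Longrightarrow> 1 / real (Suc n4) \<le> inner ((- B x) h) h"
  proof (rule ball_if_all_null_sequences[OF V, where R = "\<lambda>n x. \<forall>h\<in>neg_space (B 0).
        norm h = 1 \<longrightarrow> 1 / real (Suc n) \<le> inner ((- B x) h) h"])
    fix x :: "nat \<Rightarrow> 'a" assume x: "range x \<subseteq> V" and x2: "x \<longlonglongrightarrow> 0"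
    show "\<exists>n. \<forall>h\<in>neg_space (B 0). norm h = 1 \<longrightarrow> 1 / real (Suc n) \<le> inner ((- B (x n)) h) h"
    proof (rule ccontr)
      assume "\<not> ?thesis"
      hence "\<forall>n. \<exists>h\<in>neg_space (B 0). norm h = 1 \<and> inner ((- B (x n)) h) h < 1 / real (Suc n)"
        by (meson linorder_not_le)
      then obtain h where h: "\<And>n. h n \<in> neg_space (B 0)" "\<And>n. norm (h n) = 1"
        "\<And>n. inner ((- B (x n)) (h n)) (h n) < 1 / real (Suc n)" by metis
      have "compact (neg_space (B 0) \<inter> sphere 0 1)"
        unfolding B0
      proof (rule compact_sphere_nonpositive[OF spaces(3,4)])
        fix u assume "u \<in> neg_space (P 0 + Q 0)"
        thus "inner ((P 0 + Q 0) u) u \<le> 0"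
          using spaces(6)[of u] by (cases "u = 0") (auto simp: blinfun.zero_right less_imp_le)
      qed
      hence "seq_compact (neg_space (B 0) \<inter> sphere 0 1)" by (simp add: compact_eq_seq_compact_metric)
      then obtain e r where e: "e \<in> neg_space (B 0)" "norm e = 1" and r: "strict_mono r" "(h \<circ> r) \<longlonglongrightarrow> e"
        using h(1,2) unfolding seq_compact_def by (metis IntD1 IntD2 IntI mem_sphere_0)
      obtain K where Kb: "\<And>n. norm (P (x n)) \<le> K" using bdP[OF x x2] by blast
      have xr: "range (x \<circ> r) \<subseteq> V" "(x \<circ> r) \<longlonglongrightarrow> 0"
        using x LIMSEQ_subseq_LIMSEQ[OF x2 r(1)] by auto
      \<comment> \<open>Strong convergence alone does not allow the argument to move; the norm bound
        \<open>K\<close> absorbs the difference \<open>h (r n) - e\<close>.\<close>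
      have "(\<lambda>n. P (x (r n)) (h (r n) - e)) \<longlonglongrightarrow> 0"
      proof (rule tendsto_0_le[where K = K])
        show "(\<lambda>n. h (r n) - e) \<longlonglongrightarrow> 0" using r(2) by (simp add: LIM_zero comp_def)
        show "\<forall>\<^sub>F n in sequentially. norm (P (x (r n)) (h (r n) - e)) \<le> norm (h (r n) - e) * K"
        proof (intro always_eventually allI)
          fix n
          have "norm (P (x (r n)) (h (r n) - e)) \<le> norm (P (x (r n))) * norm (h (r n) - e)" by (rule norm_blinfun)
          also have "\<dots> \<le> K * norm (h (r n) - e)" by (intro mult_right_mono Kb norm_ge_zero)
          finally show "norm (P (x (r n)) (h (r n) - e)) \<le> norm (h (r n) - e) * K" by (simp add: mult.commute)
        qed
      qed
      hence Plim: "(\<lambda>n. P (x (r n)) (h (r n))) \<longlonglongrightarrow> P 0 e"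
        using tendsto_add[OF _ D2[OF xr, of e], of "\<lambda>n. P (x (r n)) (h (r n) - e)" 0]
        by (simp add: blinfun.diff_right)
      have "(\<lambda>n. Q (x (r n)) (h (r n))) \<longlonglongrightarrow> Q 0 e"
        using Qlim[OF xr] r(2) by (intro blinfun.tendsto) (simp_all add: comp_def)
      hence "(\<lambda>n. - inner (P (x (r n)) (h (r n)) + Q (x (r n)) (h (r n))) (h (r n))) \<longlonglongrightarrow> - inner (P 0 e + Q 0 e) e"
        using r(2) unfolding comp_def by (intro tendsto_minus tendsto_inner tendsto_add Plim)
      moreover have "(\<lambda>n. 1 / real (Suc (r n))) \<longlonglongrightarrow> 0"
        using LIMSEQ_subseq_LIMSEQ[OF LIMSEQ_inverse_real_of_nat r(1)] by (simp add: inverse_eq_divide comp_def)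
      moreover have "- inner (P (x (r n)) (h (r n)) + Q (x (r n)) (h (r n))) (h (r n)) \<le> 1 / real (Suc (r n))" for n
      proof -
        have "B (x (r n)) = P (x (r n)) + Q (x (r n))" using BPQ x by blast
        thus ?thesis using h(3)[of "r n"] unfolding blinfun.minus_left
          by (simp add: blinfun.add_left inner_add_left inner_diff_left)
      qed
      ultimately have "- inner (P 0 e + Q 0 e) e \<le> 0" by (intro LIMSEQ_le) auto
      moreover have "inner (P 0 e + Q 0 e) e < 0"
        using spaces(6)[of e] e unfolding B0 by (fastforce simp: blinfun.add_left)
      ultimately show False by simp
    qed
  qed blast
  define \<rho> where "\<rho> = min (min \<rho>1 \<rho>2) (min \<rho>3 \<rho>4)"
  define a where "a = min (1 / real (Suc n3)) (1 / real (Suc n4))"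
  show ?thesis
  proof (rule that)
    show "coercive_plus_compact (P 0) (Q 0) C0" by unfold_locales
    show "0 < \<rho>" "0 < a" "ball 0 \<rho> \<subseteq> V" using \<rho>1 \<rho>2 \<rho>3 \<rho>4 by (auto simp: \<rho>_def a_def)
    fix x :: 'a assume x: "x \<in> ball 0 \<rho>"
    show "norm (B x) \<le> real n2" using x K by (simp add: \<rho>_def)
    fix h :: 'a
    have "a \<le> 1 / real (Suc n3)" "a \<le> 1 / real (Suc n4)" by (simp_all only: a_def min.cobounded1 min.cobounded2)
    note * = this
    have a: "a * (norm h)\<^sup>2 \<le> 1 / real (Suc n3) * (norm h)\<^sup>2" "a * (norm h)\<^sup>2 \<le> 1 / real (Suc n4) * (norm h)\<^sup>2"
      by (rule mult_right_mono, rule *, simp)+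
    {
      assume "h \<in> pos_space (B 0)"
      hence "1 / real (Suc n3) * (norm h)\<^sup>2 \<le> inner (B x h) h"
        using x pos spaces(2) unfolding B0 by (intro form_bound_homogeneous) (auto simp: \<rho>_def)
      thus "a * (norm h)\<^sup>2 \<le> inner (B x h) h" using a by linarith
    next
      assume "h \<in> neg_space (B 0)"
      hence "1 / real (Suc n4) * (norm h)\<^sup>2 \<le> inner ((- B x) h) h"
        using x neg spaces(4) unfolding B0 by (intro form_bound_homogeneous) (auto simp: \<rho>_def)
      thus "inner (B x h) h \<le> - a * (norm h)\<^sup>2" using a by (simp add: blinfun.minus_left)
    }
  qed
qed

section \<open>Gradients, and Gateaux derivatives along segments\<close>

lemma has_derivative_gradient:
  fixes f :: "'a::{real_inner, banach} \<Rightarrow> real"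
  assumes "(f has_derivative f') (at x)"
  shows "GDERIV f x :> gradient f x" and "f' h = inner h (gradient f x)"
proof -
  obtain g where g: "\<And>h. f' h = inner g h"
    using riesz_representation[OF has_derivative_bounded_linear[OF assms]] by blast
  have "f' = (\<lambda>h. inner h g)" using g by (simp add: fun_eq_iff inner_commute)
  hence G: "GDERIV f x :> g" using assms by (simp add: gderiv_def)
  have "gradient f x = g" unfolding gradient_def
  proof (rule the_equality)
    show "GDERIV f x :> g" by (rule G)
    fix g' assume "GDERIV f x :> g'"
    hence "(\<lambda>h. inner h g') = (\<lambda>h. inner h g)"
      using G unfolding gderiv_def by (rule has_derivative_unique)
    hence "inner (g' - g) g' = inner (g' - g) g" by metis
    hence "inner (g' - g) (g' - g) = 0" by (simp add: inner_diff_right)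
    thus "g' = g" by simp
  qed
  thus "GDERIV f x :> gradient f x" "f' h = inner h (gradient f x)"
    using G g by (simp_all add: inner_commute)
qed

lemma GDERIV_gradient_eq:
  fixes f :: "'a::{real_inner, banach} \<Rightarrow> real"
  assumes "GDERIV f x :> g" shows "gradient f x = g"
proof -
  have "inner (g - gradient f x) g = inner (g - gradient f x) (gradient f x)"
    using has_derivative_gradient(2)[OF assms[unfolded gderiv_def]] .
  hence "inner (g - gradient f x) (g - gradient f x) = 0" by (simp add: inner_diff_right)
  thus ?thesis by simp
qed

lemma gateaux_line_derivative:
  fixes F :: "'a::real_inner \<Rightarrow> 'a"
  assumes "has_gateaux_derivative F T (x + t *\<^sub>R h)"
  shows "((\<lambda>t. inner (F (x + t *\<^sub>R h)) e) has_real_derivative inner (T h) e) (at t)"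
  unfolding DERIV_def
proof -
  have "((\<lambda>s. inner ((1 / s) *\<^sub>R (F (x + t *\<^sub>R h + s *\<^sub>R h) - F (x + t *\<^sub>R h))) e) \<longlongrightarrow> inner (T h) e) (at 0)"
    using assms unfolding has_gateaux_derivative_def by (intro tendsto_inner tendsto_const) blast
  thus "((\<lambda>s. (inner (F (x + (t + s) *\<^sub>R h)) e - inner (F (x + t *\<^sub>R h)) e) / s) \<longlongrightarrow> inner (T h) e) (at 0)"
    by (simp add: inner_diff_left algebra_simps diff_divide_distrib)
qed

text \<open>Both are one-variable statements on the segment from \<open>x\<close> to
  \<open>y\<close>, so a Gateaux derivative is enough. In the mean value part the point depends on
  the test vector \<open>e\<close>, so only bounds uniform in that point can be drawn from
  it.\<close>

lemma
  fixes f :: "'a::real_inner \<Rightarrow> real" and H :: "'a \<Rightarrow> 'a \<Rightarrow>\<^sub>L 'a"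
  assumes D: "convex D" and f: "\<And>x. x \<in> D \<Longrightarrow> GDERIV f x :> F x"
    and F: "\<And>x. x \<in> D \<Longrightarrow> has_gateaux_derivative F (H x) x" and x: "x \<in> D" and y: "y \<in> D"
  shows gateaux_mean_value: "\<exists>\<xi>\<in>D. inner (F y - F x) e = inner (H \<xi> (y - x)) e"
    and gateaux_taylor: "\<exists>\<xi>\<in>D. f y = f x + inner (F x) (y - x) + inner (H \<xi> (y - x)) (y - x) / 2"
proof -
  have seg: "x + t *\<^sub>R (y - x) \<in> D" if "0 \<le> t" "t \<le> 1" for t :: real
    using convexD_alt[OF D x y that] by (simp add: algebra_simps)
  have d2: "((\<lambda>t. inner (F (x + t *\<^sub>R (y - x))) e) has_real_derivative inner (H (x + t *\<^sub>R (y - x)) (y - x)) e) (at t)"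
    if "0 \<le> t" "t \<le> 1" for t e
    by (rule gateaux_line_derivative) (rule F[OF seg[OF that]])
  have d1: "((\<lambda>t. f (x + t *\<^sub>R (y - x))) has_real_derivative inner (F (x + t *\<^sub>R (y - x))) (y - x)) (at t)"
    if "0 \<le> t" "t \<le> 1" for t
  proof -
    have "(f has_derivative (\<lambda>h. inner h (F (x + t *\<^sub>R (y - x))))) (at (x + t *\<^sub>R (y - x)))"
      using f[OF seg[OF that]] by (simp add: gderiv_def)
    moreover have "((\<lambda>t. x + t *\<^sub>R (y - x)) has_derivative (\<lambda>s. s *\<^sub>R (y - x))) (at t)"
      by (auto intro!: derivative_eq_intros)
    ultimately have "((\<lambda>t. f (x + t *\<^sub>R (y - x))) has_derivative (\<lambda>s. inner (s *\<^sub>R (y - x)) (F (x + t *\<^sub>R (y - x))))) (at t)"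
      by (rule has_derivative_compose[rotated])
    moreover have "(\<lambda>s. inner (s *\<^sub>R (y - x)) (F (x + t *\<^sub>R (y - x)))) = (*) (inner (F (x + t *\<^sub>R (y - x))) (y - x))"
      by (auto simp: inner_commute mult.commute)
    ultimately show ?thesis unfolding has_field_derivative_def by simp
  qed
  have "\<exists>t>0. t < 1 \<and> inner (F (x + 1 *\<^sub>R (y - x))) e - inner (F (x + 0 *\<^sub>R (y - x))) e
      = (1 - 0) * inner (H (x + t *\<^sub>R (y - x)) (y - x)) e"
    by (rule MVT2) (auto intro: d2)
  then obtain t :: real where t: "0 < t" "t < 1" "inner (F (x + 1 *\<^sub>R (y - x))) e - inner (F (x + 0 *\<^sub>R (y - x))) e
      = (1 - 0) * inner (H (x + t *\<^sub>R (y - x)) (y - x)) e" by blast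
  thus "\<exists>\<xi>\<in>D. inner (F y - F x) e = inner (H \<xi> (y - x)) e"
    using seg[of t] by (intro bexI[of _ "x + t *\<^sub>R (y - x)"]) (auto simp: inner_diff_left)
  \<comment> \<open>The derivatives of order 0, 1 and 2 along the segment, indexed as
    \<open>Taylor_up\<close> expects them.\<close>
  define diff where "diff m t = (if m = 0 then f (x + t *\<^sub>R (y - x))
    else if m = 1 then inner (F (x + t *\<^sub>R (y - x))) (y - x)
    else inner (H (x + t *\<^sub>R (y - x)) (y - x)) (y - x))" for m :: nat and t
  have "\<exists>t>0. t < 1 \<and> f (x + 1 *\<^sub>R (y - x)) = (\<Sum>m<2. diff m 0 / fact m * (1 - 0) ^ m) + diff 2 t / fact 2 * (1 - 0)\<^sup>2"
  proof (rule Taylor_up)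
    show "diff 0 = (\<lambda>t. f (x + t *\<^sub>R (y - x)))" by (auto simp: diff_def)
    show "\<forall>m t. m < 2 \<and> 0 \<le> t \<and> t \<le> 1 \<longrightarrow> DERIV (diff m) t :> diff (Suc m) t"
    proof (intro allI impI)
      fix m :: nat and t :: real assume a: "m < 2 \<and> 0 \<le> t \<and> t \<le> 1"
      hence "m = 0 \<or> m = 1" by auto
      thus "DERIV (diff m) t :> diff (Suc m) t"
        using d1[of t] d2[of t] a by (auto simp: diff_def[abs_def])
    qed
  qed auto
  then obtain t where "0 < t" "t < 1" "f y = f x + inner (F x) (y - x) + diff 2 t / 2"
    by (auto simp: numeral_2_eq_2 diff_def)
  thus "\<exists>\<xi>\<in>D. f y = f x + inner (F x) (y - x) + inner (H \<xi> (y - x)) (y - x) / 2"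
    using seg[of t] by (intro bexI[of _ "x + t *\<^sub>R (y - x)"]) (auto simp: diff_def)
qed

section \<open>The family of functionals near the origin\<close>

text \<open>On \<open>V\<close> this is the gradient of \<open>perturbed L G l\<close>; the explicit
  formula keeps the affine dependence on \<open>l\<close> visible.\<close>

definition pgrad :: "('a::{real_inner, banach} \<Rightarrow> real) \<Rightarrow> ('n::finite \<Rightarrow> 'a \<Rightarrow> real) \<Rightarrow> real ^ 'n \<Rightarrow> 'a \<Rightarrow> 'a" where
  "pgrad L G l x = gradient L x + (\<Sum>j\<in>UNIV. l $ j *\<^sub>R gradient (G j) x)"

lemma GDERIV_perturbed:
  assumes "GDERIV L x :> gradient L x" "\<And>j. GDERIV (G j) x :> gradient (G j) x"
  shows "GDERIV (perturbed L G l) x :> pgrad L G l x"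
proof -
  have "((\<lambda>x. L x + (\<Sum>j\<in>UNIV. l $ j * G j x)) has_derivative
      (\<lambda>h. inner h (gradient L x) + (\<Sum>j\<in>UNIV. l $ j * inner h (gradient (G j) x)))) (at x)"
    using assms unfolding gderiv_def
    by (intro has_derivative_add has_derivative_sum has_derivative_mult_right) auto
  thus ?thesis
    unfolding gderiv_def perturbed_def[abs_def] pgrad_def
    by (simp add: inner_add_right inner_sum_right)
qed

lemma gateaux_pgrad:
  assumes "has_gateaux_derivative (gradient L) B x" "\<And>j. has_gateaux_derivative (gradient (G j)) (G2 j) x"
  shows "has_gateaux_derivative (pgrad L G l) (B + (\<Sum>j\<in>UNIV. l $ j *\<^sub>R G2 j)) x"
  unfolding has_gateaux_derivative_def
proof
  fix h
  have "((\<lambda>t. (1 / t) *\<^sub>R (gradient L (x + t *\<^sub>R h) - gradient L x)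
      + (\<Sum>j\<in>UNIV. l $ j *\<^sub>R ((1 / t) *\<^sub>R (gradient (G j) (x + t *\<^sub>R h) - gradient (G j) x))))
    \<longlongrightarrow> B h + (\<Sum>j\<in>UNIV. l $ j *\<^sub>R G2 j h)) (at 0)"
    using assms unfolding has_gateaux_derivative_def
    by (intro tendsto_add tendsto_sum tendsto_scaleR tendsto_const) auto
  thus "((\<lambda>t. (1 / t) *\<^sub>R (pgrad L G l (x + t *\<^sub>R h) - pgrad L G l x)) \<longlongrightarrow> (B + (\<Sum>j\<in>UNIV. l $ j *\<^sub>R G2 j)) h) (at 0)"
    by (simp add: pgrad_def blinfun.add_left blinfun.sum_left blinfun.scaleR_left scaleR_right_distrib
        scaleR_right_diff_distrib scaleR_sum_right sum_subtractf algebra_simps)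
qed

lemma norm_component_sum_le:
  fixes v :: "'n::finite \<Rightarrow> 'b::real_normed_vector"
  assumes "\<And>j. \<bar>l $ j\<bar> \<le> d" "\<And>j. norm (v j) \<le> M"
  shows "norm (\<Sum>j\<in>UNIV. l $ j *\<^sub>R v j) \<le> real CARD('n) * (d * M)"
proof -
  have "0 \<le> d" using assms(1) abs_ge_zero order_trans by blast
  hence "norm (l $ j *\<^sub>R v j) \<le> d * M" for j
    using assms by (auto intro!: mult_mono)
  thus ?thesis using sum_norm_bound[of UNIV "\<lambda>j. l $ j *\<^sub>R v j" "d * M"] by simp
qed

text \<open>The terms in \<open>l\<close> may spoil half of the definiteness constant
  \<open>a0\<close> of \<open>B x\<close>, and the factor 1/2 in Taylor's formula halves it again,
  hence \<open>a0 / 4\<close> in the convexity estimates.\<close>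

theorem perturbed_local_estimates:
  fixes V :: "'a::{real_inner, banach} set" and G :: "'n::finite \<Rightarrow> 'a \<Rightarrow> real"
  assumes V: "open V" "0 \<in> V"
    and L: "C1_on V L" "(L has_derivative (\<lambda>h. 0)) (at 0)" and A: "hypothesis_A V L B P Q"
    and G: "\<And>j. C1_on V (G j)" "\<And>j. (G j has_derivative (\<lambda>h. 0)) (at 0)"
    and G2: "\<And>j u. u \<in> V \<Longrightarrow> has_gateaux_derivative (gradient (G j)) (G2 j u) u"
      "\<And>j. continuous (at 0 within V) (G2 j)"
  obtains \<rho> \<delta> a K where "0 < \<rho>" "0 < \<delta>" "0 < a" "0 < K" "ball 0 \<rho> \<subseteq> V"
    and "\<And>l x. x \<in> V \<Longrightarrow> GDERIV (perturbed L G l) x :> pgrad L G l x"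
    and "\<And>l. pgrad L G l 0 = 0"
    and "\<And>l l' x y. l \<in> param_cube \<delta> \<Longrightarrow> l' \<in> param_cube \<delta> \<Longrightarrow> x \<in> ball 0 \<rho> \<Longrightarrow> y \<in> ball 0 \<rho> \<Longrightarrow>
      norm (pgrad L G l x - pgrad L G l' y) \<le> K * (dist l l' + norm (x - y))"
    and "\<And>l x y. l \<in> param_cube \<delta> \<Longrightarrow> x \<in> ball 0 \<rho> \<Longrightarrow> y \<in> ball 0 \<rho> \<Longrightarrow>
      \<bar>perturbed L G l y - perturbed L G l x - inner (pgrad L G l x) (y - x)\<bar> \<le> K * (norm (y - x))\<^sup>2"
    and "\<And>l x y. l \<in> param_cube \<delta> \<Longrightarrow> x \<in> ball 0 \<rho> \<Longrightarrow> y \<in> ball 0 \<rho> \<Longrightarrow> y - x \<in> pos_space (B 0) \<Longrightarrow>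
      perturbed L G l x + inner (pgrad L G l x) (y - x) + a * (norm (y - x))\<^sup>2 \<le> perturbed L G l y"
    and "\<And>l x y. l \<in> param_cube \<delta> \<Longrightarrow> x \<in> ball 0 \<rho> \<Longrightarrow> y \<in> ball 0 \<rho> \<Longrightarrow> y - x \<in> neg_space (B 0) \<Longrightarrow>
      perturbed L G l y \<le> perturbed L G l x + inner (pgrad L G l x) (y - x) - a * (norm (y - x))\<^sup>2"
proof -
  have C1: "GDERIV f x :> gradient f x" if f: "C1_on V f" and x: "x \<in> V" for f x
  proof -
    obtain f' where "(f has_derivative blinfun_apply (f' x)) (at x within V)"
      using f x unfolding C1_on_def by blast
    hence "(f has_derivative blinfun_apply (f' x)) (at x)" using at_within_open[OF x V(1)] by simp
    thus ?thesis by (rule has_derivative_gradient)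
  qed
  have gd: "GDERIV (perturbed L G l) x :> pgrad L G l x" if "x \<in> V" for l x
    by (intro GDERIV_perturbed C1 L G that)
  have "gradient L 0 = 0" "\<And>j. gradient (G j) 0 = 0"
    by (rule GDERIV_gradient_eq, simp add: gderiv_def L G)+
  hence pg0: "pgrad L G l 0 = 0" for l by (simp add: pgrad_def)
  obtain C \<rho>1 a0 K0 where "coercive_plus_compact (P 0) (Q 0) C" and \<rho>1: "0 < \<rho>1" "ball 0 \<rho>1 \<subseteq> V" and a0: "0 < a0"
    and K0: "\<And>x. x \<in> ball 0 \<rho>1 \<Longrightarrow> norm (B x) \<le> K0"
    and pos: "\<And>x h. x \<in> ball 0 \<rho>1 \<Longrightarrow> h \<in> pos_space (B 0) \<Longrightarrow> a0 * (norm h)\<^sup>2 \<le> inner (B x h) h"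
    and neg: "\<And>x h. x \<in> ball 0 \<rho>1 \<Longrightarrow> h \<in> neg_space (B 0) \<Longrightarrow> inner (B x h) h \<le> - a0 * (norm h)\<^sup>2"
    using hypothesis_A_local_bounds[OF V A] by metis
  have "\<forall>\<^sub>F x in at 0 within V. \<forall>j. dist (G2 j x) (G2 j 0) < 1"
    using G2(2) by (intro eventually_all_finite) (auto simp: continuous_within tendsto_iff)
  then obtain \<rho>2 where \<rho>2: "0 < \<rho>2" "\<And>x j. x \<in> V \<Longrightarrow> x \<noteq> 0 \<Longrightarrow> dist x 0 < \<rho>2 \<Longrightarrow> dist (G2 j x) (G2 j 0) < 1"
    unfolding eventually_at by blast
  \<comment> \<open>Radius at most 1, so that the Lipschitz constant \<open>M\<close> of
    \<open>gradient (G j)\<close>, which vanishes at 0, also bounds its norm.\<close>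
  define \<rho> where "\<rho> = min 1 (min \<rho>1 \<rho>2)"
  have \<rho>: "0 < \<rho>" "ball 0 \<rho> \<subseteq> ball 0 \<rho>1" "ball 0 \<rho> \<subseteq> V" "\<And>x. x \<in> ball 0 \<rho> \<Longrightarrow> norm x < 1"
    using \<rho>1 \<rho>2 by (auto simp: \<rho>_def)
  define M where "M = (\<Sum>j\<in>UNIV. norm (G2 j 0)) + 1"
  have M1: "1 \<le> M" by (simp add: M_def sum_nonneg)
  have M: "norm (G2 j x) \<le> M" if "x \<in> ball 0 \<rho>" for j x
  proof (cases "x = 0")
    case True
    have "norm (G2 j 0) \<le> (\<Sum>j\<in>UNIV. norm (G2 j 0))" by (rule member_le_sum) auto
    thus ?thesis using True by (simp add: M_def)
  next
    case False
    have "dist (G2 j x) (G2 j 0) < 1"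
      using \<rho>2(2)[of x j] that \<rho>(3) False by (auto simp: \<rho>_def)
    hence "norm (G2 j x) < norm (G2 j 0) + 1"
      using norm_triangle_sub[of "G2 j x" "G2 j 0"] by (simp add: dist_norm)
    moreover have "norm (G2 j 0) \<le> (\<Sum>j\<in>UNIV. norm (G2 j 0))" by (rule member_le_sum) auto
    ultimately show ?thesis by (simp add: M_def)
  qed
  define N where "N = real CARD('n)"
  have N: "0 < N" by (simp add: N_def)
  \<comment> \<open>Chosen so that the \<open>N\<close> perturbing operators together have norm at
    most \<open>N * (\<delta> * M)\<close>, which is at most \<open>a0 / 2\<close>.\<close>
  define \<delta> where "\<delta> = min 1 (a0 / (2 * N * M))"
  have \<delta>: "0 < \<delta>" using a0 N M1 by (simp add: \<delta>_def)
  have \<delta>1: "N * (\<delta> * M) \<le> a0 / 2"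
  proof -
    have "\<delta> \<le> a0 / (2 * N * M)" by (simp add: \<delta>_def)
    thus ?thesis using N M1 by (simp add: field_simps)
  qed
  define H where "H l x = B x + (\<Sum>j\<in>UNIV. l $ j *\<^sub>R G2 j x)" for l x
  have Hsmall: "norm (H l x - B x) \<le> a0 / 2" if l: "l \<in> param_cube \<delta>" and x: "x \<in> ball 0 \<rho>" for l x
  proof -
    have "\<bar>l $ j\<bar> \<le> \<delta>" for j using l by (auto simp: param_cube_def abs_le_iff minus_le_iff)
    hence "norm (\<Sum>j\<in>UNIV. l $ j *\<^sub>R G2 j x) \<le> N * (\<delta> * M)"
      unfolding N_def using M[OF x] by (rule norm_component_sum_le)
    thus ?thesis using \<delta>1 by (simp add: H_def)
  qed
  have Hd: "\<bar>inner (H l x h) h - inner (B x h) h\<bar> \<le> a0 / 2 * (norm h)\<^sup>2"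
    if "l \<in> param_cube \<delta>" "x \<in> ball 0 \<rho>" for l x h
  proof -
    have "\<bar>inner ((H l x - B x) h) h\<bar> \<le> norm ((H l x - B x) h) * norm h" by (rule Cauchy_Schwarz_ineq2)
    also have "\<dots> \<le> (norm (H l x - B x) * norm h) * norm h" by (intro mult_right_mono norm_blinfun norm_ge_zero)
    also have "\<dots> \<le> (a0 / 2 * norm h) * norm h" by (intro mult_right_mono Hsmall that norm_ge_zero)
    finally show ?thesis by (simp add: blinfun.diff_left inner_diff_left power2_eq_square mult.assoc)
  qed
  \<comment> \<open>The first two terms bound the norm of \<open>H l x\<close>; the last gives the
    Lipschitz constant in \<open>l\<close>.\<close>
  define K where "K = \<bar>K0\<bar> + a0 / 2 + N * M"
  have K: "0 < K" using a0 N M1 by (simp add: K_def add_nonneg_pos)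
  have HK: "norm (H l x) \<le> K" if "l \<in> param_cube \<delta>" "x \<in> ball 0 \<rho>" for l x
  proof -
    have "norm (H l x) \<le> norm (H l x - B x) + norm (B x)" by (metis diff_add_cancel norm_triangle_ineq)
    thus ?thesis using Hsmall[OF that] K0[of x] that(2) \<rho>(2) N M1 unfolding K_def
      by (smt (verit) mult_pos_pos subsetD)
  qed
  have inK: "\<bar>inner (H l x h) e\<bar> \<le> K * norm h * norm e" if "l \<in> param_cube \<delta>" "x \<in> ball 0 \<rho>" for l x h e
  proof -
    have "\<bar>inner (H l x h) e\<bar> \<le> norm (H l x h) * norm e" by (rule Cauchy_Schwarz_ineq2)
    also have "\<dots> \<le> (norm (H l x) * norm h) * norm e" by (intro mult_right_mono norm_blinfun norm_ge_zero)
    also have "\<dots> \<le> (K * norm h) * norm e" by (intro mult_right_mono HK that norm_ge_zero)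
    finally show ?thesis .
  qed
  have ga: "has_gateaux_derivative (pgrad L G l) (H l x) x" if "x \<in> ball 0 \<rho>" for l x
    unfolding H_def
  proof (rule gateaux_pgrad)
    have "x \<in> V" using that \<rho> by blast
    thus "has_gateaux_derivative (gradient L) (B x) x" "\<And>j. has_gateaux_derivative (gradient (G j)) (G2 j x) x"
      using A G2 by (auto simp: hypothesis_A_def)
  qed
  have gdb: "GDERIV (perturbed L G l) x :> pgrad L G l x" if "x \<in> ball 0 \<rho>" for l x
    using gd that \<rho> by blast
  have taylor: "\<exists>\<xi>\<in>ball 0 \<rho>. perturbed L G l y = perturbed L G l x + inner (pgrad L G l x) (y - x)
      + inner (H l \<xi> (y - x)) (y - x) / 2" if "x \<in> ball 0 \<rho>" "y \<in> ball 0 \<rho>" for l x y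
    by (rule gateaux_taylor[OF convex_ball]) (use gdb ga that in blast)+
  \<comment> \<open>The mean value theorem is scalar, so it is tested against the increment
    \<open>F x - F y\<close> itself.\<close>
  have lip1: "norm (F x - F y) \<le> K' * norm (x - y)"
    if T: "\<And>\<xi> h e. \<xi> \<in> ball 0 \<rho> \<Longrightarrow> \<bar>inner (blinfun_apply (T \<xi>) h) e\<bar> \<le> K' * norm h * norm e"
      and g: "\<And>x. x \<in> ball 0 \<rho> \<Longrightarrow> GDERIV f x :> F x"
      and t: "\<And>x. x \<in> ball 0 \<rho> \<Longrightarrow> has_gateaux_derivative F (T x) x"
      and x: "x \<in> ball 0 \<rho>" and y: "y \<in> ball 0 \<rho>" for f :: "'a \<Rightarrow> real" and F T K' x y
  proof -
    obtain \<xi> where xi: "\<xi> \<in> ball 0 \<rho>" "inner (F x - F y) (F x - F y) = inner (T \<xi> (x - y)) (F x - F y)"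
      using gateaux_mean_value[OF convex_ball g t y x] by blast
    have "norm (F x - F y) * norm (F x - F y) \<le> (K' * norm (x - y)) * norm (F x - F y)"
      using T[OF xi(1), of "x - y" "F x - F y"] xi(2)
      by (simp add: power2_norm_eq_inner flip: power2_eq_square)
    moreover have "0 \<le> K' * norm (x - y)" if "F x = F y"
    proof -
      have "0 \<le> K' * norm (x - y) * norm (x - y)"
        using T[OF xi(1), of "x - y" "x - y"] by (smt (verit))
      thus ?thesis by (cases "x = y") (auto simp: zero_le_mult_iff)
    qed
    ultimately show ?thesis by (cases "F x = F y") auto
  qed
  have Glip: "norm (gradient (G j) y) \<le> M" if y: "y \<in> ball 0 \<rho>" for j y
  proof -
    have "norm (gradient (G j) y - gradient (G j) 0) \<le> M * norm (y - 0)"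
    proof (rule lip1[of "G2 j" _ "G j"])
      fix \<xi> h e :: 'a assume "\<xi> \<in> ball 0 \<rho>"
      have "\<bar>inner (G2 j \<xi> h) e\<bar> \<le> norm (G2 j \<xi> h) * norm e" by (rule Cauchy_Schwarz_ineq2)
      also have "\<dots> \<le> (norm (G2 j \<xi>) * norm h) * norm e" by (intro mult_right_mono norm_blinfun norm_ge_zero)
      also have "\<dots> \<le> (M * norm h) * norm e" using \<open>\<xi> \<in> _\<close> by (intro mult_right_mono M norm_ge_zero)
      finally show "\<bar>inner (G2 j \<xi> h) e\<bar> \<le> M * norm h * norm e" .
    qed (use \<rho> y C1 G G2 in auto)
    also have "\<dots> \<le> M" using \<rho>(4)[OF y] M1 by (simp add: mult_left_le)
    finally show ?thesis using \<open>\<And>j. gradient (G j) 0 = 0\<close> by simp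
  qed
  show ?thesis
  proof (rule that[of \<rho> \<delta> "a0 / 4" K])
    show "0 < \<rho>" "0 < \<delta>" "0 < a0 / 4" "0 < K" "ball 0 \<rho> \<subseteq> V" using \<rho> \<delta> a0 K by auto
    show "\<And>l x. x \<in> V \<Longrightarrow> GDERIV (perturbed L G l) x :> pgrad L G l x" by (rule gd)
    show "\<And>l. pgrad L G l 0 = 0" by (rule pg0)
    fix l l' :: "real ^ 'n" and x y :: 'a
    assume l: "l \<in> param_cube \<delta>" and x: "x \<in> ball 0 \<rho>" and y: "y \<in> ball 0 \<rho>"
    have 1: "norm (pgrad L G l x - pgrad L G l y) \<le> K * norm (x - y)"
      by (rule lip1[of "H l" K "perturbed L G l" "pgrad L G l"]) (use inK[OF l] gdb ga x y in blast)+
    have "norm (\<Sum>j\<in>UNIV. (l - l') $ j *\<^sub>R gradient (G j) y) \<le> N * (dist l l' * M)"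
      unfolding N_def
    proof (rule norm_component_sum_le)
      show "\<bar>(l - l') $ j\<bar> \<le> dist l l'" for j
        unfolding dist_norm by (rule component_le_norm_cart)
    qed (rule Glip[OF y])
    also have "\<dots> \<le> K * dist l l'"
      using a0 by (simp add: K_def algebra_simps)
    finally have "norm (pgrad L G l y - pgrad L G l' y) \<le> K * dist l l'"
      by (simp add: pgrad_def sum_subtractf scaleR_left_diff_distrib)
    thus "norm (pgrad L G l x - pgrad L G l' y) \<le> K * (dist l l' + norm (x - y))"
      using 1 norm_triangle_ineq[of "pgrad L G l x - pgrad L G l y" "pgrad L G l y - pgrad L G l' y"]
      by (simp add: algebra_simps)
    obtain \<xi> where xi: "\<xi> \<in> ball 0 \<rho>" "perturbed L G l y = perturbed L G l x + inner (pgrad L G l x) (y - x)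
        + inner (H l \<xi> (y - x)) (y - x) / 2" using taylor[OF x y, of l] by blast
    have "\<bar>inner (H l \<xi> (y - x)) (y - x)\<bar> \<le> K * (norm (y - x))\<^sup>2"
      using inK[OF l xi(1), of "y - x" "y - x"] by (simp add: power2_eq_square mult.assoc)
    thus "\<bar>perturbed L G l y - perturbed L G l x - inner (pgrad L G l x) (y - x)\<bar> \<le> K * (norm (y - x))\<^sup>2"
      using xi(2) by simp
    have xi1: "\<xi> \<in> ball 0 \<rho>1" using xi(1) \<rho>(2) by blast
    note Hd' = Hd[OF l xi(1), of "y - x"]
    {
      assume "y - x \<in> pos_space (B 0)"
      thus "perturbed L G l x + inner (pgrad L G l x) (y - x) + a0 / 4 * (norm (y - x))\<^sup>2 \<le> perturbed L G l y"
        using pos[OF xi1, of "y - x"] Hd'[unfolded abs_le_iff] xi(2) by linarith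
    next
      assume "y - x \<in> neg_space (B 0)"
      thus "perturbed L G l y \<le> perturbed L G l x + inner (pgrad L G l x) (y - x) - a0 / 4 * (norm (y - x))\<^sup>2"
        using neg[OF xi1, of "y - x"] Hd'[unfolded abs_le_iff] xi(2) by linarith
    }
  qed
qed

section \<open>Parametrised functions that are strongly convex along the fibres\<close>

text \<open>Along each fibre \<open>x + Y\<close> the function \<open>f l\<close> has exactly one critical point \<open>x + c l x\<close>.  As \<open>f l\<close>
  increases quadratically along the rays leaving it, the radial rescaling \<open>T l x\<close> turns
  \<open>f l (x + c l x + y) - f l (x + c l x)\<close> into \<open>(norm (T l x y))\<^sup>2\<close>, and \<open>T l x\<close> is expanding on rays;
  \<open>S l x\<close> is its inverse.\<close>

locale fibre_convex =
  fixes X Y :: "'a::{real_inner, banach} set" and \<Lambda> :: "'l::metric_space set"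
    and f :: "'l \<Rightarrow> 'a \<Rightarrow> real" and F :: "'l \<Rightarrow> 'a \<Rightarrow> 'a" and \<rho> K a :: real
  assumes subspace_X: "subspace X" and subspace_Y: "subspace Y" and closed_Y: "closed Y"
    and XY: "\<And>x y. x \<in> X \<Longrightarrow> y \<in> Y \<Longrightarrow> inner x y = 0"
    and \<rho>_pos: "0 < \<rho>" and K_pos: "0 < K" and a_pos: "0 < a"
    and lip: "\<And>l l' x x' y y'. l \<in> \<Lambda> \<Longrightarrow> l' \<in> \<Lambda> \<Longrightarrow> x \<in> X \<Longrightarrow> norm x < \<rho> \<Longrightarrow> x' \<in> X \<Longrightarrow> norm x' < \<rho> \<Longrightarrow>
      y \<in> Y \<Longrightarrow> norm y < \<rho> \<Longrightarrow> y' \<in> Y \<Longrightarrow> norm y' < \<rho> \<Longrightarrow>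
      norm (F l (x + y) - F l' (x' + y')) \<le> K * (dist l l' + norm ((x + y) - (x' + y')))"
    and convex: "\<And>l x y y'. l \<in> \<Lambda> \<Longrightarrow> x \<in> X \<Longrightarrow> norm x < \<rho> \<Longrightarrow>
      y \<in> Y \<Longrightarrow> norm y < \<rho> \<Longrightarrow> y' \<in> Y \<Longrightarrow> norm y' < \<rho> \<Longrightarrow>
      f l (x + y) + inner (F l (x + y)) (y' - y) + a * (norm (y' - y))\<^sup>2 \<le> f l (x + y')"
    and upper: "\<And>l x y y'. l \<in> \<Lambda> \<Longrightarrow> x \<in> X \<Longrightarrow> norm x < \<rho> \<Longrightarrow>
      y \<in> Y \<Longrightarrow> norm y < \<rho> \<Longrightarrow> y' \<in> Y \<Longrightarrow> norm y' < \<rho> \<Longrightarrow>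
      f l (x + y') \<le> f l (x + y) + inner (F l (x + y)) (y' - y) + K * (norm (y' - y))\<^sup>2"
    and F0: "\<And>l. l \<in> \<Lambda> \<Longrightarrow> F l 0 = 0"
    and cont: "continuous_on (\<Lambda> \<times> (X \<inter> ball 0 \<rho>) \<times> (Y \<inter> ball 0 \<rho>)) (\<lambda>(l, x, y). f l (x + y))"
begin

text \<open>The convexity inequality is added to itself with \<open>y\<close> and \<open>y'\<close>
  exchanged: values cancel and the quadratic terms double.\<close>

lemma monotone:
  assumes "l \<in> \<Lambda>" "x \<in> X" "norm x < \<rho>" "y \<in> Y" "norm y < \<rho>" "y' \<in> Y" "norm y' < \<rho>"
  shows "2 * a * (norm (y' - y))\<^sup>2 \<le> inner (F l (x + y') - F l (x + y)) (y' - y)"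
  using convex[OF assms] convex[OF assms(1-3,6,7,4,5)]
  by (simp add: inner_diff_left inner_diff_right norm_minus_commute)

definition critical :: "'l \<Rightarrow> 'a \<Rightarrow> 'a \<Rightarrow> bool" where
  "critical l x y \<longleftrightarrow> (\<forall>v\<in>Y. inner (F l (x + y)) v = 0)"

lemma critical_unique:
  assumes "l \<in> \<Lambda>" "x \<in> X" "norm x < \<rho>" "y \<in> Y" "norm y < \<rho>" "y' \<in> Y" "norm y' < \<rho>"
    and "critical l x y" "critical l x y'"
  shows "y' = y"
proof -
  have "y' - y \<in> Y" using assms subspace_Y subspace_diff by blast
  hence "inner (F l (x + y') - F l (x + y)) (y' - y) = 0"
    using assms(8,9) by (simp add: critical_def inner_diff_left)
  hence "2 * a * (norm (y' - y))\<^sup>2 \<le> 0" using monotone[OF assms(1-7)] by simp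
  thus ?thesis using a_pos by (simp add: mult_le_0_iff)
qed

text \<open>For a gradient step of length \<open>t\<close>, monotonicity \<open>2 * a\<close> and
  Lipschitz constant \<open>K'\<close> bound the squared contraction factor by
  \<open>1 - 4 * a * t + t^2 * K'^2\<close>. This is least at \<open>t = \<tau>\<close>, with value
  \<open>q^2\<close>. Enlarging \<open>K\<close> to \<open>K'\<close> makes
  \<open>2 * a < K'\<close>, so the root is taken of a positive number.\<close>

abbreviation "K' \<equiv> K + 2 * a"
abbreviation "\<tau> \<equiv> 2 * a / K'\<^sup>2"
abbreviation "q \<equiv> sqrt (1 - 4 * a\<^sup>2 / K'\<^sup>2)"

text \<open>The first bound keeps \<open>x\<close> in the domain. The second keeps the gradient step
  from 0 within \<open>(1 - q) * (\<rho> / 2)\<close>, which is what a \<open>q\<close>-contraction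
  needs to map the ball of radius \<open>\<rho> / 2\<close> into itself.\<close>

definition \<sigma> where "\<sigma> = min (\<rho> / 2) ((1 - q) * \<rho> / (2 * \<tau> * K'))"

lemma K': "0 < K'" "0 < \<tau>" "4 * a\<^sup>2 / K'\<^sup>2 < 1" "0 \<le> q" "q < 1"
proof -
  show K: "0 < K'" using K_pos a_pos by simp
  show "0 < \<tau>" using K a_pos by simp
  have "(2 * a)\<^sup>2 < K'\<^sup>2" using K_pos a_pos by (intro power_strict_mono) auto
  thus 1: "4 * a\<^sup>2 / K'\<^sup>2 < 1" using K by (simp add: power_mult_distrib)
  show "0 \<le> q" using 1 by simp
  have "0 < 4 * a\<^sup>2 / K'\<^sup>2" using K a_pos by simp
  thus "q < 1" by simp
qed

lemma \<sigma>_pos: "0 < \<sigma>" and \<sigma>_le: "\<sigma> \<le> \<rho> / 2"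
proof -
  have "0 < (1 - q) * \<rho>" "0 < 2 * \<tau> * K'" using K'(1,2,5) \<rho>_pos by (intro mult_pos_pos; simp)+
  thus "0 < \<sigma>" unfolding \<sigma>_def using \<rho>_pos by (simp only: min_less_iff_conj divide_pos_pos half_gt_zero)
  show "\<sigma> \<le> \<rho> / 2" unfolding \<sigma>_def by (rule min.cobounded1)
qed

text \<open>The critical point is the fixed point of a gradient step, which contracts a ball of \<open>Y\<close>.\<close>

lemma critical_exists:
  assumes l: "l \<in> \<Lambda>" and x: "x \<in> X" "norm x < \<sigma>"
  shows "\<exists>y\<in>Y. norm y \<le> \<rho> / 2 \<and> critical l x y"
proof -
  let ?\<pi> = "orth_proj Y" and ?S = "Y \<inter> cball 0 (\<rho> / 2)"
  interpret \<pi>: bounded_linear ?\<pi> by (rule bounded_linear_orth_proj[OF closed_Y subspace_Y])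
  have x\<rho>: "norm x < \<rho>" using x \<sigma>_le \<rho>_pos by linarith
  define E where "E y = y - \<tau> *\<^sub>R ?\<pi> (F l (x + y))" for y
  have SD: "y \<in> Y" "norm y < \<rho>" if "y \<in> ?S" for y using that \<rho>_pos by auto
  have EY: "E y \<in> Y" if "y \<in> Y" for y
    unfolding E_def using that subspace_Y orth_proj_in[OF closed_Y subspace_Y]
    by (intro subspace_diff subspace_scale)
  have contr: "norm (E y' - E y) \<le> q * norm (y' - y)" if "y \<in> ?S" "y' \<in> ?S" for y y'
  proof -
    let ?d = "y' - y" and ?G = "F l (x + y') - F l (x + y)"
    have dY: "?d \<in> Y" using SD that subspace_Y subspace_diff by blast
    have "norm ?G \<le> K * norm ?d"
      using lip[OF l l x(1) x\<rho> x(1) x\<rho> SD[OF that(2)] SD[OF that(1)]] by simp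
    also have "\<dots> \<le> K' * norm ?d" using a_pos by (intro mult_right_mono) auto
    finally have G: "norm ?G \<le> K' * norm ?d" .
    have "norm (?\<pi> ?G) \<le> K' * norm ?d"
      using norm_orth_proj_le[OF closed_Y subspace_Y] G order_trans by blast
    hence "(norm (?\<pi> ?G))\<^sup>2 \<le> (K' * norm ?d)\<^sup>2" by (intro power_mono) auto
    hence 1: "\<tau>\<^sup>2 * (norm (?\<pi> ?G))\<^sup>2 \<le> \<tau>\<^sup>2 * (K' * norm ?d)\<^sup>2" by (intro mult_left_mono) auto
    have "inner ?d (?\<pi> ?G) = inner ?G ?d"
      by (metis inner_orth_proj[OF closed_Y subspace_Y dY] inner_commute)
    hence "2 * a * (norm ?d)\<^sup>2 \<le> inner ?d (?\<pi> ?G)"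
      using monotone[OF l x(1) x\<rho> SD[OF that(1)] SD[OF that(2)]] by simp
    hence 2: "2 * \<tau> * (2 * a * (norm ?d)\<^sup>2) \<le> 2 * \<tau> * inner ?d (?\<pi> ?G)"
      using K'(2) by (intro mult_left_mono) auto
    have "E y' - E y = ?d - \<tau> *\<^sub>R ?\<pi> ?G"
      by (simp add: E_def \<pi>.diff scaleR_right_diff_distrib)
    hence "(norm (E y' - E y))\<^sup>2 = (norm ?d)\<^sup>2 - 2 * \<tau> * inner ?d (?\<pi> ?G) + \<tau>\<^sup>2 * (norm (?\<pi> ?G))\<^sup>2"
      unfolding power2_norm_eq_inner
      by (simp only:) (simp add: inner_diff_left inner_diff_right inner_commute power2_eq_square algebra_simps)
    also have "\<dots> \<le> (norm ?d)\<^sup>2 - 2 * \<tau> * (2 * a * (norm ?d)\<^sup>2) + \<tau>\<^sup>2 * (K' * norm ?d)\<^sup>2"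
      using 1 2 by linarith
    also have "\<dots> = (1 - 4 * a\<^sup>2 / K'\<^sup>2) * (norm ?d)\<^sup>2"
    proof -
      have "n - 2 * (2 * a / k\<^sup>2) * (2 * a * n) + (2 * a / k\<^sup>2)\<^sup>2 * (k\<^sup>2 * n) = (1 - 4 * a\<^sup>2 / k\<^sup>2) * n"
        if "0 < k" for k n :: real using that by (simp add: field_simps power2_eq_square)
      from this[OF K'(1)] show ?thesis unfolding power_mult_distrib[of K'] .
    qed
    also have "\<dots> = (q * norm ?d)\<^sup>2" using K'(3) by (simp add: power_mult_distrib)
    finally show ?thesis
      by (rule power2_le_imp_le) (intro mult_nonneg_nonneg K'(4) norm_ge_zero)
  qed
  have E0: "norm (E 0) \<le> (1 - q) * (\<rho> / 2)"
  proof -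
    have "norm (F l (x + 0) - F l (0 + 0)) \<le> K * (dist l l + norm ((x + 0) - (0 + 0)))"
      using subspace_0[OF subspace_X] subspace_0[OF subspace_Y] \<rho>_pos
      by (intro lip l x(1) x\<rho>) simp_all
    hence "norm (F l x) \<le> K * norm x" using F0[OF l] by simp
    also have "\<dots> \<le> K' * norm x" using a_pos by (intro mult_right_mono) auto
    finally have "norm (?\<pi> (F l x)) \<le> K' * norm x"
      using norm_orth_proj_le[OF closed_Y subspace_Y] order_trans by blast
    hence "\<tau> * norm (?\<pi> (F l x)) \<le> \<tau> * (K' * norm x)" by (rule mult_left_mono) (rule less_imp_le[OF K'(2)])
    moreover have "norm (E 0) = \<tau> * norm (?\<pi> (F l x))"
      unfolding E_def add_0_right diff_0 norm_minus_cancel norm_scaleR abs_of_pos[OF K'(2)] ..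
    ultimately have "norm (E 0) \<le> \<tau> * (K' * norm x)" by (simp only:)
    also have "\<dots> \<le> \<tau> * (K' * ((1 - q) * \<rho> / (2 * \<tau> * K')))"
    proof (intro mult_left_mono less_imp_le[OF K'(1)] less_imp_le[OF K'(2)])
      show "norm x \<le> (1 - q) * \<rho> / (2 * \<tau> * K')"
        using x(2) unfolding \<sigma>_def min_less_iff_conj by (intro less_imp_le) blast
    qed
    also have "\<dots> = (1 - q) * (\<rho> / 2)"
    proof -
      have "t * (k * (u * \<rho> / (2 * t * k))) = u * (\<rho> / 2)" if "0 < k" "0 < t" for k t u :: real
        using that by simp
      from this[OF K'(1,2)] show ?thesis .
    qed
    finally show ?thesis .
  qed
  have "\<exists>!y\<in>?S. E y = y"
  proof (rule Banach_fix[where c = q])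
    show "complete ?S" using closed_Y by (simp add: complete_eq_closed closed_Int)
    show "?S \<noteq> {}" using subspace_0[OF subspace_Y] \<rho>_pos by auto
    show "0 \<le> q" "q < 1" by (rule K')+
    show "E ` ?S \<subseteq> ?S"
    proof (intro image_subsetI IntI)
      fix y assume y: "y \<in> ?S"
      show "E y \<in> Y" using y EY by blast
      have 0: "0 \<in> ?S" using subspace_0[OF subspace_Y] \<rho>_pos by auto
      have "norm (E y) \<le> norm (E y - E 0) + norm (E 0)" by (metis diff_add_cancel norm_triangle_ineq)
      also have "\<dots> \<le> q * norm (y - 0) + (1 - q) * (\<rho> / 2)" using contr[OF 0 y] E0 by linarith
      also have "\<dots> \<le> q * (\<rho> / 2) + (1 - q) * (\<rho> / 2)" using y K'(4) by (intro add_mono mult_left_mono) auto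
      also have "\<dots> = \<rho> / 2" by (simp add: algebra_simps)
      finally show "E y \<in> cball 0 (\<rho> / 2)" by simp
    qed
    show "dist (E y') (E y) \<le> q * dist y' y" if "y' \<in> ?S" "y \<in> ?S" for y' y
      using contr[OF that(2,1)] by (simp add: dist_norm)
  qed
  then obtain y where y: "y \<in> ?S" "E y = y" by blast
  have "?\<pi> (F l (x + y)) = 0" using y(2) a_pos K'(1) by (simp add: E_def)
  hence "critical l x y" unfolding critical_def
    by (metis inner_orth_proj[OF closed_Y subspace_Y] inner_zero_left)
  thus ?thesis using y(1) by auto
qed

text \<open>Uniqueness refers to the whole ball of radius \<open>\<rho>\<close>, while existence
  yields norm at most \<open>\<rho> / 2\<close>; the gap leaves room for the displacements
  \<open>y\<close> with \<open>norm y < \<rho> / 2\<close> around the critical point.\<close>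

definition c :: "'l \<Rightarrow> 'a \<Rightarrow> 'a" where
  "c l x = (THE y. y \<in> Y \<and> norm y < \<rho> \<and> critical l x y)"

lemma c_unique:
  assumes "l \<in> \<Lambda>" "x \<in> X" "norm x < \<sigma>" "y \<in> Y" "norm y < \<rho>" "critical l x y"
  shows "c l x = y"
  unfolding c_def
proof (rule the_equality)
  have "norm x < \<rho>" using assms(3) \<sigma>_le \<rho>_pos by linarith
  thus "y' = y" if "y' \<in> Y \<and> norm y' < \<rho> \<and> critical l x y'" for y'
    using that assms critical_unique by blast
qed (use assms in blast)

lemma
  assumes "l \<in> \<Lambda>" "x \<in> X" "norm x < \<sigma>"
  shows c_in: "c l x \<in> Y" and norm_c: "norm (c l x) \<le> \<rho> / 2" "norm (c l x) < \<rho>"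
    and critical_c: "critical l x (c l x)"
proof -
  obtain y where y: "y \<in> Y" "norm y \<le> \<rho> / 2" "critical l x y" using critical_exists[OF assms] by blast
  moreover have "c l x = y" using y \<rho>_pos by (intro c_unique assms) auto
  ultimately show "c l x \<in> Y" "norm (c l x) \<le> \<rho> / 2" "norm (c l x) < \<rho>" "critical l x (c l x)"
    using \<rho>_pos by auto
qed

text \<open>Both critical points are compared on the single fibre over \<open>x'\<close>, by
  monotonicity of \<open>F l'\<close>. Tested on their difference, which lies in \<open>Y\<close>,
  the two critical values of \<open>F\<close> vanish and can be exchanged, leaving a difference of
  \<open>F\<close> that the Lipschitz bound controls.\<close>

lemma c_lipschitz:
  assumes l: "l \<in> \<Lambda>" "l' \<in> \<Lambda>" and x: "x \<in> X" "norm x < \<sigma>" "x' \<in> X" "norm x' < \<sigma>"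
  shows "norm (c l x - c l' x') \<le> K / (2 * a) * (dist l l' + norm (x - x'))"
proof -
  let ?y = "c l x" and ?y' = "c l' x'"
  have x\<rho>: "norm x < \<rho>" "norm x' < \<rho>" using x \<sigma>_le \<rho>_pos by linarith+
  note y = c_in[OF l(1) x(1,2)] norm_c(2)[OF l(1) x(1,2)]
  note y' = c_in[OF l(2) x(3,4)] norm_c(2)[OF l(2) x(3,4)]
  have d: "?y - ?y' \<in> Y" using y y' subspace_Y subspace_diff by blast
  have "2 * a * (norm (?y - ?y'))\<^sup>2 \<le> inner (F l' (x' + ?y) - F l' (x' + ?y')) (?y - ?y')"
    by (rule monotone[OF l(2) x(3) x\<rho>(2) y' y])
  also have "\<dots> = inner (F l' (x' + ?y) - F l (x + ?y)) (?y - ?y')"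
    using critical_c[OF l(1) x(1,2)] critical_c[OF l(2) x(3,4)] d
    by (simp add: critical_def inner_diff_left)
  also have "\<dots> \<le> norm (F l' (x' + ?y) - F l (x + ?y)) * norm (?y - ?y')" by (rule norm_cauchy_schwarz)
  also have "\<dots> \<le> (K * (dist l' l + norm ((x' + ?y) - (x + ?y)))) * norm (?y - ?y')"
    by (intro mult_right_mono lip l x x\<rho> y norm_ge_zero)
  finally have "2 * a * norm (?y - ?y') * norm (?y - ?y') \<le> K * (dist l l' + norm (x - x')) * norm (?y - ?y')"
    by (simp add: power2_eq_square mult.assoc dist_commute norm_minus_commute)
  hence "?y \<noteq> ?y' \<Longrightarrow> 2 * a * norm (?y - ?y') \<le> K * (dist l l' + norm (x - x'))" by simp
  moreover have "0 \<le> K * (dist l l' + norm (x - x'))" using K_pos by simp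
  ultimately have "2 * a * norm (?y - ?y') \<le> K * (dist l l' + norm (x - x'))" by fastforce
  thus ?thesis using a_pos by (simp add: field_simps)
qed

lemma c_zero: "l \<in> \<Lambda> \<Longrightarrow> c l 0 = 0"
  using \<sigma>_pos \<rho>_pos subspace_0[OF subspace_X] subspace_0[OF subspace_Y]
  by (intro c_unique) (auto simp: critical_def F0)

lemma norm_c_le:
  assumes "l \<in> \<Lambda>" "x \<in> X" "norm x < \<sigma>"
  shows "norm (c l x) \<le> K / (2 * a) * norm x"
  using c_lipschitz[OF assms(1,1,2,3) subspace_0[OF subspace_X]] \<sigma>_pos c_zero[OF assms(1)] by simp

lemma continuous_on_c: "continuous_on (\<Lambda> \<times> (X \<inter> ball 0 \<sigma>)) (\<lambda>(l, x). c l x)"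
  unfolding continuous_on_iff
proof (intro ballI allI impI)
  fix p and e :: real assume p: "p \<in> \<Lambda> \<times> (X \<inter> ball 0 \<sigma>)" and e: "0 < e"
  obtain l x where lx: "p = (l, x)" by (cases p)
  define d where "d = e / (K / (2 * a) * 2)"
  have M: "0 < K / (2 * a)" using K_pos a_pos by simp
  have d: "0 < d" unfolding d_def using e a_pos K_pos by (intro divide_pos_pos mult_pos_pos) auto
  have "dist (case p' of (l, x) \<Rightarrow> c l x) (case p of (l, x) \<Rightarrow> c l x) < e"
    if p': "p' \<in> \<Lambda> \<times> (X \<inter> ball 0 \<sigma>)" "dist p' p < d" for p'
  proof -
    obtain l' x' where lx': "p' = (l', x')" by (cases p')
    have "dist l' l \<le> dist p' p" "dist x' x \<le> dist p' p"
      using dist_fst_le[of p' p] dist_snd_le[of p' p] lx lx' by auto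
    hence "dist l' l + norm (x' - x) < 2 * d" using p'(2) by (simp add: dist_norm)
    hence "K / (2 * a) * (dist l' l + norm (x' - x)) < K / (2 * a) * (2 * d)"
      using M by (intro mult_strict_left_mono)
    also have "\<dots> = e" using K_pos a_pos unfolding d_def by (simp add: field_simps)
    finally show ?thesis
      using c_lipschitz[of l' l x' x] p p' by (simp add: lx lx' dist_norm)
  qed
  thus "\<exists>d>0. \<forall>p'\<in>\<Lambda> \<times> (X \<inter> ball 0 \<sigma>). dist p' p < d \<longrightarrow>
      dist (case p' of (l, x) \<Rightarrow> c l x) (case p of (l, x) \<Rightarrow> c l x) < e" using d by blast
qed

lemma c_minimal:
  assumes "l \<in> \<Lambda>" "x \<in> X" "norm x < \<sigma>" "y \<in> Y" "norm y < \<rho>"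
  shows "f l (x + c l x) \<le> f l (x + y)"
proof -
  have x\<rho>: "norm x < \<rho>" using assms \<sigma>_le \<rho>_pos by linarith
  have "y - c l x \<in> Y" using assms c_in subspace_Y subspace_diff by blast
  hence "inner (F l (x + c l x)) (y - c l x) = 0"
    using critical_c[OF assms(1-3)] by (simp add: critical_def)
  moreover have "0 \<le> a * (norm (y - c l x))\<^sup>2" using a_pos by simp
  ultimately show ?thesis
    using convex[OF assms(1,2) x\<rho> c_in[OF assms(1-3)] norm_c(2)[OF assms(1-3)] assms(4,5)] by linarith
qed

end

section \<open>Radial rescaling along the fibres and its inverse\<close>

context fibre_convex
begin

definition g :: "'l \<Rightarrow> 'a \<Rightarrow> 'a \<Rightarrow> real" where
  "g l x y = f l (x + (c l x + y)) - f l (x + c l x)"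

text \<open>At \<open>y = 0\<close> division by zero yields the value 0, which is also the limit,
  because the root of \<open>g\<close> is at most \<open>sqrt K * norm y\<close>.\<close>

definition T :: "'l \<Rightarrow> 'a \<Rightarrow> 'a \<Rightarrow> 'a" where
  "T l x y = (sqrt (g l x y) / norm y) *\<^sub>R y"

definition S :: "'l \<Rightarrow> 'a \<Rightarrow> 'a \<Rightarrow> 'a" where
  "S l x b = (THE y. y \<in> Y \<and> norm y < \<rho> / 2 \<and> T l x y = b)"

text \<open>\<open>T l x\<close> stretches norms by at least \<open>sqrt a\<close>, so the sphere of
  radius \<open>\<rho> / 4\<close> is mapped outside the ball of this radius.\<close>

definition \<beta> where "\<beta> = sqrt a * (\<rho> / 4)"

lemma \<beta>_pos: "0 < \<beta>" using a_pos \<rho>_pos by (simp add: \<beta>_def)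

context
  fixes l x
  assumes l: "l \<in> \<Lambda>" and x: "x \<in> X" "norm x < \<sigma>"
begin

lemma x_lt_\<rho>: "norm x < \<rho>" using x \<sigma>_le \<rho>_pos by linarith

lemma c_add:
  assumes "y \<in> Y" "norm y < \<rho> / 2"
  shows "c l x + y \<in> Y" "norm (c l x + y) < \<rho>"
  using assms c_in[OF l x] norm_c(1)[OF l x] norm_triangle_ineq[of "c l x" y] subspace_Y
  by (auto simp: subspace_add)

lemma inner_F_c: "y \<in> Y \<Longrightarrow> inner (F l (x + c l x)) y = 0"
  using critical_c[OF l x] by (simp add: critical_def)

lemma
  assumes y: "y \<in> Y" "norm y < \<rho> / 2"
  shows g_lower: "a * (norm y)\<^sup>2 \<le> g l x y" and g_upper: "g l x y \<le> K * (norm y)\<^sup>2"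
  using convex[OF l x(1) x_lt_\<rho> c_in[OF l x] norm_c(2)[OF l x] c_add[OF y]]
    upper[OF l x(1) x_lt_\<rho> c_in[OF l x] norm_c(2)[OF l x] c_add[OF y]] inner_F_c[OF y(1)]
  by (simp_all add: g_def)

lemma g_nonneg: "y \<in> Y \<Longrightarrow> norm y < \<rho> / 2 \<Longrightarrow> 0 \<le> g l x y"
  using g_lower a_pos by (smt (verit) mult_nonneg_nonneg zero_le_power2)

text \<open>Monotonicity against the critical point makes the slope of \<open>g\<close> along the
  ray at least \<open>2 * a * t\<close>. Convexity from \<open>t\<close> to \<open>t'\<close> adds
  \<open>a * (t' - t)^2\<close>, and the two contributions sum to
  \<open>a * (t'^2 - t^2)\<close>.\<close>

lemma g_ray:
  assumes e: "e \<in> Y" "norm e = 1" and t: "0 \<le> t" "t \<le> t'" "t' < \<rho> / 2"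
  shows "a * (t'\<^sup>2 - t\<^sup>2) \<le> g l x (t' *\<^sub>R e) - g l x (t *\<^sub>R e)"
proof -
  let ?y = "c l x + t *\<^sub>R e" and ?y' = "c l x + t' *\<^sub>R e"
  have te: "t *\<^sub>R e \<in> Y" "norm (t *\<^sub>R e) < \<rho> / 2" "t' *\<^sub>R e \<in> Y" "norm (t' *\<^sub>R e) < \<rho> / 2"
    using e t subspace_Y by (auto simp: subspace_scale)
  have d: "?y' - ?y = (t' - t) *\<^sub>R e" by (simp add: scaleR_left_diff_distrib)
  have "2 * a * (norm (?y - c l x))\<^sup>2 \<le> inner (F l (x + ?y) - F l (x + c l x)) (?y - c l x)"
    by (rule monotone[OF l x(1) x_lt_\<rho> c_in[OF l x] norm_c(2)[OF l x] c_add[OF te(1,2)]])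
  hence "2 * a * t\<^sup>2 \<le> t * inner (F l (x + ?y)) e"
    using inner_F_c[OF e(1)] e(2) by (simp add: inner_diff_left)
  hence "t * (2 * a * t) \<le> t * inner (F l (x + ?y)) e" by (simp add: power2_eq_square algebra_simps)
  hence 1: "t \<noteq> 0 \<Longrightarrow> 2 * a * t \<le> inner (F l (x + ?y)) e"
    using t(1) by (simp only: mult_le_cancel_left)
  \<comment> \<open>The factor \<open>t\<close> cannot be cancelled at \<open>t = 0\<close>; there
    the slope vanishes by criticality.\<close>
  have "2 * a * t \<le> inner (F l (x + ?y)) e"
    using 1 inner_F_c[OF e(1)] by (cases "t = 0") auto
  hence "(t' - t) * (2 * a * t) \<le> (t' - t) * inner (F l (x + ?y)) e"
    using t by (intro mult_left_mono) auto
  moreover have "f l (x + ?y) + inner (F l (x + ?y)) (?y' - ?y) + a * (norm (?y' - ?y))\<^sup>2 \<le> f l (x + ?y')"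
    by (rule convex[OF l x(1) x_lt_\<rho> c_add[OF te(1,2)] c_add[OF te(3,4)]])
  hence "(t' - t) * inner (F l (x + ?y)) e + a * (t' - t)\<^sup>2 \<le> g l x (t' *\<^sub>R e) - g l x (t *\<^sub>R e)"
    unfolding d using e(2) by (simp add: g_def)
  ultimately show ?thesis by (simp add: algebra_simps power2_eq_square)
qed

text \<open>\<open>g_ray\<close> is a difference of squares; dividing by the sum of the roots, at
  most \<open>sqrt K * (t + t')\<close>, leaves a linear lower bound. It supplies injectivity of
  \<open>T\<close> and continuity of its inverse.\<close>

lemma sqrt_g_ray:
  assumes e: "e \<in> Y" "norm e = 1" and t: "0 \<le> t" "t < \<rho> / 2" "0 \<le> t'" "t' < \<rho> / 2"
  shows "a / sqrt K * \<bar>t' - t\<bar> \<le> \<bar>sqrt (g l x (t' *\<^sub>R e)) - sqrt (g l x (t *\<^sub>R e))\<bar>"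
  using t
proof (induction t t' rule: linorder_wlog)
  case (le t t')
  let ?h = "\<lambda>t. sqrt (g l x (t *\<^sub>R e))"
  have te: "t *\<^sub>R e \<in> Y" "norm (t *\<^sub>R e) < \<rho> / 2" "t' *\<^sub>R e \<in> Y" "norm (t' *\<^sub>R e) < \<rho> / 2"
    using e le subspace_Y by (auto simp: subspace_scale)
  have sq: "(?h t)\<^sup>2 = g l x (t *\<^sub>R e)" "(?h t')\<^sup>2 = g l x (t' *\<^sub>R e)" and h0: "0 \<le> ?h t" "0 \<le> ?h t'"
    using te g_nonneg by simp_all
  have up: "?h s \<le> sqrt K * s" if "0 \<le> s" "s < \<rho> / 2" for s
  proof -
    have "g l x (s *\<^sub>R e) \<le> K * s\<^sup>2"
      using g_upper[of "s *\<^sub>R e"] that e subspace_Y by (simp add: subspace_scale)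
    hence "?h s \<le> sqrt (K * s\<^sup>2)" by simp
    thus ?thesis using that by (simp add: real_sqrt_mult)
  qed
  show ?case
  proof (cases "t' = 0")
    case False
    hence t': "0 < t'" using le by simp
    have "0 < a * t'\<^sup>2" using t' a_pos by simp
    also have "\<dots> \<le> g l x (t' *\<^sub>R e)" using g_lower[OF te(3,4)] e(2) by simp
    finally have hp: "0 < ?h t' + ?h t" using h0 by (simp add: add_pos_nonneg)
    have "a / sqrt K * (t' - t) * (?h t' + ?h t) \<le> a / sqrt K * (t' - t) * (sqrt K * t' + sqrt K * t)"
      using le up a_pos K_pos by (intro mult_left_mono add_mono) auto
    also have "\<dots> = a * (t'\<^sup>2 - t\<^sup>2)" using K_pos by (simp add: field_simps power2_eq_square)
    also have "\<dots> \<le> (?h t')\<^sup>2 - (?h t)\<^sup>2" unfolding sq using g_ray[OF e] le by simp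
    also have "\<dots> = (?h t' - ?h t) * (?h t' + ?h t)" by (simp add: algebra_simps power2_eq_square)
    finally have "a / sqrt K * (t' - t) \<le> ?h t' - ?h t" using hp by (rule mult_right_le_imp_le)
    thus ?thesis using le by simp
  qed (use le in auto)
next
  case (sym t t')
  thus ?case by (simp add: abs_minus_commute)
qed

lemma
  assumes y: "y \<in> Y" "norm y < \<rho> / 2"
  shows T_in: "T l x y \<in> Y" and norm_T: "norm (T l x y) = sqrt (g l x y)"
    and norm_T_lower: "sqrt a * norm y \<le> norm (T l x y)" and norm_T_upper: "norm (T l x y) \<le> sqrt K * norm y"
proof -
  show "T l x y \<in> Y" unfolding T_def using y subspace_Y by (simp add: subspace_scale)
  show 1: "norm (T l x y) = sqrt (g l x y)"
    using g_nonneg[OF y] g_upper[OF y] g_lower[OF y] by (cases "y = 0") (auto simp: T_def)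
  have "sqrt (a * (norm y)\<^sup>2) \<le> sqrt (g l x y)" "sqrt (g l x y) \<le> sqrt (K * (norm y)\<^sup>2)"
    using g_lower[OF y] g_upper[OF y] by simp_all
  thus "sqrt a * norm y \<le> norm (T l x y)" "norm (T l x y) \<le> sqrt K * norm y"
    unfolding 1 by (simp_all add: real_sqrt_mult)
qed

lemma f_T:
  assumes "y \<in> Y" "norm y < \<rho> / 2"
  shows "f l (x + (c l x + y)) = f l (x + c l x) + (norm (T l x y))\<^sup>2"
  using g_nonneg[OF assms] norm_T[OF assms] by (simp add: g_def)

text \<open>\<open>T l x\<close> maps each ray into itself, so a common nonzero image puts both
  points on one ray, where \<open>sqrt_g_ray\<close> separates different lengths.\<close>

lemma T_inj:
  assumes y: "y \<in> Y" "norm y < \<rho> / 2" and y': "y' \<in> Y" "norm y' < \<rho> / 2" and eq: "T l x y = T l x y'"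
  shows "y = y'"
proof (cases "y = 0 \<or> y' = 0")
  case True
  have "sqrt a * norm y \<le> 0 \<or> sqrt a * norm y' \<le> 0"
    using True norm_T_lower[OF y] norm_T_lower[OF y'] norm_T_upper[OF y] norm_T_upper[OF y'] eq by auto
  hence "sqrt a * norm y \<le> 0 \<and> sqrt a * norm y' \<le> 0"
    using True norm_T_lower[OF y] norm_T_lower[OF y'] norm_T_upper[OF y] norm_T_upper[OF y'] eq by auto
  thus ?thesis using a_pos by (simp add: mult_le_0_iff)
next
  case False
  define e where "e = (1 / norm y) *\<^sub>R y"
  have e: "e \<in> Y" "norm e = 1" "y = norm y *\<^sub>R e"
    using False y subspace_Y by (auto simp: e_def subspace_scale)
  have gp: "0 < sqrt (g l x y)" using norm_T_lower[OF y] norm_T[OF y] False a_pos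
    by (smt (verit) mult_pos_pos real_sqrt_gt_zero zero_less_norm_iff)
  have geq: "sqrt (g l x y) = sqrt (g l x y')" using norm_T[OF y] norm_T[OF y'] eq by simp
  have "sqrt (g l x y) *\<^sub>R ((1 / norm y) *\<^sub>R y) = sqrt (g l x y) *\<^sub>R ((1 / norm y') *\<^sub>R y')"
    using eq geq by (simp add: T_def)
  hence "e = (1 / norm y') *\<^sub>R y'"
    unfolding e_def using gp by (metis less_irrefl scaleR_cancel_left)
  hence e': "y' = norm y' *\<^sub>R e" using False by simp
  have "a / sqrt K * \<bar>norm y' - norm y\<bar> \<le> \<bar>sqrt (g l x (norm y' *\<^sub>R e)) - sqrt (g l x (norm y *\<^sub>R e))\<bar>"
    using y y' by (intro sqrt_g_ray e) auto
  also have "\<dots> = 0" using e(3) e' geq by simp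
  finally have "norm y' = norm y" using a_pos K_pos by (simp add: mult_le_0_iff divide_le_0_iff)
  thus ?thesis using e(3) e' by metis
qed

lemma continuous_on_g_ray:
  assumes "e \<in> Y" "norm e = 1"
  shows "continuous_on {0..\<rho> / 4} (\<lambda>t. sqrt (g l x (t *\<^sub>R e)))"
proof -
  have "continuous_on {0..\<rho> / 4} (\<lambda>t. (\<lambda>(l, x, y). f l (x + y)) (l, x, c l x + t *\<^sub>R e))"
  proof (rule continuous_on_compose2[OF cont])
    show "continuous_on {0..\<rho> / 4} (\<lambda>t. (l, x, c l x + t *\<^sub>R e))" by (intro continuous_intros)
    have "c l x + t *\<^sub>R e \<in> Y \<inter> ball 0 \<rho>" if "t \<in> {0..\<rho> / 4}" for t
      using c_add[of "t *\<^sub>R e"] that assms subspace_Y \<rho>_pos by (simp add: subspace_scale)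
    thus "(\<lambda>t. (l, x, c l x + t *\<^sub>R e)) ` {0..\<rho> / 4} \<subseteq> \<Lambda> \<times> (X \<inter> ball 0 \<rho>) \<times> (Y \<inter> ball 0 \<rho>)"
      using l x(1) x_lt_\<rho> by auto
  qed
  thus ?thesis unfolding g_def by (intro continuous_intros) simp
qed

text \<open>The intermediate value theorem on the ray through \<open>b\<close>: the length of the
  image runs continuously from 0 to at least \<open>\<beta>\<close>.\<close>

lemma T_surj:
  assumes b: "b \<in> Y" "norm b < \<beta>"
  shows "\<exists>y\<in>Y. norm y \<le> \<rho> / 4 \<and> T l x y = b"
proof (cases "b = 0")
  case True
  thus ?thesis using subspace_0[OF subspace_Y] \<rho>_pos by (intro bexI[of _ 0]) (auto simp: T_def)
next
  case False
  define e where "e = (1 / norm b) *\<^sub>R b"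
  have e: "e \<in> Y" "norm e = 1" "b = norm b *\<^sub>R e"
    using False b subspace_Y by (auto simp: e_def subspace_scale)
  let ?h = "\<lambda>t. sqrt (g l x (t *\<^sub>R e))"
  have te: "t *\<^sub>R e \<in> Y" "norm (t *\<^sub>R e) < \<rho> / 2" if "0 \<le> t" "t \<le> \<rho> / 4" for t
    using that e subspace_Y \<rho>_pos by (auto simp: subspace_scale)
  have h0: "?h 0 = 0" by (simp add: g_def)
  have "sqrt a * norm ((\<rho> / 4) *\<^sub>R e) \<le> ?h (\<rho> / 4)"
    using norm_T_lower[OF te, of "\<rho> / 4"] norm_T[OF te, of "\<rho> / 4"] \<rho>_pos by simp
  hence "norm b \<le> ?h (\<rho> / 4)" using b(2) e(2) \<rho>_pos by (simp add: \<beta>_def)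
  hence "\<exists>t\<ge>0. t \<le> \<rho> / 4 \<and> ?h t = norm b"
    using h0 \<rho>_pos by (intro IVT' continuous_on_g_ray e) auto
  then obtain t where t: "0 \<le> t" "t \<le> \<rho> / 4" "?h t = norm b" by blast
  have "t \<noteq> 0" using t(3) h0 False by auto
  hence "T l x (t *\<^sub>R e) = b" using t e by (simp add: T_def)
  thus ?thesis using te[OF t(1,2)] t e(2) by (intro bexI[of _ "t *\<^sub>R e"]) auto
qed

lemma S_unique:
  assumes "y \<in> Y" "norm y < \<rho> / 2"
  shows "S l x (T l x y) = y"
  unfolding S_def using assms T_inj by (intro the_equality) auto

lemma
  assumes b: "b \<in> Y" "norm b < \<beta>"
  shows S_in: "S l x b \<in> Y" and norm_S: "norm (S l x b) \<le> \<rho> / 4" and T_S: "T l x (S l x b) = b"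
    and norm_S_le: "sqrt a * norm (S l x b) \<le> norm b"
proof -
  obtain y where y: "y \<in> Y" "norm y \<le> \<rho> / 4" "T l x y = b" using T_surj[OF b] by blast
  have y2: "norm y < \<rho> / 2" using y(2) \<rho>_pos by linarith
  have "S l x b = y" using S_unique[OF y(1) y2] y(3) by simp
  thus "S l x b \<in> Y" "norm (S l x b) \<le> \<rho> / 4" "T l x (S l x b) = b" "sqrt a * norm (S l x b) \<le> norm b"
    using y norm_T_lower[OF y(1) y2] by auto
qed

lemma f_S:
  assumes b: "b \<in> Y" "norm b < \<beta>"
  shows "f l (x + (c l x + S l x b)) = f l (x + c l x) + (norm b)\<^sup>2"
proof -
  have "norm (S l x b) < \<rho> / 2" using norm_S[OF b] \<rho>_pos by linarith
  thus ?thesis using f_T[OF S_in[OF b]] T_S[OF b] by simp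
qed

end

lemma continuous_on_T:
  "continuous_on (\<Lambda> \<times> (X \<inter> ball 0 \<sigma>) \<times> (Y \<inter> ball 0 (\<rho> / 2))) (\<lambda>(l, x, y). T l x y)"
  (is "continuous_on ?Z _")
proof -
  have c: "continuous_on ?Z (\<lambda>(l, x, y). c l x)"
  proof -
    have "continuous_on ?Z (\<lambda>p. (\<lambda>(l, x). c l x) (fst p, fst (snd p)))"
      by (rule continuous_on_compose2[OF continuous_on_c]) (auto intro!: continuous_intros)
    thus ?thesis by (simp add: case_prod_beta)
  qed
  have Z: "l \<in> \<Lambda> \<and> x \<in> X \<and> norm x < \<sigma> \<and> norm x < \<rho> \<and> c l x \<in> Y \<and> norm (c l x) < \<rho> \<and> c l x + y \<in> Y \<and> norm (c l x + y) < \<rho>"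
    if "(l, x, y) \<in> ?Z" for l x y
    using that c_add[of l x y] c_in[of l x] norm_c(2)[of l x] x_lt_\<rho>[of l x] by auto
  have g: "continuous_on ?Z (\<lambda>(l, x, y). g l x y)"
  proof -
    have "continuous_on ?Z (\<lambda>p. (\<lambda>(l, x, y). f l (x + y)) (fst p, fst (snd p), (\<lambda>(l, x, y). c l x) p + snd (snd p)))"
      using Z by (intro continuous_on_compose2[OF cont] continuous_intros c) auto
    moreover have "continuous_on ?Z (\<lambda>p. (\<lambda>(l, x, y). f l (x + y)) (fst p, fst (snd p), (\<lambda>(l, x, y). c l x) p))"
      using Z by (intro continuous_on_compose2[OF cont] continuous_intros c) auto
    ultimately show ?thesis
      unfolding g_def case_prod_beta by (intro continuous_on_diff) (simp_all add: case_prod_beta)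
  qed
  show ?thesis
    unfolding continuous_on_def
  proof
    fix p assume p: "p \<in> ?Z"
    obtain l x y where lxy: "p = (l, x, y)" by (cases p)
    show "((\<lambda>(l, x, y). T l x y) \<longlongrightarrow> (\<lambda>(l, x, y). T l x y) p) (at p within ?Z)"
    proof (cases "y = 0")
      case False
      have "((\<lambda>p. (sqrt ((\<lambda>(l, x, y). g l x y) p) / norm (snd (snd p))) *\<^sub>R snd (snd p)) \<longlongrightarrow>
          (sqrt ((\<lambda>(l, x, y). g l x y) p) / norm (snd (snd p))) *\<^sub>R snd (snd p)) (at p within ?Z)"
        using g p False unfolding continuous_on_def lxy by (intro tendsto_intros) auto
      thus ?thesis by (simp add: case_prod_unfold T_def)
    next
      case True
      \<comment> \<open>The direction \<open>y / norm y\<close> has no limit here; the bound by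
        \<open>sqrt K * norm y\<close> replaces it.\<close>
      have "((\<lambda>(l, x, y). T l x y) \<longlongrightarrow> 0) (at p within ?Z)"
      proof (rule tendsto_0_le[where K = "sqrt K"])
        have "((\<lambda>p. snd (snd p)) \<longlongrightarrow> snd (snd p)) (at p within ?Z)" by (intro tendsto_intros)
        thus "((\<lambda>p. snd (snd p)) \<longlongrightarrow> 0) (at p within ?Z)" by (simp add: lxy True)
        show "\<forall>\<^sub>F p' in at p within ?Z. norm (case p' of (l, x, y) \<Rightarrow> T l x y) \<le> norm (snd (snd p')) * sqrt K"
          unfolding eventually_at_filter
          by (rule always_eventually) (auto simp: mult.commute norm_T_upper)
      qed
      thus ?thesis by (simp add: lxy True T_def)
    qed
  qed
qed

text \<open>At \<open>b \<noteq> 0\<close> the length of \<open>S l x b\<close> is controlled by comparing \<open>norm (T l x _)\<close> at two points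
  of the same ray.\<close>

lemma continuous_on_S:
  "continuous_on (\<Lambda> \<times> (X \<inter> ball 0 \<sigma>) \<times> (Y \<inter> ball 0 \<beta>)) (\<lambda>(l, x, b). S l x b)"
  (is "continuous_on ?Z _")
  unfolding continuous_on_def
proof
  fix p assume p: "p \<in> ?Z"
  let ?F = "at p within ?Z"
  let ?S = "\<lambda>(l, x, b). S l x b"
  obtain l x b where lxb: "p = (l, x, b)" by (cases p)
  have pZ: "l \<in> \<Lambda>" "x \<in> X" "norm x < \<sigma>" "b \<in> Y" "norm b < \<beta>" using p lxb by auto
  have evZ: "\<forall>\<^sub>F p' in ?F. p' \<in> ?Z" by (simp add: eventually_at_filter)
  have blim: "((\<lambda>p. snd (snd p)) \<longlongrightarrow> b) ?F"
  proof -
    have "((\<lambda>p. snd (snd p)) \<longlongrightarrow> snd (snd p)) ?F" by (intro tendsto_intros)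
    thus ?thesis by (simp add: lxb)
  qed
  show "(?S \<longlongrightarrow> ?S p) ?F"
  proof (cases "b = 0")
    case True
    have "(?S \<longlongrightarrow> 0) ?F"
    proof (rule tendsto_0_le[where K = "1 / sqrt a"])
      show "((\<lambda>p. snd (snd p)) \<longlongrightarrow> 0) ?F" using blim True by simp
      show "\<forall>\<^sub>F p' in ?F. norm (?S p') \<le> norm (snd (snd p')) * (1 / sqrt a)"
        using evZ
      proof (rule eventually_mono)
        fix p' assume "p' \<in> ?Z"
        thus "norm (?S p') \<le> norm (snd (snd p')) * (1 / sqrt a)"
          using norm_S_le a_pos by (auto simp: field_simps)
      qed
    qed
    moreover have "S l x 0 = 0"
      using norm_S_le[OF pZ(1-3) subspace_0[OF subspace_Y]] \<beta>_pos a_pos by (simp add: mult_le_0_iff)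
    ultimately show ?thesis by (simp add: lxb True)
  next
    case False
    define e where "e p' = (1 / norm (snd (snd p'))) *\<^sub>R snd (snd p')" for p' :: "'l \<times> 'a \<times> 'a"
    define t where "t p' = norm (?S p')" for p'
    have S_te: "?S p' = t p' *\<^sub>R e p' \<and> e p' \<in> Y \<and> norm (e p') = 1 \<and> t p' < \<rho> / 2 \<and>
        norm (snd (snd p')) = sqrt (g (fst p') (fst (snd p')) (t p' *\<^sub>R e p'))"
      if p': "p' \<in> ?Z" "snd (snd p') \<noteq> 0" for p'
    proof -
      obtain l' x' b' where e: "p' = (l', x', b')" by (cases p')
      have Z': "l' \<in> \<Lambda>" "x' \<in> X" "norm x' < \<sigma>" "b' \<in> Y" "norm b' < \<beta>" using p' e by auto
      note S' = S_in[OF Z'] norm_S[OF Z'] T_S[OF Z']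
      have S2: "norm (S l' x' b') < \<rho> / 2" using S'(2) \<rho>_pos by linarith
      have nb: "norm b' = sqrt (g l' x' (S l' x' b'))"
        using norm_T[OF Z'(1-3) S'(1) S2] S'(3) by simp
      have S0: "S l' x' b' \<noteq> 0" using S'(3) p'(2) e by (auto simp: T_def)
      define \<alpha> where "\<alpha> = norm b' / norm (S l' x' b')"
      have nb0: "norm b' \<noteq> 0" "norm (S l' x' b') \<noteq> 0" using p'(2) e S0 by auto
      have b': "b' = \<alpha> *\<^sub>R S l' x' b'"
        using S'(3) nb by (simp add: T_def \<alpha>_def)
      have "norm (S l' x' b') *\<^sub>R ((1 / norm b') *\<^sub>R b') = norm (S l' x' b') *\<^sub>R ((1 / norm b') *\<^sub>R (\<alpha> *\<^sub>R S l' x' b'))"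
        using b' by (rule arg_cong)
      also have "\<dots> = (norm (S l' x' b') * (1 / norm b') * \<alpha>) *\<^sub>R S l' x' b'" by simp
      also have "norm (S l' x' b') * (1 / norm b') * \<alpha> = 1" using nb0 by (simp add: \<alpha>_def)
      finally have 1: "S l' x' b' = t p' *\<^sub>R e p'" by (simp add: e t_def e_def)
      have 2: "e p' \<in> Y" "norm (e p') = 1"
        using Z'(4) nb0(1) subspace_Y by (auto simp: e e_def subspace_scale)
      have 3: "norm b' = sqrt (g l' x' (t p' *\<^sub>R e p'))" using nb 1 by simp
      have 4: "t p' < \<rho> / 2" using S2 by (simp add: e t_def)
      show ?thesis using 1 2 3 4 by (simp only: e prod.case fst_conv snd_conv simp_thms)
    qed
    have ev: "\<forall>\<^sub>F p' in ?F. p' \<in> ?Z \<and> snd (snd p') \<noteq> 0"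
    proof (rule eventually_conj[OF evZ])
      show "\<forall>\<^sub>F p' in ?F. snd (snd p') \<noteq> 0" by (rule tendsto_imp_eventually_ne[OF blim False])
    qed
    have elim: "(e \<longlongrightarrow> e p) ?F"
      unfolding e_def using blim False by (intro tendsto_intros) (auto simp: lxb)
    have pe: "p \<in> ?Z" "snd (snd p) \<noteq> 0" using p False lxb by auto
    \<comment> \<open>Direction of \<open>p'\<close> with the length belonging to \<open>p\<close>.
      Continuity of \<open>T\<close> makes the norm of its value at this point tend to
      \<open>norm b\<close>, as does the norm of the third component of \<open>p'\<close>;
      \<open>sqrt_g_ray\<close> then forces the lengths together.\<close>
    let ?q = "\<lambda>p'. (fst p', fst (snd p'), t p *\<^sub>R e p')"
    have qZ: "\<forall>\<^sub>F p' in ?F. ?q p' \<in> \<Lambda> \<times> (X \<inter> ball 0 \<sigma>) \<times> (Y \<inter> ball 0 (\<rho> / 2))"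
      using ev
    proof (rule eventually_mono)
      fix p' assume "p' \<in> ?Z \<and> snd (snd p') \<noteq> 0"
      thus "?q p' \<in> \<Lambda> \<times> (X \<inter> ball 0 \<sigma>) \<times> (Y \<inter> ball 0 (\<rho> / 2))"
        using S_te[of p'] S_te[OF pe] subspace_Y by (auto simp: subspace_scale t_def)
    qed
    have qp: "?q p \<in> \<Lambda> \<times> (X \<inter> ball 0 \<sigma>) \<times> (Y \<inter> ball 0 (\<rho> / 2))"
      using S_te[OF pe] S_in[OF pZ] pZ by (auto simp: t_def lxb)
    have "(?q \<longlongrightarrow> ?q p) ?F" by (intro tendsto_intros elim)
    hence "((\<lambda>p'. (\<lambda>(l, x, y). T l x y) (?q p')) \<longlongrightarrow> (\<lambda>(l, x, y). T l x y) (?q p)) ?F"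
      by (rule continuous_on_tendsto_compose[OF continuous_on_T _ qp qZ])
    hence "((\<lambda>p'. norm ((\<lambda>(l, x, y). T l x y) (?q p'))) \<longlongrightarrow> norm ((\<lambda>(l, x, y). T l x y) (?q p))) ?F"
      by (rule tendsto_norm)
    moreover have "norm ((\<lambda>(l, x, y). T l x y) (?q p)) = norm b"
      using norm_T[OF pZ(1-3), of "t p *\<^sub>R e p"] qp S_te[OF pe] by (simp add: lxb)
    ultimately have nT: "((\<lambda>p'. norm ((\<lambda>(l, x, y). T l x y) (?q p'))) \<longlongrightarrow> norm b) ?F" by simp
    hence "((\<lambda>p'. norm (snd (snd p')) - norm ((\<lambda>(l, x, y). T l x y) (?q p'))) \<longlongrightarrow> norm b - norm b) ?F"
      by (rule tendsto_diff[OF tendsto_norm[OF blim]])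
    hence z: "((\<lambda>p'. norm (snd (snd p')) - norm ((\<lambda>(l, x, y). T l x y) (?q p'))) \<longlongrightarrow> 0) ?F" by simp
    have "((\<lambda>p'. t p' - t p) \<longlongrightarrow> 0) ?F"
    proof (rule tendsto_0_le[OF z, where K = "sqrt K / a"])
      show "\<forall>\<^sub>F p' in ?F. norm (t p' - t p) \<le>
          norm (norm (snd (snd p')) - norm ((\<lambda>(l, x, y). T l x y) (?q p'))) * (sqrt K / a)"
        using eventually_conj[OF ev qZ]
      proof (rule eventually_mono)
        fix p' assume *: "(p' \<in> ?Z \<and> snd (snd p') \<noteq> 0) \<and> ?q p' \<in> \<Lambda> \<times> (X \<inter> ball 0 \<sigma>) \<times> (Y \<inter> ball 0 (\<rho> / 2))"
        obtain l' x' b' where e': "p' = (l', x', b')" by (cases p')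
        have Z': "l' \<in> \<Lambda>" "x' \<in> X" "norm x' < \<sigma>" using * e' by auto
        have te: "e p' \<in> Y" "norm (e p') = 1" "t p' < \<rho> / 2" "t p < \<rho> / 2"
          "norm b' = sqrt (g l' x' (t p' *\<^sub>R e p'))"
          using S_te[of p'] S_te[OF pe] * e' by auto
        have "norm (T l' x' (t p *\<^sub>R e p')) = sqrt (g l' x' (t p *\<^sub>R e p'))"
          using * e' by (intro norm_T Z') auto
        moreover have "a / sqrt K * \<bar>t p' - t p\<bar> \<le> \<bar>sqrt (g l' x' (t p' *\<^sub>R e p')) - sqrt (g l' x' (t p *\<^sub>R e p'))\<bar>"
          using te by (intro sqrt_g_ray Z') (auto simp: t_def)
        ultimately have "a / sqrt K * \<bar>t p' - t p\<bar> \<le> \<bar>norm b' - norm (T l' x' (t p *\<^sub>R e p'))\<bar>"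
          using te(5) by simp
        thus "norm (t p' - t p) \<le> norm (norm (snd (snd p')) - norm ((\<lambda>(l, x, y). T l x y) (?q p'))) * (sqrt K / a)"
          using a_pos K_pos by (simp add: e' field_simps)
      qed
    qed
    hence "(t \<longlongrightarrow> t p) ?F" by (simp add: LIM_zero_iff)
    hence "((\<lambda>p'. t p' *\<^sub>R e p') \<longlongrightarrow> ?S p) ?F"
      unfolding S_te[OF pe, THEN conjunct1] by (intro tendsto_intros elim)
    moreover have "\<forall>\<^sub>F p' in ?F. t p' *\<^sub>R e p' = ?S p'"
      using ev by (rule eventually_mono) (use S_te in auto)
    ultimately show ?thesis by (rule Lim_transform_eventually)
  qed
qed

lemma
  assumes U: "linear U" "\<And>x y. inner (U x) (U y) = inner x y" "U ` X \<subseteq> X" "U ` Y = Y"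
    and f: "\<And>l x y. l \<in> \<Lambda> \<Longrightarrow> x \<in> X \<Longrightarrow> norm x < \<rho> \<Longrightarrow> y \<in> Y \<Longrightarrow> norm y < \<rho> \<Longrightarrow> f l (U (x + y)) = f l (x + y)"
    and F: "\<And>l x y. l \<in> \<Lambda> \<Longrightarrow> x \<in> X \<Longrightarrow> norm x < \<rho> \<Longrightarrow> y \<in> Y \<Longrightarrow> norm y < \<rho> \<Longrightarrow> F l (U (x + y)) = U (F l (x + y))"
    and l: "l \<in> \<Lambda>" and x: "x \<in> X" "norm x < \<sigma>"
  shows c_equivariant: "c l (U x) = U (c l x)"
    and S_equivariant: "b \<in> Y \<Longrightarrow> norm b < \<beta> \<Longrightarrow> S l (U x) (U b) = U (S l x b)"
proof -
  have nU: "norm (U v) = norm v" for v by (simp add: norm_eq_sqrt_inner U(2))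
  have x\<rho>: "norm x < \<rho>" using x \<sigma>_le \<rho>_pos by linarith
  have Ux: "U x \<in> X" "norm (U x) < \<sigma>" using U(3) x nU by auto
  have UY: "U y \<in> Y" if "y \<in> Y" for y using U(4) that by blast
  show c: "c l (U x) = U (c l x)"
  proof (rule c_unique[OF l Ux])
    show "U (c l x) \<in> Y" "norm (U (c l x)) < \<rho>"
      using UY c_in[OF l x] norm_c(2)[OF l x] nU by auto
    show "critical l (U x) (U (c l x))"
      unfolding critical_def
    proof
      fix v assume "v \<in> Y"
      then obtain v' where v': "v' \<in> Y" "v = U v'" using U(4) by blast
      have "inner (F l (U x + U (c l x))) v = inner (U (F l (x + c l x))) (U v')"
        using F[OF l x(1) x\<rho> c_in[OF l x] norm_c(2)[OF l x]] v'(2) by (simp add: linear_add[OF U(1)])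
      thus "inner (F l (U x + U (c l x))) v = 0"
        using critical_c[OF l x] v'(1) by (simp add: U(2) critical_def)
    qed
  qed
  have T: "T l (U x) (U y) = U (T l x y)" if y: "y \<in> Y" "norm y < \<rho> / 2" for y
  proof -
    have "g l (U x) (U y) = g l x y"
      using f[OF l x(1) x\<rho> c_add[OF l x y]] f[OF l x(1) x\<rho> c_in[OF l x] norm_c(2)[OF l x]]
      unfolding g_def c by (simp add: linear_add[OF U(1)])
    thus ?thesis by (simp add: T_def nU linear_scale[OF U(1)])
  qed
  assume b: "b \<in> Y" "norm b < \<beta>"
  have S2: "norm (S l x b) < \<rho> / 2" using norm_S[OF l x b] \<rho>_pos by linarith
  have "S l (U x) (T l (U x) (U (S l x b))) = U (S l x b)"
    using S2 by (intro S_unique l Ux UY S_in[OF l x b]) (simp add: nU)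
  thus "S l (U x) (U b) = U (S l x b)"
    using T[OF S_in[OF l x b] S2] T_S[OF l x b] by simp
qed

end

section \<open>The saddle reduction\<close>

text \<open>Lets inequalities be imposed one at a time, each on the relatively open set where the
  function in it is already known to be continuous.\<close>

lemma openin_strict_sublevel:
  fixes g :: "'p::topological_space \<Rightarrow> real"
  assumes "openin (top_of_set Z) U" and "continuous_on U g"
  shows "openin (top_of_set Z) {p \<in> U. g p < c}"
proof -
  have "openin (top_of_set U) (U \<inter> g -` {..<c})"
    using continuous_openin_preimage_gen[OF assms(2) open_lessThan] .
  moreover have "U \<inter> g -` {..<c} = {p \<in> U. g p < c}" by auto
  ultimately show ?thesis using assms(1) openin_trans by metis
qed

lemma has_derivative_of_quadratic_error:
  assumes "bounded_linear f'" and "\<And>y. y \<in> S \<Longrightarrow> norm (f y - f x - f' (y - x)) \<le> C * (norm (y - x))\<^sup>2"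
  shows "(f has_derivative f') (at x within S)"
  unfolding has_derivative_within
proof (intro conjI assms(1))
  have "((\<lambda>y. y - x) \<longlongrightarrow> x - x) (at x within S)" by (intro tendsto_intros)
  hence 0: "((\<lambda>y. y - x) \<longlongrightarrow> 0) (at x within S)" by simp
  show "((\<lambda>y. (1 / norm (y - x)) *\<^sub>R (f y - (f x + f' (y - x)))) \<longlongrightarrow> 0) (at x within S)"
  proof (rule tendsto_0_le[OF 0, where K = C])
    show "\<forall>\<^sub>F y in at x within S. norm ((1 / norm (y - x)) *\<^sub>R (f y - (f x + f' (y - x)))) \<le> norm (y - x) * C"
      unfolding eventually_at_filter
    proof (intro always_eventually allI impI)
      fix y assume y: "y \<noteq> x" "y \<in> S"
      have "norm ((1 / norm (y - x)) *\<^sub>R (f y - (f x + f' (y - x)))) = norm (f y - f x - f' (y - x)) / norm (y - x)"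
        by (simp add: diff_diff_eq)
      also have "\<dots> \<le> C * (norm (y - x))\<^sup>2 / norm (y - x)" using assms(2)[OF y(2)] by (intro divide_right_mono) auto
      also have "\<dots> = norm (y - x) * C" using y by (simp add: power2_eq_square)
      finally show "norm ((1 / norm (y - x)) *\<^sub>R (f y - (f x + f' (y - x)))) \<le> norm (y - x) * C" .
    qed
  qed
qed

locale saddle =
  fixes N Hp Hm :: "'a::{real_inner, banach} set" and \<Lambda> :: "'l::metric_space set"
    and f :: "'l \<Rightarrow> 'a \<Rightarrow> real" and F :: "'l \<Rightarrow> 'a \<Rightarrow> 'a" and \<rho> K a :: real
  assumes subspaces: "subspace N" "subspace Hp" "subspace Hm" and closed: "closed N" "closed Hp" "closed Hm"
    and orthogonal: "\<And>z u. z \<in> N \<Longrightarrow> u \<in> Hp \<Longrightarrow> inner z u = 0" "\<And>z v. z \<in> N \<Longrightarrow> v \<in> Hm \<Longrightarrow> inner z v = 0"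
      "\<And>u v. u \<in> Hp \<Longrightarrow> v \<in> Hm \<Longrightarrow> inner u v = 0"
    and split: "\<And>w. \<exists>z u v. z \<in> N \<and> u \<in> Hp \<and> v \<in> Hm \<and> w = z + u + v"
    and \<rho>0: "0 < \<rho>" and K0: "0 < K" and a0: "0 < a"
    and F_lip: "\<And>l l' x y. l \<in> \<Lambda> \<Longrightarrow> l' \<in> \<Lambda> \<Longrightarrow> norm x < \<rho> \<Longrightarrow> norm y < \<rho> \<Longrightarrow>
      norm (F l x - F l' y) \<le> K * (dist l l' + norm (x - y))"
    and f_quad: "\<And>l x y. l \<in> \<Lambda> \<Longrightarrow> norm x < \<rho> \<Longrightarrow> norm y < \<rho> \<Longrightarrow>
      \<bar>f l y - f l x - inner (F l x) (y - x)\<bar> \<le> K * (norm (y - x))\<^sup>2"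
    and f_convex: "\<And>l x y. l \<in> \<Lambda> \<Longrightarrow> norm x < \<rho> \<Longrightarrow> norm y < \<rho> \<Longrightarrow> y - x \<in> Hp \<Longrightarrow>
      f l x + inner (F l x) (y - x) + a * (norm (y - x))\<^sup>2 \<le> f l y"
    and f_concave: "\<And>l x y. l \<in> \<Lambda> \<Longrightarrow> norm x < \<rho> \<Longrightarrow> norm y < \<rho> \<Longrightarrow> y - x \<in> Hm \<Longrightarrow>
      f l y \<le> f l x + inner (F l x) (y - x) - a * (norm (y - x))\<^sup>2"
    and F_zero: "\<And>l. l \<in> \<Lambda> \<Longrightarrow> F l 0 = 0"
    and f_cont: "continuous_on (\<Lambda> \<times> ball 0 \<rho>) (\<lambda>(l, x). f l x)"
begin

text \<open>Maximisation along \<open>Hm\<close>, phrased as a convex problem for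
  \<open>- f\<close>. The radius is halved so that the sum of a base point and a fibre point stays
  in the ball of radius \<open>\<rho>\<close>.\<close>

sublocale A: fibre_convex "Hm\<^sup>\<bottom>" Hm \<Lambda> "\<lambda>l x. - f l x" "\<lambda>l x. - F l x" "\<rho> / 2" K a
proof
  have sum: "norm (x + y) < \<rho>" if "norm x < \<rho> / 2" "norm y < \<rho> / 2" for x y :: 'a
    using that norm_triangle_ineq[of x y] by linarith
  show "subspace (Hm\<^sup>\<bottom>)" by (rule subspace_orthogonal_comp)
  show "subspace Hm" "closed Hm" "0 < \<rho> / 2" "0 < K" "0 < a" using subspaces closed \<rho>0 K0 a0 by auto
  show "inner x y = 0" if "x \<in> Hm\<^sup>\<bottom>" "y \<in> Hm" for x y using that by (simp add: mem_orthogonal_comp)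
  fix l and x y y' :: 'a
  assume l: "l \<in> \<Lambda>" and x: "norm x < \<rho> / 2" and y: "y \<in> Hm" "norm y < \<rho> / 2" and y': "y' \<in> Hm" "norm y' < \<rho> / 2"
  have "(x + y') - (x + y) \<in> Hm" using y y' subspaces subspace_diff by simp
  from f_concave[OF l sum[OF x y(2)] sum[OF x y'(2)] this]
  show "- f l (x + y) + inner (- F l (x + y)) (y' - y) + a * (norm (y' - y))\<^sup>2 \<le> - f l (x + y')" by simp
  from f_quad[OF l sum[OF x y(2)] sum[OF x y'(2)]]
  show "- f l (x + y') \<le> - f l (x + y) + inner (- F l (x + y)) (y' - y) + K * (norm (y' - y))\<^sup>2"
    by (simp add: abs_le_iff)
next
  have sum: "norm (x + y) < \<rho>" if "norm x < \<rho> / 2" "norm y < \<rho> / 2" for x y :: 'a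
    using that norm_triangle_ineq[of x y] by linarith
  show "norm (- F l (x + y) - - F l' (x' + y')) \<le> K * (dist l l' + norm (x + y - (x' + y')))"
    if "l \<in> \<Lambda>" "l' \<in> \<Lambda>" "norm x < \<rho> / 2" "norm x' < \<rho> / 2" "norm y < \<rho> / 2" "norm y' < \<rho> / 2" for l l' x x' y y'
    using F_lip[OF that(1,2) sum[OF that(3,5)] sum[OF that(4,6)]] by (simp add: norm_minus_commute)
  show "- F l 0 = 0" if "l \<in> \<Lambda>" for l using F_zero[OF that] by simp
  let ?Z = "\<Lambda> \<times> (Hm\<^sup>\<bottom> \<inter> ball 0 (\<rho> / 2)) \<times> (Hm \<inter> ball 0 (\<rho> / 2))"
  have "continuous_on ?Z (\<lambda>p. (\<lambda>(l, x). f l x) (fst p, fst (snd p) + snd (snd p)))"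
    by (rule continuous_on_compose2[OF f_cont]) (auto intro!: continuous_intros sum)
  thus "continuous_on ?Z (\<lambda>(l, x, y). - f l (x + y))"
    by (simp add: case_prod_unfold continuous_on_minus)
qed

text \<open>\<open>R\<close> is the full gradient at the maximiser. Being orthogonal to
  \<open>Hm\<close>, it does not see the motion of the maximiser and can act as the gradient of
  \<open>r\<close>.\<close>

definition r :: "'l \<Rightarrow> 'a \<Rightarrow> real" where "r l x = f l (x + A.c l x)"
definition R :: "'l \<Rightarrow> 'a \<Rightarrow> 'a" where "R l x = F l (x + A.c l x)"

text \<open>The Lipschitz factor of the map taking \<open>(l, x)\<close> to
  \<open>x + A.c l x\<close>, as \<open>x_c_lip\<close> makes precise.\<close>

abbreviation "m \<equiv> 1 + K / (2 * a)"

lemma m: "1 \<le> m" using K0 a0 by simp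

lemma norm_x_c:
  assumes "l \<in> \<Lambda>" "x \<in> Hm\<^sup>\<bottom>" "norm x < A.\<sigma>" shows "norm (x + A.c l x) < \<rho>"
  using assms A.norm_c(1)[OF assms] A.\<sigma>_le norm_triangle_ineq[of x "A.c l x"] \<rho>0 by linarith

lemma x_c_lip:
  assumes "l \<in> \<Lambda>" "l' \<in> \<Lambda>" "x \<in> Hm\<^sup>\<bottom>" "norm x < A.\<sigma>" "x' \<in> Hm\<^sup>\<bottom>" "norm x' < A.\<sigma>"
  shows "dist l l' + norm ((x + A.c l x) - (x' + A.c l' x')) \<le> m * (dist l l' + norm (x - x'))"
proof -
  have "norm ((x + A.c l x) - (x' + A.c l' x')) \<le> norm (x - x') + norm (A.c l x - A.c l' x')"
    using norm_triangle_ineq[of "x - x'" "A.c l x - A.c l' x'"] by (simp add: algebra_simps)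
  also have "\<dots> \<le> norm (x - x') + K / (2 * a) * (dist l l' + norm (x - x'))"
    using A.c_lipschitz[OF assms] by simp
  finally show ?thesis by (simp add: algebra_simps)
qed

lemma A_critical:
  assumes "l \<in> \<Lambda>" "x \<in> Hm\<^sup>\<bottom>" "norm x < A.\<sigma>" "v \<in> Hm"
  shows "inner (F l (x + A.c l x)) v = 0"
  using A.critical_c[OF assms(1-3)] assms(4) by (simp add: A.critical_def)

lemma NHp: "z \<in> N \<Longrightarrow> u \<in> Hp \<Longrightarrow> z + u \<in> Hm\<^sup>\<bottom>"
  using orthogonal by (simp add: mem_orthogonal_comp inner_add_left)

text \<open>For convexity the maximiser over \<open>x + y\<close> is kept as a competitor over
  \<open>x + y'\<close>. The upper bound is the quadratic estimate between the two maximisers, whose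
  distance carries the factor \<open>m\<close> and enters squared; the linear term loses the
  increment of \<open>A.c\<close> by criticality. The Lipschitz constant \<open>K * m\<close> of
  \<open>R\<close> is enlarged to \<open>K * m^2\<close> so that one constant serves both.\<close>

sublocale B: fibre_convex N Hp \<Lambda> r R "A.\<sigma> / 2" "K * m\<^sup>2" a
proof
  have sum: "norm (x + y) < A.\<sigma>" if "norm x < A.\<sigma> / 2" "norm y < A.\<sigma> / 2" for x y :: 'a
    using that norm_triangle_ineq[of x y] by linarith
  show "subspace N" "subspace Hp" "closed Hp" "0 < A.\<sigma> / 2" "0 < a" using subspaces closed A.\<sigma>_pos a0 by auto
  show "0 < K * m\<^sup>2" using K0 m by simp
  show "inner x y = 0" if "x \<in> N" "y \<in> Hp" for x y using that orthogonal by simp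
  have mm: "m * t \<le> m\<^sup>2 * t" if "0 \<le> t" for t
    using that m by (intro mult_right_mono) (simp_all add: power2_eq_square)
  show "R l 0 = 0" if "l \<in> \<Lambda>" for l using that by (simp add: R_def A.c_zero F_zero)
  show "norm (R l (x + y) - R l' (x' + y')) \<le> K * m\<^sup>2 * (dist l l' + norm (x + y - (x' + y')))"
    if "l \<in> \<Lambda>" "l' \<in> \<Lambda>" "x \<in> N" "norm x < A.\<sigma> / 2" "x' \<in> N" "norm x' < A.\<sigma> / 2"
      "y \<in> Hp" "norm y < A.\<sigma> / 2" "y' \<in> Hp" "norm y' < A.\<sigma> / 2" for l l' x x' y y'
  proof -
    note w = NHp[OF that(3,7)] sum[OF that(4,8)] and w' = NHp[OF that(5,9)] sum[OF that(6,10)]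
    have "norm (R l (x + y) - R l' (x' + y')) \<le>
        K * (dist l l' + norm ((x + y + A.c l (x + y)) - (x' + y' + A.c l' (x' + y'))))"
      unfolding R_def by (intro F_lip that norm_x_c w w')
    also have "\<dots> \<le> K * (m * (dist l l' + norm (x + y - (x' + y'))))"
      using K0 by (intro mult_left_mono x_c_lip that w w') auto
    also have "\<dots> \<le> K * (m\<^sup>2 * (dist l l' + norm (x + y - (x' + y'))))"
      using K0 by (intro mult_left_mono mm) auto
    finally show ?thesis by (simp add: mult.assoc)
  qed
  fix l x y y' assume l: "l \<in> \<Lambda>" and x: "x \<in> N" "norm x < A.\<sigma> / 2"
    and y: "y \<in> Hp" "norm y < A.\<sigma> / 2" and y': "y' \<in> Hp" "norm y' < A.\<sigma> / 2"
  let ?w = "x + y" and ?w' = "x + y'"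
  note w = NHp[OF x(1) y(1)] sum[OF x(2) y(2)] and w' = NHp[OF x(1) y'(1)] sum[OF x(2) y'(2)]
  have d: "y' - y \<in> Hp" using y y' subspaces subspace_diff by blast
  have nw: "norm (?w' + A.c l ?w) < \<rho>"
    using norm_triangle_ineq[of ?w' "A.c l ?w"] A.norm_c(1)[OF l w] w'(2) A.\<sigma>_le \<rho>0 by linarith
  have "r l ?w + inner (R l ?w) (y' - y) + a * (norm (y' - y))\<^sup>2 \<le> f l (?w' + A.c l ?w)"
    using f_convex[OF l norm_x_c[OF l w] nw] d by (simp add: r_def R_def)
  also have "\<dots> \<le> r l ?w'"
    using A.c_minimal[OF l w' A.c_in[OF l w] A.norm_c(2)[OF l w]] by (simp add: r_def)
  finally show "r l ?w + inner (R l ?w) (y' - y) + a * (norm (y' - y))\<^sup>2 \<le> r l ?w'" .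
  have cd: "A.c l ?w' - A.c l ?w \<in> Hm" using A.c_in l w w' subspaces subspace_diff by blast
  have e: "(?w' + A.c l ?w') - (?w + A.c l ?w) = (y' - y) + (A.c l ?w' - A.c l ?w)" by simp
  have "inner (R l ?w) ((?w' + A.c l ?w') - (?w + A.c l ?w)) = inner (R l ?w) (y' - y)"
    unfolding e inner_add_right R_def using A_critical[OF l w cd] by simp
  moreover have "norm ((?w' + A.c l ?w') - (?w + A.c l ?w)) \<le> m * norm (y' - y)"
    using x_c_lip[OF l l w' w] by simp
  hence "(norm ((?w' + A.c l ?w') - (?w + A.c l ?w)))\<^sup>2 \<le> (m * norm (y' - y))\<^sup>2" by (rule power_mono) simp
  hence "K * (norm ((?w' + A.c l ?w') - (?w + A.c l ?w)))\<^sup>2 \<le> K * (m * norm (y' - y))\<^sup>2"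
    using K0 by (intro mult_left_mono) auto
  ultimately show "r l ?w' \<le> r l ?w + inner (R l ?w) (y' - y) + K * m\<^sup>2 * (norm (y' - y))\<^sup>2"
    using f_quad[OF l norm_x_c[OF l w] norm_x_c[OF l w']]
    unfolding r_def R_def power_mult_distrib abs_le_iff by linarith
next
  let ?Z = "\<Lambda> \<times> (N \<inter> ball 0 (A.\<sigma> / 2)) \<times> (Hp \<inter> ball 0 (A.\<sigma> / 2))"
  have Z: "l \<in> \<Lambda> \<and> x + y \<in> Hm\<^sup>\<bottom> \<and> norm (x + y) < A.\<sigma>" if "(l, x, y) \<in> ?Z" for l x y
    using that NHp norm_triangle_ineq[of x y] by auto
  have "continuous_on ?Z (\<lambda>p. (\<lambda>(l, x). A.c l x) (fst p, fst (snd p) + snd (snd p)))"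
    by (rule continuous_on_compose2[OF A.continuous_on_c]) (use Z in \<open>auto intro!: continuous_intros\<close>)
  hence c: "continuous_on ?Z (\<lambda>p. A.c (fst p) (fst (snd p) + snd (snd p)))" by simp
  have "continuous_on ?Z (\<lambda>p. (\<lambda>(l, x). f l x) (fst p, (fst (snd p) + snd (snd p)) + A.c (fst p) (fst (snd p) + snd (snd p))))"
  proof (rule continuous_on_compose2[OF f_cont])
    show "(\<lambda>p. (fst p, (fst (snd p) + snd (snd p)) + A.c (fst p) (fst (snd p) + snd (snd p)))) ` ?Z \<subseteq> \<Lambda> \<times> ball 0 \<rho>"
      using Z norm_x_c by auto
  qed (intro continuous_intros c)
  thus "continuous_on ?Z (\<lambda>(l, x, y). r l (x + y))" by (simp add: r_def case_prod_unfold)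
qed

definition \<psi> :: "'l \<Rightarrow> 'a \<Rightarrow> 'a" where "\<psi> l z = B.c l z + A.c l (z + B.c l z)"

context
  fixes l z assumes l: "l \<in> \<Lambda>" and z: "z \<in> N" "norm z < B.\<sigma>"
begin

lemma x_base: "z + B.c l z \<in> Hm\<^sup>\<bottom>" "norm (z + B.c l z) < A.\<sigma>"
  using NHp[OF z(1) B.c_in[OF l z]] norm_triangle_ineq[of z "B.c l z"] B.norm_c(1)[OF l z] B.\<sigma>_le z(2) A.\<sigma>_pos
  by auto

lemma \<psi>_critical: "v \<in> Hp \<Longrightarrow> inner (F l (z + \<psi> l z)) v = 0" "v \<in> Hm \<Longrightarrow> inner (F l (z + \<psi> l z)) v = 0"
  using B.critical_c[OF l z] A_critical[OF l x_base]
  by (auto simp: B.critical_def R_def \<psi>_def add.assoc)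

lemma norm_z_\<psi>: "norm (z + \<psi> l z) < \<rho>"
  using norm_x_c[OF l x_base] by (simp add: \<psi>_def add.assoc)

text \<open>The two steps undone in order: criticality along \<open>Hm\<close> forces
  \<open>v\<close> to be the maximiser over \<open>z + u\<close>, and then criticality along
  \<open>Hp\<close> is criticality of \<open>u\<close> for \<open>r\<close>.\<close>

lemma \<psi>_unique:
  assumes u: "u \<in> Hp" "norm u < A.\<sigma> / 2" and v: "v \<in> Hm" "norm v < \<rho> / 2"
    and crit: "\<And>e. e \<in> Hp \<Longrightarrow> inner (F l (z + (u + v))) e = 0" "\<And>e. e \<in> Hm \<Longrightarrow> inner (F l (z + (u + v))) e = 0"
  shows "u + v = \<psi> l z"
proof -
  have "norm (z + u) < A.\<sigma>"
    using norm_triangle_ineq[of z u] u(2) z(2) B.\<sigma>_le A.\<sigma>_pos by auto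
  hence c: "A.c l (z + u) = v"
    using crit(2) by (intro A.c_unique l NHp z u v) (auto simp: A.critical_def add.assoc)
  have "B.c l z = u"
    using crit(1) c by (intro B.c_unique l z u) (auto simp: B.critical_def R_def add.assoc)
  thus ?thesis using c by (simp add: \<psi>_def)
qed

lemma norm_Bc_le: "norm (B.c l z) \<le> K * m\<^sup>2 / (2 * a) * norm z"
  by (rule B.norm_c_le[OF l z])

lemma norm_Ac_le: "norm (A.c l (z + B.c l z)) \<le> K / (2 * a) * ((1 + K * m\<^sup>2 / (2 * a)) * norm z)"
proof -
  have "norm (z + B.c l z) \<le> (1 + K * m\<^sup>2 / (2 * a)) * norm z"
    using norm_Bc_le norm_triangle_ineq[of z "B.c l z"] by (simp add: algebra_simps)
  hence "K / (2 * a) * norm (z + B.c l z) \<le> K / (2 * a) * ((1 + K * m\<^sup>2 / (2 * a)) * norm z)"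
    using K0 a0 by (intro mult_left_mono) auto
  thus ?thesis using A.norm_c_le[OF l x_base] by linarith
qed

end

lemma \<psi>_zero: "l \<in> \<Lambda> \<Longrightarrow> \<psi> l 0 = 0"
  by (simp add: \<psi>_def B.c_zero A.c_zero)

lemma continuous_on_\<psi>: "continuous_on (\<Lambda> \<times> (N \<inter> ball 0 B.\<sigma>)) (\<lambda>(l, z). \<psi> l z)"
proof -
  let ?Z = "\<Lambda> \<times> (N \<inter> ball 0 B.\<sigma>)"
  have b: "continuous_on ?Z (\<lambda>p. B.c (fst p) (snd p))"
    using B.continuous_on_c by (simp add: case_prod_unfold)
  have "continuous_on ?Z (\<lambda>p. (\<lambda>(l, x). A.c l x) (fst p, snd p + B.c (fst p) (snd p)))"
  proof (rule continuous_on_compose2[OF A.continuous_on_c])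
    show "(\<lambda>p. (fst p, snd p + B.c (fst p) (snd p))) ` ?Z \<subseteq> \<Lambda> \<times> (Hm\<^sup>\<bottom> \<inter> ball 0 A.\<sigma>)"
      using x_base by auto
  qed (intro continuous_intros b)
  hence "continuous_on ?Z (\<lambda>p. B.c (fst p) (snd p) + A.c (fst p) (snd p + B.c (fst p) (snd p)))"
    by (intro continuous_on_add b) simp
  thus ?thesis by (simp add: \<psi>_def case_prod_unfold)
qed

text \<open>Product of the Lipschitz factors of the two steps composing the map from
  \<open>z\<close> to \<open>z + \<psi> l z\<close>.\<close>

definition M where "M = m * (1 + K * m\<^sup>2 / (2 * a))"

lemma z_\<psi>_lipschitz:
  assumes l: "l \<in> \<Lambda>" and z: "z \<in> N" "norm z < B.\<sigma>" and z': "z' \<in> N" "norm z' < B.\<sigma>"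
  shows "norm ((z' + \<psi> l z') - (z + \<psi> l z)) \<le> M * norm (z' - z)"
proof -
  have "norm ((z' + B.c l z') - (z + B.c l z)) \<le> norm (z' - z) + norm (B.c l z' - B.c l z)"
    using norm_triangle_ineq[of "z' - z" "B.c l z' - B.c l z"] by (simp add: algebra_simps)
  also have "\<dots> \<le> (1 + K * m\<^sup>2 / (2 * a)) * norm (z' - z)"
    using B.c_lipschitz[OF l l z' z] by (simp add: algebra_simps)
  finally have 1: "norm ((z' + B.c l z') - (z + B.c l z)) \<le> (1 + K * m\<^sup>2 / (2 * a)) * norm (z' - z)" .
  have "norm ((z' + \<psi> l z') - (z + \<psi> l z)) \<le> m * norm ((z' + B.c l z') - (z + B.c l z))"
    using x_c_lip[OF l l x_base[OF l z'] x_base[OF l z]] by (simp add: \<psi>_def add.assoc)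
  also have "\<dots> \<le> m * ((1 + K * m\<^sup>2 / (2 * a)) * norm (z' - z))"
    using 1 m by (intro mult_left_mono) auto
  finally show ?thesis by (simp add: M_def mult.assoc)
qed

lemma \<psi>_in: "l \<in> \<Lambda> \<Longrightarrow> z \<in> N \<Longrightarrow> norm z < B.\<sigma> \<Longrightarrow> \<exists>u\<in>Hp. \<exists>v\<in>Hm. \<psi> l z = u + v"
  unfolding \<psi>_def using B.c_in A.c_in x_base by blast

text \<open>Since \<open>F l (z + \<psi> l z)\<close> is orthogonal to the increments of \<open>\<psi>\<close>, these do not contribute to the
  first order.\<close>

lemma reduced_derivative:
  assumes l: "l \<in> \<Lambda>" and z: "z \<in> N" "norm z < B.\<sigma>" and \<epsilon>: "\<epsilon> \<le> B.\<sigma>"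
  shows "((\<lambda>z. f l (z + \<psi> l z)) has_derivative (\<lambda>h. inner h (F l (z + \<psi> l z)))) (at z within N \<inter> ball 0 \<epsilon>)"
proof (rule has_derivative_of_quadratic_error[where C = "K * M\<^sup>2"])
  show "bounded_linear (\<lambda>h. inner h (F l (z + \<psi> l z)))" by (rule bounded_linear_inner_left)
  fix z' assume "z' \<in> N \<inter> ball 0 \<epsilon>"
  hence z': "z' \<in> N" "norm z' < B.\<sigma>" using \<epsilon> by auto
  let ?w = "z + \<psi> l z" and ?w' = "z' + \<psi> l z'"
  obtain u v u' v' where uv: "u \<in> Hp" "v \<in> Hm" "\<psi> l z = u + v" "u' \<in> Hp" "v' \<in> Hm" "\<psi> l z' = u' + v'"
    using \<psi>_in[OF l z] \<psi>_in[OF l z'] by blast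
  have "u' - u \<in> Hp" "v' - v \<in> Hm" using uv subspaces subspace_diff by blast+
  hence 0: "inner (F l ?w) (u' - u) = 0" "inner (F l ?w) (v' - v) = 0" using \<psi>_critical[OF l z] by blast+
  have "?w' - ?w = (z' - z) + (u' - u) + (v' - v)" unfolding uv by simp
  hence e: "inner (F l ?w) (?w' - ?w) = inner (F l ?w) (z' - z)"
    using 0 by (simp only: inner_add_right)
  have "\<bar>f l ?w' - f l ?w - inner (F l ?w) (?w' - ?w)\<bar> \<le> K * (norm (?w' - ?w))\<^sup>2"
    by (intro f_quad l norm_z_\<psi> z z')
  also have "\<dots> \<le> K * (M * norm (z' - z))\<^sup>2"
    using K0 by (intro mult_left_mono power_mono z_\<psi>_lipschitz l z z') auto
  finally show "norm (f l ?w' - f l ?w - inner (z' - z) (F l ?w)) \<le> K * M\<^sup>2 * (norm (z' - z))\<^sup>2"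
    unfolding e by (simp add: power_mult_distrib mult.assoc inner_commute)
qed

text \<open>The derivative is a composition of Lipschitz maps. The vector representing it is
  orthogonal to \<open>Hp\<close> and \<open>Hm\<close>, hence lies in \<open>N\<close>, so
  \<open>D z\<close> is the derivative on \<open>N\<close> extended by the orthogonal
  projection.\<close>

lemma
  assumes l: "l \<in> \<Lambda>" and \<epsilon>: "\<epsilon> \<le> B.\<sigma>"
  shows reduced_C1: "C1_on (N \<inter> ball 0 \<epsilon>) (\<lambda>z. f l (z + \<psi> l z))"
    and reduced_C2_0: "C2_0_on (N \<inter> ball 0 \<epsilon>) (\<lambda>z. f l (z + \<psi> l z))"
proof -
  let ?S = "N \<inter> ball 0 \<epsilon>"
  define D where "D z = blinfun_inner_left (F l (z + \<psi> l z))" for z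
  have der: "((\<lambda>z. f l (z + \<psi> l z)) has_derivative blinfun_apply (D z)) (at z within ?S)" if "z \<in> ?S" for z
  proof -
    have "z \<in> N" "norm z < B.\<sigma>" using that \<epsilon> by auto
    hence "((\<lambda>z. f l (z + \<psi> l z)) has_derivative (\<lambda>h. inner h (F l (z + \<psi> l z)))) (at z within ?S)"
      using reduced_derivative[OF l _ _ \<epsilon>] by blast
    thus ?thesis by (simp add: D_def blinfun_inner_left.rep_eq)
  qed
  have lipS: "lipschitz_on (K * M) ?S D"
  proof (rule lipschitz_onI)
    have "0 \<le> M" using m K0 a0 by (simp add: M_def)
    thus "0 \<le> K * M" using K0 by simp
    fix z z' assume "z \<in> ?S" "z' \<in> ?S"
    hence z: "z \<in> N" "norm z < B.\<sigma>" "z' \<in> N" "norm z' < B.\<sigma>" using \<epsilon> by auto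
    have "D z - D z' = blinfun_inner_left (F l (z + \<psi> l z) - F l (z' + \<psi> l z'))"
      by (rule blinfun_eqI) (simp add: D_def blinfun_inner_left.rep_eq blinfun.diff_left inner_diff_right)
    moreover have "norm (blinfun_inner_left v) \<le> norm v" for v :: 'a
      by (rule norm_blinfun_bound)
        (simp_all add: blinfun_inner_left.rep_eq, metis Cauchy_Schwarz_ineq2 mult.commute)
    ultimately have "dist (D z) (D z') \<le> norm (F l (z + \<psi> l z) - F l (z' + \<psi> l z'))"
      by (simp add: dist_norm)
    also have "\<dots> \<le> K * (dist l l + norm ((z + \<psi> l z) - (z' + \<psi> l z')))"
      by (intro F_lip l norm_z_\<psi> z)
    also have "\<dots> \<le> K * (M * norm (z - z'))"
      using K0 z_\<psi>_lipschitz[OF l z(3,4,1,2)] by (intro mult_left_mono) auto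
    finally show "dist (D z) (D z') \<le> K * M * dist z z'" by (simp add: dist_norm mult.assoc)
  qed
  show "C1_on ?S (\<lambda>z. f l (z + \<psi> l z))"
    unfolding C1_on_def using der lipschitz_on_continuous_on[OF lipS] by blast
  have "lipschitz_on (K * M) (?S \<inter> ball x 1) D" for x
    by (rule lipschitz_on_subset[OF lipS]) auto
  thus "C2_0_on ?S (\<lambda>z. f l (z + \<psi> l z))"
    unfolding C2_0_on_def using der zero_less_one by blast
qed

end

section \<open>The normal form chart and its explicit inverse\<close>

context saddle
begin

lemma
  assumes "z \<in> N" "u \<in> Hp" "v \<in> Hm"
  shows proj_N: "orth_proj N (z + u + v) = z" and proj_Hp: "orth_proj Hp (z + u + v) = u"
    and proj_Hm: "orth_proj Hm (z + u + v) = v"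
proof -
  have "inner u z = 0" "inner v z = 0" "inner v u = 0" if "z \<in> N" "u \<in> Hp" "v \<in> Hm" for z u v
    using orthogonal that by (metis inner_commute)+
  thus "orth_proj N (z + u + v) = z" "orth_proj Hp (z + u + v) = u" "orth_proj Hm (z + u + v) = v"
    using assms orthogonal
    by (intro orth_proj_unique subspaces; simp add: inner_add_left inner_diff_left)+
qed

lemma proj_sum: "orth_proj N w + orth_proj Hp w + orth_proj Hm w = w"
  using split[of w] proj_N proj_Hp proj_Hm by metis

lemma norm_proj:
  "norm (orth_proj N w) \<le> norm w" "norm (orth_proj Hp w) \<le> norm w" "norm (orth_proj Hm w) \<le> norm w"
  by (intro norm_orth_proj_le subspaces closed)+

lemma proj_in: "orth_proj N w \<in> N" "orth_proj Hp w \<in> Hp" "orth_proj Hm w \<in> Hm"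
  by (intro orth_proj_in subspaces closed)+

lemma continuous_on_proj [continuous_intros]:
  assumes "continuous_on D h"
  shows "continuous_on D (\<lambda>p. orth_proj N (h p))" "continuous_on D (\<lambda>p. orth_proj Hp (h p))"
    "continuous_on D (\<lambda>p. orth_proj Hm (h p))"
  by (intro bounded_linear.continuous_on[OF bounded_linear_orth_proj] subspaces closed assms)+

lemma proj_pair:
  assumes "u \<in> Hp" "v \<in> Hm"
  shows "orth_proj Hp (u + v) = u" "orth_proj Hm (u + v) = v"
  using proj_Hp[OF subspace_0[OF subspaces(1)] assms] proj_Hm[OF subspace_0[OF subspaces(1)] assms] by simp_all

definition chart_x :: "'l \<Rightarrow> 'a \<Rightarrow> 'a \<Rightarrow> 'a" where
  "chart_x l z u = z + (B.c l z + B.S l z (orth_proj Hp u))"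

text \<open>Inverse rescalings applied in turn: the \<open>Hp\<close> part over \<open>z\<close>
  fixes the base point \<open>chart_x\<close>, over which the \<open>Hm\<close> part is then placed.
  Each adds the square of its norm, the second with a minus sign because step \<open>A\<close>
  concerns \<open>- f\<close>.\<close>

definition \<Phi> :: "'l \<Rightarrow> 'a \<Rightarrow> 'a \<Rightarrow> 'a" where
  "\<Phi> l z u = chart_x l z u + (A.c l (chart_x l z u) + A.S l (chart_x l z u) (orth_proj Hm u))"

text \<open>For \<open>p = (l, w)\<close>, the displacement of \<open>w\<close> from the critical
  point of its fibre. The chart is triangular: the \<open>N\<close> and \<open>Hp\<close> parts of
  \<open>w\<close> already determine the base points of both fibres, so inverting it requires no
  further equation.\<close>

definition fibre_p :: "'l \<times> 'a \<Rightarrow> 'a" where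
  "fibre_p p = orth_proj Hp (snd p) - B.c (fst p) (orth_proj N (snd p))"

definition fibre_m :: "'l \<times> 'a \<Rightarrow> 'a" where
  "fibre_m p = orth_proj Hm (snd p) - A.c (fst p) (orth_proj N (snd p) + orth_proj Hp (snd p))"

definition coord_p :: "'l \<times> 'a \<Rightarrow> 'a" where
  "coord_p p = B.T (fst p) (orth_proj N (snd p)) (fibre_p p)"

definition coord_m :: "'l \<times> 'a \<Rightarrow> 'a" where
  "coord_m p = A.T (fst p) (orth_proj N (snd p) + orth_proj Hp (snd p)) (fibre_m p)"

lemma
  assumes l: "l \<in> \<Lambda>" and z: "z \<in> N" "norm z < B.\<sigma>" and u: "orth_proj Hp u = u'" "norm u' < B.\<beta>"
  shows chart_x_in: "chart_x l z u \<in> Hm\<^sup>\<bottom>" "norm (chart_x l z u) < A.\<sigma>"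
    and chart_x_Hp: "B.c l z + B.S l z u' \<in> Hp" "norm (B.c l z + B.S l z u') < A.\<sigma> / 2"
    and r_chart_x: "r l (chart_x l z u) = f l (z + \<psi> l z) + (norm u')\<^sup>2"
proof -
  have u': "u' \<in> Hp" using proj_in u(1) by blast
  note S = B.S_in[OF l z u' u(2)] B.norm_S[OF l z u' u(2)] and c = B.c_in[OF l z] B.norm_c(1)[OF l z]
  show 1: "B.c l z + B.S l z u' \<in> Hp" using S c subspaces subspace_add by blast
  show 2: "norm (B.c l z + B.S l z u') < A.\<sigma> / 2"
    using norm_triangle_ineq[of "B.c l z" "B.S l z u'"] S(2) c(2) A.\<sigma>_pos by linarith
  show "chart_x l z u \<in> Hm\<^sup>\<bottom>" unfolding chart_x_def u(1) by (rule NHp[OF z(1) 1])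
  show "norm (chart_x l z u) < A.\<sigma>"
    using norm_triangle_ineq[of z "B.c l z + B.S l z u'"] 2 z(2) B.\<sigma>_le A.\<sigma>_pos
    unfolding chart_x_def u(1) by linarith
  show "r l (chart_x l z u) = f l (z + \<psi> l z) + (norm u')\<^sup>2"
    using B.f_S[OF l z u' u(2)] unfolding chart_x_def u(1) by (simp add: r_def \<psi>_def add.assoc)
qed

lemma f_\<Phi>:
  assumes "l \<in> \<Lambda>" "z \<in> N" "norm z < B.\<sigma>" "u \<in> Hp" "norm u < B.\<beta>" "v \<in> Hm" "norm v < A.\<beta>"
  shows "f l (\<Phi> l z (u + v)) = (norm u)\<^sup>2 - (norm v)\<^sup>2 + f l (z + \<psi> l z)"
proof -
  have p: "orth_proj Hp (u + v) = u" "orth_proj Hm (u + v) = v" using assms proj_pair by blast+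
  show ?thesis
    using A.f_S[OF assms(1) chart_x_in[OF assms(1-3) p(1) assms(5)] assms(6,7)]
      r_chart_x[OF assms(1-3) p(1) assms(5)]
    by (simp add: \<Phi>_def p(2) r_def)
qed

lemma \<Phi>_zero: "l \<in> \<Lambda> \<Longrightarrow> \<Phi> l 0 0 = 0"
proof -
  assume l: "l \<in> \<Lambda>"
  have 0: "orth_proj M 0 = 0" if "subspace M" for M :: "'a set" using that by (intro orth_proj_zero) auto
  have "B.S l 0 0 = 0" "A.S l 0 0 = 0"
    using B.S_unique[OF l subspace_0[OF subspaces(1)] _ subspace_0[OF subspaces(2)]]
      A.S_unique[OF l subspace_0[OF subspace_orthogonal_comp] _ subspace_0[OF subspaces(3)]]
      B.\<sigma>_pos A.\<sigma>_pos B.\<rho>_pos A.\<rho>_pos by (simp_all add: B.T_def A.T_def)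
  thus ?thesis using 0 subspaces l by (simp add: \<Phi>_def chart_x_def A.c_zero B.c_zero)
qed

text \<open>\<open>\<Omega>\<close> is cut out by strict inequalities on the inverse coordinates,
  hence relatively open. It contains a ball uniform in \<open>l\<close> because these coordinates
  are bounded linearly in \<open>norm w\<close>, with constants independent of
  \<open>l\<close>.\<close>

theorem saddle_homeomorphism:
  assumes \<epsilon>: "0 < \<epsilon>" "\<epsilon> \<le> B.\<sigma>" and \<eta>: "0 < \<eta>" "\<eta> \<le> B.\<beta>" and \<theta>: "0 < \<theta>" "\<theta> \<le> A.\<beta>"
  defines "Dom \<equiv> \<Lambda> \<times> (N \<inter> ball 0 \<epsilon>) \<times> {u + v | u v. u \<in> Hp \<inter> ball 0 \<eta> \<and> v \<in> Hm \<inter> ball 0 \<theta>}"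
  obtains W \<Omega> \<Psi> where "open W" "0 \<in> W" "openin (top_of_set (\<Lambda> \<times> UNIV)) \<Omega>"
    "\<Lambda> \<times> W \<subseteq> \<Omega>" "\<Omega> \<subseteq> \<Lambda> \<times> ball 0 \<rho>" "homeomorphism Dom \<Omega> (\<lambda>(l, z, u). (l, \<Phi> l z u)) \<Psi>"
proof -
  \<comment> \<open>Three stages, since \<open>fibre_p\<close> and \<open>fibre_m\<close> are
    controlled only where the base points are small, and \<open>coord_p\<close> and
    \<open>coord_m\<close> only where these displacements are small as well.\<close>
  define O1 where "O1 = {p \<in> {p \<in> \<Lambda> \<times> UNIV. norm (orth_proj N (snd p)) < \<epsilon>}. norm (orth_proj Hp (snd p)) < A.\<sigma> / 2}"
  define O2 where "O2 = {p \<in> {p \<in> O1. norm (fibre_p p) < A.\<sigma> / 2 / 2}. norm (fibre_m p) < \<rho> / 2 / 2}"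
  define \<Omega> where "\<Omega> = {p \<in> {p \<in> O2. norm (coord_p p) < \<eta>}. norm (coord_m p) < \<theta>}"
  define \<Psi> where "\<Psi> p = (fst p, orth_proj N (snd p), coord_p p + coord_m p)" for p
  have O1: "fst p \<in> \<Lambda>" "norm (orth_proj N (snd p)) < \<epsilon>" "norm (orth_proj N (snd p)) < B.\<sigma>"
    "orth_proj N (snd p) + orth_proj Hp (snd p) \<in> Hm\<^sup>\<bottom>"
    "norm (orth_proj N (snd p) + orth_proj Hp (snd p)) < A.\<sigma>"
    "norm (orth_proj Hp (snd p)) < A.\<sigma> / 2" if "p \<in> O1" for p
    using that \<epsilon> B.\<sigma>_le A.\<sigma>_pos norm_triangle_ineq[of "orth_proj N (snd p)" "orth_proj Hp (snd p)"]
      NHp proj_in by (auto simp: O1_def)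
  have fib: "fibre_p p \<in> Hp" "fibre_m p \<in> Hm" if "p \<in> O1" for p
    unfolding fibre_p_def fibre_m_def
    using B.c_in[OF O1(1)[OF that] proj_in(1) O1(3)[OF that]] A.c_in[OF O1(1,4,5)[OF that]] proj_in subspaces subspace_diff
    by blast+
  have O2: "p \<in> O1" "norm (fibre_p p) < A.\<sigma> / 2 / 2" "norm (fibre_m p) < \<rho> / 2 / 2" if "p \<in> O2" for p
    using that by (auto simp: O2_def)
  have op1: "openin (top_of_set (\<Lambda> \<times> UNIV)) O1"
    unfolding O1_def by (intro openin_strict_sublevel openin_subtopology_self) (auto intro!: continuous_intros)
  have cB: "continuous_on O1 (\<lambda>p. B.c (fst p) (orth_proj N (snd p)))"
  proof -
    have "continuous_on O1 (\<lambda>p. (\<lambda>(l, x). B.c l x) (fst p, orth_proj N (snd p)))"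
      by (rule continuous_on_compose2[OF B.continuous_on_c]) (use O1 proj_in in \<open>auto intro!: continuous_intros\<close>)
    thus ?thesis by simp
  qed
  have cA: "continuous_on O1 (\<lambda>p. A.c (fst p) (orth_proj N (snd p) + orth_proj Hp (snd p)))"
  proof -
    have "continuous_on O1 (\<lambda>p. (\<lambda>(l, x). A.c l x) (fst p, orth_proj N (snd p) + orth_proj Hp (snd p)))"
      by (rule continuous_on_compose2[OF A.continuous_on_c]) (use O1 in \<open>auto intro!: continuous_intros\<close>)
    thus ?thesis by simp
  qed
  have fp: "continuous_on O1 fibre_p" and fm: "continuous_on O1 fibre_m"
    unfolding fibre_p_def[abs_def] fibre_m_def[abs_def] by (intro continuous_intros cA cB)+
  have op2: "openin (top_of_set (\<Lambda> \<times> UNIV)) O2"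
    unfolding O2_def
    by (intro openin_strict_sublevel op1 continuous_on_norm continuous_on_subset[OF fm] fp) auto
  note O12 = O1[OF O2(1)] fib[OF O2(1)] O2(2,3)
  have O21: "O2 \<subseteq> O1" using O2 by blast
  have tp: "continuous_on O2 coord_p"
  proof -
    have "continuous_on O2 (\<lambda>p. (\<lambda>(l, x, y). B.T l x y) (fst p, orth_proj N (snd p), fibre_p p))"
      by (rule continuous_on_compose2[OF B.continuous_on_T])
        (use O12 proj_in in \<open>auto intro!: continuous_intros continuous_on_subset[OF fp O21]\<close>)
    thus ?thesis by (simp add: coord_p_def[abs_def])
  qed
  have tm: "continuous_on O2 coord_m"
  proof -
    have "continuous_on O2 (\<lambda>p. (\<lambda>(l, x, y). A.T l x y) (fst p, orth_proj N (snd p) + orth_proj Hp (snd p), fibre_m p))"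
      by (rule continuous_on_compose2[OF A.continuous_on_T])
        (use O12 in \<open>auto intro!: continuous_intros continuous_on_subset[OF fm O21]\<close>)
    thus ?thesis by (simp add: coord_m_def[abs_def])
  qed
  have op\<Omega>: "openin (top_of_set (\<Lambda> \<times> UNIV)) \<Omega>"
    unfolding \<Omega>_def
    by (intro openin_strict_sublevel op2 continuous_on_norm continuous_on_subset[OF tm] tp) auto
  have \<Omega>: "p \<in> O2" "norm (coord_p p) < \<eta>" "norm (coord_m p) < \<theta>" if "p \<in> \<Omega>" for p
    using that by (auto simp: \<Omega>_def)
  have coord: "coord_p p \<in> Hp" "coord_m p \<in> Hm" if "p \<in> O2" for p
    unfolding coord_p_def coord_m_def
    using O1[OF O2(1)[OF that]] O2[OF that] fib[OF O2(1)[OF that]] proj_in by (intro B.T_in A.T_in; blast)+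
  have Dom: "\<exists>u v. w = u + v \<and> l \<in> \<Lambda> \<and> z \<in> N \<and> norm z < \<epsilon> \<and> norm z < B.\<sigma> \<and> u \<in> Hp \<and> norm u < \<eta> \<and> norm u < B.\<beta> \<and>
      v \<in> Hm \<and> norm v < \<theta> \<and> norm v < A.\<beta> \<and> orth_proj Hp w = u \<and> orth_proj Hm w = v"
    if "(l, z, w) \<in> Dom" for l z w
  proof -
    obtain u v where "w = u + v" "u \<in> Hp" "norm u < \<eta>" "v \<in> Hm" "norm v < \<theta>" "l \<in> \<Lambda>" "z \<in> N" "norm z < \<epsilon>"
      using \<open>(l, z, w) \<in> Dom\<close> by (auto simp: Dom_def)
    thus ?thesis using proj_pair[of u v] \<epsilon> \<eta> \<theta> by (intro exI[of _ u] exI[of _ v]) auto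
  qed
  have hom: "homeomorphism Dom \<Omega> (\<lambda>(l, z, u). (l, \<Phi> l z u)) \<Psi>"
  proof (rule homeomorphismI)
    have D: "fst p \<in> \<Lambda> \<and> fst (snd p) \<in> N \<and> norm (fst (snd p)) < B.\<sigma> \<and>
        orth_proj Hp (snd (snd p)) \<in> Hp \<and> norm (orth_proj Hp (snd (snd p))) < B.\<beta> \<and>
        orth_proj Hm (snd (snd p)) \<in> Hm \<and> norm (orth_proj Hm (snd (snd p))) < A.\<beta> \<and>
        chart_x (fst p) (fst (snd p)) (snd (snd p)) \<in> Hm\<^sup>\<bottom> \<and> norm (chart_x (fst p) (fst (snd p)) (snd (snd p))) < A.\<sigma>"
      if "p \<in> Dom" for p
      using Dom[of "fst p" "fst (snd p)" "snd (snd p)"] that chart_x_in by auto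
    have "continuous_on Dom (\<lambda>p. (\<lambda>(l, x). B.c l x) (fst p, fst (snd p)))"
      by (rule continuous_on_compose2[OF B.continuous_on_c]) (use D in \<open>auto intro!: continuous_intros\<close>)
    moreover have "continuous_on Dom (\<lambda>p. (\<lambda>(l, x, y). B.S l x y) (fst p, fst (snd p), orth_proj Hp (snd (snd p))))"
      by (rule continuous_on_compose2[OF B.continuous_on_S]) (use D in \<open>auto intro!: continuous_intros\<close>)
    ultimately have cx: "continuous_on Dom (\<lambda>p. chart_x (fst p) (fst (snd p)) (snd (snd p)))"
      unfolding chart_x_def prod.case by (intro continuous_intros)
    have "continuous_on Dom (\<lambda>p. (\<lambda>(l, x). A.c l x) (fst p, chart_x (fst p) (fst (snd p)) (snd (snd p))))"
      by (rule continuous_on_compose2[OF A.continuous_on_c]) (use D in \<open>auto intro!: continuous_intros cx\<close>)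
    moreover have "continuous_on Dom (\<lambda>p. (\<lambda>(l, x, y). A.S l x y)
        (fst p, chart_x (fst p) (fst (snd p)) (snd (snd p)), orth_proj Hm (snd (snd p))))"
      by (rule continuous_on_compose2[OF A.continuous_on_S]) (use D in \<open>auto intro!: continuous_intros cx\<close>)
    ultimately have "continuous_on Dom (\<lambda>p. (fst p, \<Phi> (fst p) (fst (snd p)) (snd (snd p))))"
      unfolding \<Phi>_def prod.case by (intro continuous_intros cx)
    thus "continuous_on Dom (\<lambda>(l, z, u). (l, \<Phi> l z u))" by (simp add: case_prod_unfold)
    have \<Omega>2: "\<Omega> \<subseteq> O2" "\<Omega> \<subseteq> O1" using \<Omega> O2 by blast+
    show "continuous_on \<Omega> \<Psi>"
      unfolding \<Psi>_def[abs_def]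
      by (intro continuous_intros continuous_on_subset[OF tp \<Omega>2(1)] continuous_on_subset[OF tm \<Omega>2(1)])
    \<comment> \<open>The orthogonal components of the image can be read off, and \<open>T\<close>
      after \<open>S\<close> then returns \<open>u\<close> and \<open>v\<close>.\<close>
    have main: "(l, \<Phi> l z w) \<in> \<Omega> \<and> \<Psi> (l, \<Phi> l z w) = (l, z, w)" if lzw: "(l, z, w) \<in> Dom" for l z w
    proof -
      obtain u v where d: "w = u + v" "l \<in> \<Lambda>" "z \<in> N" "norm z < \<epsilon>" "norm z < B.\<sigma>" "u \<in> Hp" "norm u < \<eta>" "norm u < B.\<beta>"
        "v \<in> Hm" "norm v < \<theta>" "norm v < A.\<beta>" "orth_proj Hp w = u" "orth_proj Hm w = v"
        using Dom[OF lzw] by blast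
      define x where "x = chart_x l z w"
      note x = chart_x_in[OF d(2,3,5,12,8), folded x_def] chart_x_Hp[OF d(2,3,5,12,8)]
      have xe: "x = z + (B.c l z + B.S l z u)" by (simp add: x_def chart_x_def d(12))
      have vm: "A.c l x + A.S l x v \<in> Hm"
        using A.c_in[OF d(2) x(1,2)] A.S_in[OF d(2) x(1,2) d(9,11)] subspaces subspace_add by blast
      have \<Phi>e: "\<Phi> l z w = z + (B.c l z + B.S l z u) + (A.c l x + A.S l x v)"
        unfolding \<Phi>_def x_def[symmetric] d(13) by (simp only: xe)
      note pr = proj_N[OF d(3) x(3) vm, folded \<Phi>e] proj_Hp[OF d(3) x(3) vm, folded \<Phi>e] proj_Hm[OF d(3) x(3) vm, folded \<Phi>e]
      have fp: "fibre_p (l, \<Phi> l z w) = B.S l z u" by (simp add: fibre_p_def pr)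
      have fm: "fibre_m (l, \<Phi> l z w) = A.S l x v" by (simp add: fibre_m_def pr xe)
      have cp: "coord_p (l, \<Phi> l z w) = u"
        unfolding coord_p_def fp by (simp add: pr B.T_S[OF d(2,3,5,6,8)])
      have cm: "coord_m (l, \<Phi> l z w) = v"
        unfolding coord_m_def fm using A.T_S[OF d(2) x(1,2) d(9,11)] by (simp add: pr xe)
      have "(l, \<Phi> l z w) \<in> O1" using d(2,4) x(4) by (simp add: O1_def pr)
      moreover have "norm (B.S l z u) < A.\<sigma> / 2 / 2" using B.norm_S[OF d(2,3,5,6,8)] A.\<sigma>_pos by linarith
      moreover have "norm (A.S l x v) < \<rho> / 2 / 2" using A.norm_S[OF d(2) x(1,2) d(9,11)] \<rho>0 by linarith
      ultimately have "(l, \<Phi> l z w) \<in> O2" by (simp add: O2_def fp fm)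
      hence "(l, \<Phi> l z w) \<in> \<Omega>" using d(7,10) by (simp add: \<Omega>_def cp cm)
      moreover have "\<Psi> (l, \<Phi> l z w) = (l, z, w)" unfolding \<Psi>_def cp cm snd_conv fst_conv pr d(1)[symmetric] ..
      ultimately show ?thesis by blast
    qed
    thus "(\<lambda>(l, z, u). (l, \<Phi> l z u)) ` Dom \<subseteq> \<Omega>"
      and "\<And>p. p \<in> Dom \<Longrightarrow> \<Psi> ((\<lambda>(l, z, u). (l, \<Phi> l z u)) p) = p" by auto
    show "\<Psi> ` \<Omega> \<subseteq> Dom"
    proof
      fix q assume "q \<in> \<Psi> ` \<Omega>"
      then obtain p where p: "p \<in> \<Omega>" "q = \<Psi> p" by blast
      have "coord_p p + coord_m p \<in> {u + v |u v. u \<in> Hp \<inter> ball 0 \<eta> \<and> v \<in> Hm \<inter> ball 0 \<theta>}"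
        using coord[OF \<Omega>(1)[OF p(1)]] \<Omega>[OF p(1)] by auto
      thus "q \<in> Dom"
        using O1[OF O2(1)[OF \<Omega>(1)[OF p(1)]]] proj_in unfolding p(2) \<Psi>_def Dom_def by auto
    qed
    fix p assume p: "p \<in> \<Omega>"
    obtain l w where lw: "p = (l, w)" by (cases p)
    note o2 = \<Omega>(1)[OF p] and o1 = O2(1)[OF \<Omega>(1)[OF p]]
    let ?z = "orth_proj N w" and ?u = "coord_p p" and ?v = "coord_m p"
    have q: "orth_proj Hp (?u + ?v) = ?u" "orth_proj Hm (?u + ?v) = ?v"
      using proj_pair coord[OF o2] by blast+
    have Su: "B.S l ?z ?u = fibre_p p"
      using B.S_unique[OF O1(1)[OF o1] proj_in(1) O1(3)[OF o1] fib(1)[OF o1] O2(2)[OF o2]]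
      by (simp add: coord_p_def lw)
    have Sv: "A.S l (?z + orth_proj Hp w) ?v = fibre_m p"
      using A.S_unique[OF O1(1,4,5)[OF o1] fib(2)[OF o1] O2(3)[OF o2]]
      by (simp add: coord_m_def lw)
    have cx: "chart_x l ?z (?u + ?v) = ?z + orth_proj Hp w"
      unfolding chart_x_def q Su by (simp add: fibre_p_def lw)
    have "\<Phi> l ?z (?u + ?v) = ?z + orth_proj Hp w + orth_proj Hm w"
      unfolding \<Phi>_def cx q Sv by (simp add: fibre_m_def lw)
    thus "(\<lambda>(l, z, u). (l, \<Phi> l z u)) (\<Psi> p) = p"
      using proj_sum[of w] by (simp add: \<Psi>_def lw)
  qed
  have sub: "\<Omega> \<subseteq> \<Lambda> \<times> ball 0 \<rho>"
  proof
    fix p assume p: "p \<in> \<Omega>"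
    note o2 = O2[OF \<Omega>(1)[OF p]] and o1 = O1[OF O2(1)[OF \<Omega>(1)[OF p]]]
    let ?x = "orth_proj N (snd p) + orth_proj Hp (snd p)"
    have e: "snd p = ?x + (A.c (fst p) ?x + fibre_m p)"
      using proj_sum[of "snd p"] by (simp add: fibre_m_def)
    have "norm (snd p) \<le> norm ?x + (norm (A.c (fst p) ?x) + norm (fibre_m p))"
      using norm_triangle_ineq[of ?x "A.c (fst p) ?x + fibre_m p"] norm_triangle_ineq[of "A.c (fst p) ?x" "fibre_m p"]
        arg_cong[OF e, of norm] by linarith
    also have "\<dots> < \<rho>"
      using o1(5) A.\<sigma>_le A.norm_c(1)[OF o1(1,4,5)] o2(3) \<rho>0 by linarith
    finally show "p \<in> \<Lambda> \<times> ball 0 \<rho>" using o1(1) by (cases p) simp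
  qed
  \<comment> \<open>\<open>k1\<close> and \<open>k0\<close> are the linear bounds for
    \<open>B.c\<close> and \<open>A.c\<close>. \<open>C\<close> exceeds every factor by which
    \<open>norm w\<close> is multiplied below, and \<open>\<omega>\<close> is at most every radius
    to be respected, so the ball of radius \<open>\<omega> / C\<close> fits.\<close>
  define k1 k0 where "k1 = K * m\<^sup>2 / (2 * a)" and "k0 = K / (2 * a)"
  define C where "C = (1 + k1) + (1 + 2 * k0) + sqrt (K * m\<^sup>2) * (1 + k1) + sqrt K * (1 + 2 * k0)"
  have k: "0 \<le> k1" "0 \<le> k0" using K0 a0 by (simp_all add: k1_def k0_def)
  have C: "1 \<le> C" "1 + k1 \<le> C" "1 + 2 * k0 \<le> C" "sqrt (K * m\<^sup>2) * (1 + k1) \<le> C" "sqrt K * (1 + 2 * k0) \<le> C"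
    using k K0 by (simp_all add: C_def add_nonneg_nonneg)
  define \<omega> where "\<omega> = min (min \<epsilon> (A.\<sigma> / 4)) (min (min \<eta> \<theta>) (\<rho> / 4))"
  have \<omega>: "0 < \<omega>" "\<omega> \<le> \<epsilon>" "\<omega> \<le> A.\<sigma> / 4" "\<omega> \<le> \<eta>" "\<omega> \<le> \<theta>" "\<omega> \<le> \<rho> / 4"
    using \<epsilon> \<eta> \<theta> A.\<sigma>_pos \<rho>0 by (auto simp: \<omega>_def)
  have W: "\<Lambda> \<times> ball 0 (\<omega> / C) \<subseteq> \<Omega>"
  proof
    fix p :: "'l \<times> 'a" assume p: "p \<in> \<Lambda> \<times> ball 0 (\<omega> / C)"
    obtain l w where lw: "p = (l, w)" by (cases p)
    have l: "l \<in> \<Lambda>" using p lw by simp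
    have w: "C * norm w < \<omega>" using p lw C(1) by (simp add: field_simps)
    have bnd: "t * norm w < \<omega>" if "t \<le> C" for t
      using mult_right_mono[OF that norm_ge_zero[of w]] w by linarith
    have o1: "p \<in> O1"
      using bnd[OF C(1)] norm_proj[of w] \<omega> A.\<sigma>_pos l by (auto simp: O1_def lw)
    note o = O1[OF o1, unfolded lw fst_conv snd_conv]
    have "norm (fibre_p p) \<le> norm (orth_proj Hp w) + norm (B.c l (orth_proj N w))"
      unfolding fibre_p_def lw fst_conv snd_conv by (rule norm_triangle_ineq4)
    also have "\<dots> \<le> norm w + k1 * norm w"
    proof (intro add_mono norm_proj)
      have "norm (B.c l (orth_proj N w)) \<le> k1 * norm (orth_proj N w)"
        unfolding k1_def by (rule norm_Bc_le[OF l proj_in(1) o(3)])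
      also have "\<dots> \<le> k1 * norm w" using k norm_proj by (intro mult_left_mono) auto
      finally show "norm (B.c l (orth_proj N w)) \<le> k1 * norm w" .
    qed
    finally have fp: "norm (fibre_p p) \<le> (1 + k1) * norm w" by (simp add: algebra_simps)
    have "norm (fibre_m p) \<le> norm (orth_proj Hm w) + norm (A.c l (orth_proj N w + orth_proj Hp w))"
      unfolding fibre_m_def lw fst_conv snd_conv by (rule norm_triangle_ineq4)
    also have "\<dots> \<le> norm w + k0 * (2 * norm w)"
    proof (intro add_mono norm_proj)
      have "norm (A.c l (orth_proj N w + orth_proj Hp w)) \<le> k0 * norm (orth_proj N w + orth_proj Hp w)"
        unfolding k0_def by (rule A.norm_c_le[OF l o(4,5)])
      also have "\<dots> \<le> k0 * (2 * norm w)"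
        using k norm_triangle_ineq[of "orth_proj N w" "orth_proj Hp w"] norm_proj[of w] by (intro mult_left_mono) auto
      finally show "norm (A.c l (orth_proj N w + orth_proj Hp w)) \<le> k0 * (2 * norm w)" .
    qed
    finally have fm: "norm (fibre_m p) \<le> (1 + 2 * k0) * norm w" by (simp add: algebra_simps)
    have fp2: "norm (fibre_p p) < A.\<sigma> / 2 / 2" using fp bnd[OF C(2)] \<omega> by linarith
    have fm2: "norm (fibre_m p) < \<rho> / 2 / 2" using fm bnd[OF C(3)] \<omega> by linarith
    have "norm (coord_p p) \<le> sqrt (K * m\<^sup>2) * norm (fibre_p p)"
      unfolding coord_p_def lw fst_conv snd_conv
      using B.norm_T_upper[OF l proj_in(1) o(3) fib(1)[OF o1] fp2] by (simp only: lw)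
    also have "\<dots> \<le> sqrt (K * m\<^sup>2) * ((1 + k1) * norm w)"
      by (rule mult_left_mono[OF fp]) (use K0 in simp)
    also have "\<dots> < \<eta>" using bnd[OF C(4)] \<omega> by (simp only: mult.assoc)
    finally have 1: "norm (coord_p p) < \<eta>" .
    have "norm (coord_m p) \<le> sqrt K * norm (fibre_m p)"
      unfolding coord_m_def lw fst_conv snd_conv
      using A.norm_T_upper[OF l o(4,5) fib(2)[OF o1] fm2] by (simp only: lw)
    also have "\<dots> \<le> sqrt K * ((1 + 2 * k0) * norm w)"
      by (rule mult_left_mono[OF fm]) (use K0 in simp)
    also have "\<dots> < \<theta>" using bnd[OF C(5)] \<omega> by (simp only: mult.assoc)
    finally show "p \<in> \<Omega>" using 1 o1 fp2 fm2 by (simp add: \<Omega>_def O2_def)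
  qed
  show ?thesis
    using that[OF open_ball _ op\<Omega> W sub hom] \<omega>(1) C(1) by simp
qed

lemma
  assumes U: "linear U" "\<And>x y. inner (U x) (U y) = inner x y" "U ` N \<subseteq> N" "U ` Hp = Hp" "U ` Hm = Hm"
    and f: "\<And>l w. l \<in> \<Lambda> \<Longrightarrow> norm w < \<rho> \<Longrightarrow> f l (U w) = f l w"
    and F: "\<And>l w. l \<in> \<Lambda> \<Longrightarrow> norm w < \<rho> \<Longrightarrow> F l (U w) = U (F l w)"
    and l: "l \<in> \<Lambda>" and z: "z \<in> N" "norm z < B.\<sigma>"
  shows \<psi>_equivariant: "\<psi> l (U z) = U (\<psi> l z)"
    and \<Phi>_equivariant: "u \<in> Hp \<Longrightarrow> norm u < B.\<beta> \<Longrightarrow> v \<in> Hm \<Longrightarrow> norm v < A.\<beta> \<Longrightarrow>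
      \<Phi> l (U z) (U (u + v)) = U (\<Phi> l z (u + v))"
proof -
  interpret U: linear U by (rule U(1))
  have Uperp: "U ` (Hm\<^sup>\<bottom>) \<subseteq> Hm\<^sup>\<bottom>"
  proof
    fix y assume "y \<in> U ` (Hm\<^sup>\<bottom>)"
    then obtain x where x: "x \<in> Hm\<^sup>\<bottom>" "y = U x" by blast
    show "y \<in> Hm\<^sup>\<bottom>" unfolding mem_orthogonal_comp
    proof
      fix v assume "v \<in> Hm"
      then obtain v' where "v' \<in> Hm" "v = U v'" using U(5) by blast
      thus "inner y v = 0" using x U(2) by (simp add: mem_orthogonal_comp)
    qed
  qed
  have sum: "norm (x + y) < \<rho>" if "norm x < \<rho> / 2" "norm y < \<rho> / 2" for x y :: 'a
    using that norm_triangle_ineq[of x y] by linarith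
  have A_eq: "A.c l (U x) = U (A.c l x)" "b \<in> Hm \<Longrightarrow> norm b < A.\<beta> \<Longrightarrow> A.S l (U x) (U b) = U (A.S l x b)"
    if "l \<in> \<Lambda>" "x \<in> Hm\<^sup>\<bottom>" "norm x < A.\<sigma>" for l x b
    using that f F sum
    by (intro A.c_equivariant[OF U(1,2) Uperp U(5)] A.S_equivariant[OF U(1,2) Uperp U(5)]; simp add: U.neg)+
  have sum2: "norm (x + y) < A.\<sigma>" if "norm x < A.\<sigma> / 2" "norm y < A.\<sigma> / 2" for x y :: 'a
    using that norm_triangle_ineq[of x y] by linarith
  have rR: "r l (U x) = r l x" "R l (U x) = U (R l x)" if "l \<in> \<Lambda>" "x \<in> Hm\<^sup>\<bottom>" "norm x < A.\<sigma>" for l x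
    using f[OF that(1) norm_x_c[OF that]] F[OF that(1) norm_x_c[OF that]] A_eq(1)[OF that]
    by (simp_all add: r_def R_def U.add)
  have B_eq: "B.c l (U z) = U (B.c l z)" "b \<in> Hp \<Longrightarrow> norm b < B.\<beta> \<Longrightarrow> B.S l (U z) (U b) = U (B.S l z b)" for b
    using rR NHp sum2
    by (intro B.c_equivariant[OF U(1-4) _ _ l z] B.S_equivariant[OF U(1-4) _ _ l z]; simp)+
  show "\<psi> l (U z) = U (\<psi> l z)"
    unfolding \<psi>_def B_eq(1) U.add[symmetric] A_eq(1)[OF l x_base[OF l z]] ..
  assume u: "u \<in> Hp" "norm u < B.\<beta>" and v: "v \<in> Hm" "norm v < A.\<beta>"
  have p: "orth_proj Hp (u + v) = u" "orth_proj Hm (u + v) = v" using proj_pair u v by blast+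
  have "U u \<in> Hp" "U v \<in> Hm" using U u v by blast+
  hence Up: "orth_proj Hp (U (u + v)) = U u" "orth_proj Hm (U (u + v)) = U v"
    using proj_pair[of "U u" "U v"] by (simp_all add: U.add)
  have cx: "chart_x l (U z) (U (u + v)) = U (chart_x l z (u + v))"
    unfolding chart_x_def p Up B_eq(1) B_eq(2)[OF u] by (simp only: U.add)
  note x = chart_x_in[OF l z p(1) u(2)]
  show "\<Phi> l (U z) (U (u + v)) = U (\<Phi> l z (u + v))"
    unfolding \<Phi>_def cx p Up A_eq(1)[OF l x] A_eq(2)[OF l x v] by (simp only: U.add)
qed

end

section \<open>Equivariance\<close>

text \<open>The inverse is carried along because an isometry of an infinite-dimensional space need
  not be onto. Statements about \<open>U\<close> transfer to \<open>U'\<close> by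
  \<open>swap\<close>.\<close>

locale invertible_isometry =
  fixes U U' :: "'a::{real_inner, banach} \<Rightarrow> 'a"
  assumes lin: "linear U" and lin': "linear U'"
    and iso: "\<And>x y. inner (U x) (U y) = inner x y" and iso': "\<And>x y. inner (U' x) (U' y) = inner x y"
    and UU': "\<And>x. U (U' x) = x" and U'U: "\<And>x. U' (U x) = x"
begin

lemma norm_U: "norm (U x) = norm x" and norm_U': "norm (U' x) = norm x"
  by (simp_all add: norm_eq_sqrt_inner iso iso')

lemma bounded_linear_U: "bounded_linear U" and bounded_linear_U': "bounded_linear U'"
  by (intro bounded_linear_intro[of _ 1]; simp add: norm_U norm_U' lin lin' linear_add linear_scale)+

lemma swap: "invertible_isometry U' U"
  by (rule invertible_isometry.intro[OF lin' lin iso' iso U'U UU'])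

lemma inner_U: "inner (U x) y = inner x (U' y)"
  using iso[of x "U' y"] by (simp add: UU')

text \<open>Differentiating the invariance of \<open>f\<close> gives
  \<open>U' (gradient f (U x)) = gradient f x\<close>, since \<open>U'\<close> is the adjoint of
  \<open>U\<close>.\<close>

lemma gradient_equivariant:
  fixes f :: "'a \<Rightarrow> real"
  assumes V: "open V" "U ` V \<subseteq> V" and f: "\<And>x. x \<in> V \<Longrightarrow> f (U x) = f x"
    and gd: "\<And>x. x \<in> V \<Longrightarrow> GDERIV f x :> gradient f x" and x: "x \<in> V"
  shows "gradient f (U x) = U (gradient f x)"
proof -
  have "(f has_derivative (\<lambda>h. inner h (gradient f (U x)))) (at (U x))"
    using gd[of "U x"] V x by (auto simp: gderiv_def)
  moreover have "(U has_derivative U) (at x)" by (rule bounded_linear_imp_has_derivative[OF bounded_linear_U])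
  ultimately have "((\<lambda>x. f (U x)) has_derivative (\<lambda>h. inner (U h) (gradient f (U x)))) (at x)"
    by (rule has_derivative_compose[rotated])
  hence "(f has_derivative (\<lambda>h. inner (U h) (gradient f (U x)))) (at x)"
    by (rule has_derivative_transform_within_open[OF _ V(1) x]) (rule f)
  hence "GDERIV f x :> U' (gradient f (U x))" by (simp add: gderiv_def inner_U)
  hence "gradient f x = U' (gradient f (U x))" by (rule GDERIV_gradient_eq)
  thus ?thesis by (simp add: UU')
qed

lemma gateaux_commutes:
  assumes V: "open V" "0 \<in> V" and F: "\<And>x. x \<in> V \<Longrightarrow> F (U x) = U (F x)" and A: "has_gateaux_derivative F A 0"
  shows "A (U h) = U (A h)"
proof (rule tendsto_unique)
  interpret U: bounded_linear U by (rule bounded_linear_U)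
  show "at (0::real) \<noteq> bot" by simp
  show "((\<lambda>t::real. (1 / t) *\<^sub>R (F (0 + t *\<^sub>R U h) - F 0)) \<longlongrightarrow> A (U h)) (at 0)"
    using A unfolding has_gateaux_derivative_def by blast
  have "((\<lambda>t::real. U ((1 / t) *\<^sub>R (F (0 + t *\<^sub>R h) - F 0))) \<longlongrightarrow> U (A h)) (at 0)"
    using A unfolding has_gateaux_derivative_def by (intro U.tendsto) blast
  moreover have "\<forall>\<^sub>F t::real in at 0. t *\<^sub>R h \<in> V"
  proof -
    have "((\<lambda>t::real. t *\<^sub>R h) \<longlongrightarrow> 0 *\<^sub>R h) (at 0)" by (intro tendsto_intros)
    thus ?thesis using V by (auto dest!: topological_tendstoD[OF _ V(1)])
  qed
  hence "\<forall>\<^sub>F t::real in at 0. U ((1 / t) *\<^sub>R (F (0 + t *\<^sub>R h) - F 0)) = (1 / t) *\<^sub>R (F (0 + t *\<^sub>R U h) - F 0)"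
    by (rule eventually_mono) (use F[OF V(2)] F in \<open>simp add: U.scaleR U.diff U.zero flip: F\<close>)
  ultimately show "((\<lambda>t::real. (1 / t) *\<^sub>R (F (0 + t *\<^sub>R U h) - F 0)) \<longlongrightarrow> U (A h)) (at 0)"
    by (rule Lim_transform_eventually)
qed

lemma closed_image: "closed M \<Longrightarrow> closed (U ` M)"
proof -
  assume "closed M"
  hence "closed (U' -` M)"
    by (rule closed_vimage) (simp add: linear_continuous_on bounded_linear_U')
  moreover have "U ` M = U' -` M"
    by (auto simp: U'U intro: image_eqI[of _ U, OF UU'[symmetric]])
  ultimately show ?thesis by simp
qed

text \<open>If \<open>A\<close> commutes with \<open>U\<close>, images under \<open>U\<close> of
  members of the families defining the spectral spaces are members again.\<close>

lemma
  fixes A :: "'a \<Rightarrow>\<^sub>L 'a"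
  assumes A: "\<And>x. A (U x) = U (A x)"
  shows pos_space_image: "U ` pos_space A \<subseteq> pos_space A" and neg_space_image: "U ` neg_space A \<subseteq> neg_space A"
    and null_space_image: "U ` null_space A \<subseteq> null_space A"
proof -
  have im: "subspace (U ` M) \<and> closed (U ` M) \<and> A ` U ` M \<subseteq> U ` M"
    if "subspace M" "closed M" "A ` M \<subseteq> M" for M
    using that closed_image linear_subspace_image[OF lin] by (auto simp: A)
  have U0: "U x = 0 \<longleftrightarrow> x = 0" for x using norm_U by (metis norm_eq_zero)
  show "U ` pos_space A \<subseteq> pos_space A"
  proof
    fix y assume "y \<in> U ` pos_space A"
    then obtain x M where x: "y = U x" "x \<in> M" and M: "subspace M" "closed M" "A ` M \<subseteq> M"
      "\<forall>x\<in>M. x \<noteq> 0 \<longrightarrow> 0 < inner (A x) x" unfolding pos_space_def by blast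
    have "\<forall>x\<in>U ` M. x \<noteq> 0 \<longrightarrow> 0 < inner (A x) x" using M(4) by (auto simp: A iso U0)
    thus "y \<in> pos_space A" unfolding pos_space_def using im[OF M(1-3)] x by blast
  qed
  show "U ` neg_space A \<subseteq> neg_space A"
  proof
    fix y assume "y \<in> U ` neg_space A"
    then obtain x M where x: "y = U x" "x \<in> M" and M: "subspace M" "closed M" "A ` M \<subseteq> M"
      "\<forall>x\<in>M. x \<noteq> 0 \<longrightarrow> inner (A x) x < 0" unfolding neg_space_def by blast
    have "\<forall>x\<in>U ` M. x \<noteq> 0 \<longrightarrow> inner (A x) x < 0" using M(4) by (auto simp: A iso U0)
    thus "y \<in> neg_space A" unfolding neg_space_def using im[OF M(1-3)] x by blast
  qed
  show "U ` null_space A \<subseteq> null_space A" by (auto simp: null_space_def A linear_0[OF lin])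
qed

lemma
  fixes A :: "'a \<Rightarrow>\<^sub>L 'a"
  assumes A: "\<And>x. A (U x) = U (A x)"
  shows pos_space_image_eq: "U ` pos_space A = pos_space A" and neg_space_image_eq: "U ` neg_space A = neg_space A"
    and null_space_perp_image: "U ` {x. \<forall>y\<in>null_space A. inner y x = 0} \<subseteq> {x. \<forall>y\<in>null_space A. inner y x = 0}"
proof -
  interpret I: invertible_isometry U' U by (rule swap)
  have A': "A (U' x) = U' (A x)" for x using A[of "U' x"] by (metis UU' U'U)
  have e: "U ` M = M" if "U ` M \<subseteq> M" "U' ` M \<subseteq> M" for M
  proof
    show "M \<subseteq> U ` M" using that(2) UU' by (metis image_eqI image_subset_iff subsetI)
  qed (rule that)
  show "U ` pos_space A = pos_space A" "U ` neg_space A = neg_space A"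
    using pos_space_image[of A] neg_space_image[of A] I.pos_space_image[of A] I.neg_space_image[of A] A A'
    by (intro e; blast)+
  have "inner y (U x) = inner (U' y) x" for x y using inner_U[of x y] by (simp add: inner_commute)
  thus "U ` {x. \<forall>y\<in>null_space A. inner y x = 0} \<subseteq> {x. \<forall>y\<in>null_space A. inner y x = 0}"
    using I.null_space_image[OF A'] by auto
qed

end

lemma orthogonal_action_isometry:
  assumes "orthogonal_action K T act" "group K" "g \<in> carrier K"
  shows "invertible_isometry (act g) (act (inv\<^bsub>K\<^esub> g))"
proof -
  interpret group K by fact
  note act = assms(1)[unfolded orthogonal_action_def]
  have inv: "inv\<^bsub>K\<^esub> g \<in> carrier K" using assms(3) by simp
  have "act g (act (inv\<^bsub>K\<^esub> g) x) = x" "act (inv\<^bsub>K\<^esub> g) (act g x) = x" for x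
    using act assms(3) inv by (metis r_inv, metis l_inv)
  thus ?thesis using act assms(3) inv by (intro invertible_isometry.intro) auto
qed

section \<open>The parametrised splitting theorem\<close>

theorem theorem2p16:
  fixes V :: "'a::{real_inner, banach} set"
    and L :: "'a \<Rightarrow> real"
    and G :: "'n::finite \<Rightarrow> 'a \<Rightarrow> real"
    and B P Q :: "'a \<Rightarrow> 'a \<Rightarrow>\<^sub>L 'a"
    and G2 :: "'n \<Rightarrow> 'a \<Rightarrow> 'a \<Rightarrow>\<^sub>L 'a"
  assumes "open V" and "0 \<in> V"
    and "C1_on V L" and "(L has_derivative (\<lambda>h. 0)) (at 0)"
    and "hypothesis_A V L B P Q"
    and "null_space (B 0) \<noteq> {0}"
    and "\<And>j. C1_on V (G j)" and "\<And>j. (G j has_derivative (\<lambda>h. 0)) (at 0)"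
    and "\<And>j u. u \<in> V \<Longrightarrow> has_gateaux_derivative (gradient (G j)) (G2 j u) u"
    and "\<And>j u. u \<in> V \<Longrightarrow> self_adjoint (G2 j u)"
    and "\<And>j. continuous (at 0 within V) (G2 j)"
  shows "\<exists>\<delta>>0. \<exists>\<epsilon>>0. \<exists>r>0. \<exists>s>0.
    (\<forall>z\<in>null_ball (B 0) \<epsilon>. \<forall>u\<in>pos_neg_ball (B 0) r s. z + u \<in> V) \<and>
    (\<exists>\<psi> :: real ^ 'n \<Rightarrow> 'a \<Rightarrow> 'a.
      reduction_map L G (B 0) \<delta> \<epsilon> r s \<psi> \<and>
      (\<forall>\<psi>'. reduction_map L G (B 0) \<delta> \<epsilon> r s \<psi>' \<longrightarrow>
         (\<forall>l\<in>param_cube \<delta>. \<forall>z\<in>null_ball (B 0) \<epsilon>. \<psi>' l z = \<psi> l z)) \<and>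
      (\<exists>(W :: 'a set) (\<Omega> :: ((real ^ 'n) \<times> 'a) set) (\<Phi> :: real ^ 'n \<Rightarrow> 'a \<Rightarrow> 'a \<Rightarrow> 'a).
        open W \<and> 0 \<in> W \<and>
        openin (top_of_set (param_cube \<delta> \<times> UNIV)) \<Omega> \<and>
        param_cube \<delta> \<times> W \<subseteq> \<Omega> \<and> \<Omega> \<subseteq> param_cube \<delta> \<times> V \<and>
        (\<exists>\<Psi>. homeomorphism (param_cube \<delta> \<times> null_ball (B 0) \<epsilon> \<times> pos_neg_ball (B 0) r s) \<Omega>
               (\<lambda>(l, z, u). (l, \<Phi> l z u)) \<Psi>) \<and>
        (\<forall>l\<in>param_cube \<delta>. \<Phi> l 0 0 = 0) \<and>
        (\<forall>l\<in>param_cube \<delta>. \<forall>z\<in>null_ball (B 0) \<epsilon>.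
          \<forall>up\<in>pos_ball (B 0) r. \<forall>um\<in>neg_ball (B 0) s.
            perturbed L G l (\<Phi> l z (up + um)) =
              (norm up)\<^sup>2 - (norm um)\<^sup>2 + perturbed L G l (z + \<psi> l z)) \<and>
        (\<forall>l\<in>param_cube \<delta>.
          C1_on (null_ball (B 0) \<epsilon>) (\<lambda>z. perturbed L G l (z + \<psi> l z)) \<and>
          (\<forall>z\<in>null_ball (B 0) \<epsilon>.
            ((\<lambda>z. perturbed L G l (z + \<psi> l z)) has_derivative
              (\<lambda>h. frechet_derivative L (at (z + \<psi> l z)) h
                 + (\<Sum>j\<in>UNIV. l $ j * frechet_derivative (G j) (at (z + \<psi> l z)) h)))
              (at z within null_ball (B 0) \<epsilon>))) \<and>
        (C2_0_on V L \<and> (\<forall>j. C2_0_on V (G j)) \<longrightarrow>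
          (\<forall>l\<in>param_cube \<delta>.
            C2_0_on (null_ball (B 0) \<epsilon>) (\<lambda>z. perturbed L G l (z + \<psi> l z)))) \<and>
        (\<forall>(K :: 'g monoid) (T :: 'g topology) (act :: 'g \<Rightarrow> 'a \<Rightarrow> 'a).
          compact_lie_group TYPE('e::euclidean_space) K T \<and> orthogonal_action K T act \<and>
          (\<forall>g\<in>carrier K. act g ` V \<subseteq> V \<and>
             (\<forall>x\<in>V. L (act g x) = L x \<and> (\<forall>j. G j (act g x) = G j x))) \<longrightarrow>
          (\<forall>g\<in>carrier K.
            act g ` null_space (B 0) \<subseteq> null_space (B 0) \<and>
            act g ` {x. \<forall>y\<in>null_space (B 0). inner y x = 0}
              \<subseteq> {x. \<forall>y\<in>null_space (B 0). inner y x = 0} \<and>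
            (\<forall>l\<in>param_cube \<delta>. \<forall>z\<in>null_ball (B 0) \<epsilon>.
              \<psi> l (act g z) = act g (\<psi> l z) \<and>
              (\<forall>u\<in>pos_neg_ball (B 0) r s. \<Phi> l (act g z) (act g u) = act g (\<Phi> l z u)) \<and>
              perturbed L G l (act g z + \<psi> l (act g z)) = perturbed L G l (z + \<psi> l z))))))"
proof -
  note V = assms(1,2) and L = assms(3,4) and A = assms(5) and G = assms(7,8) and G2 = assms(9,11)
  obtain C where "coercive_plus_compact (P 0) (Q 0) C"
    using hypothesis_A_local_bounds[OF V A] by metis
  then interpret cpc: coercive_plus_compact "P 0" "Q 0" C .
  have B0: "B 0 = P 0 + Q 0" using A V by (simp add: hypothesis_A_def)
  let ?N = "null_space (B 0)" and ?Hp = "pos_space (B 0)" and ?Hm = "neg_space (B 0)"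
  let ?f = "perturbed L G" and ?F = "pgrad L G"
  obtain \<rho> \<delta> a K where pos: "0 < \<rho>" "0 < \<delta>" "0 < a" "0 < K" and \<rho>V: "ball 0 \<rho> \<subseteq> V"
    and gd: "\<And>l x. x \<in> V \<Longrightarrow> GDERIV (?f l) x :> ?F l x"
    and F0: "\<And>l. ?F l 0 = 0"
    and est: "\<And>l l' x y. l \<in> param_cube \<delta> \<Longrightarrow> l' \<in> param_cube \<delta> \<Longrightarrow> x \<in> ball 0 \<rho> \<Longrightarrow> y \<in> ball 0 \<rho> \<Longrightarrow>
      norm (?F l x - ?F l' y) \<le> K * (dist l l' + norm (x - y))"
      "\<And>l x y. l \<in> param_cube \<delta> \<Longrightarrow> x \<in> ball 0 \<rho> \<Longrightarrow> y \<in> ball 0 \<rho> \<Longrightarrow>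
      \<bar>?f l y - ?f l x - inner (?F l x) (y - x)\<bar> \<le> K * (norm (y - x))\<^sup>2"
      "\<And>l x y. l \<in> param_cube \<delta> \<Longrightarrow> x \<in> ball 0 \<rho> \<Longrightarrow> y \<in> ball 0 \<rho> \<Longrightarrow> y - x \<in> ?Hp \<Longrightarrow>
      ?f l x + inner (?F l x) (y - x) + a * (norm (y - x))\<^sup>2 \<le> ?f l y"
      "\<And>l x y. l \<in> param_cube \<delta> \<Longrightarrow> x \<in> ball 0 \<rho> \<Longrightarrow> y \<in> ball 0 \<rho> \<Longrightarrow> y - x \<in> ?Hm \<Longrightarrow>
      ?f l y \<le> ?f l x + inner (?F l x) (y - x) - a * (norm (y - x))\<^sup>2"
    by (rule perturbed_local_estimates[where V = V and L = L and G = G and B = B and P = P and Q = Q and ?G2.0 = G2],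
        (erule assms | rule assms)+, (rule that; assumption))
  have C1: "GDERIV f x :> gradient f x" if f: "C1_on V f" and x: "x \<in> V" for f :: "'a \<Rightarrow> real" and x
  proof -
    obtain f' where "(f has_derivative blinfun_apply (f' x)) (at x within V)"
      using f x unfolding C1_on_def by blast
    hence "(f has_derivative blinfun_apply (f' x)) (at x)" using at_within_open[OF x V(1)] by simp
    thus ?thesis by (rule has_derivative_gradient)
  qed
  have cont: "continuous_on (ball 0 \<rho>) f" if "C1_on V f" for f :: "'a \<Rightarrow> real"
    using C1[OF that] \<rho>V unfolding gderiv_def
    by (intro continuous_at_imp_continuous_on ballI has_derivative_continuous) blast
  interpret S: saddle ?N ?Hp ?Hm "param_cube \<delta>" ?f ?F \<rho> K a
  proof
    show "subspace ?N" "subspace ?Hp" "subspace ?Hm" "closed ?N" "closed ?Hp" "closed ?Hm"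
      unfolding B0 by (rule cpc.subspace_null_space cpc.subspace_pos_space cpc.subspace_neg_space
          cpc.closed_null_space cpc.closed_pos_space cpc.closed_neg_space)+
    show "\<And>z u. z \<in> ?N \<Longrightarrow> u \<in> ?Hp \<Longrightarrow> inner z u = 0" "\<And>z v. z \<in> ?N \<Longrightarrow> v \<in> ?Hm \<Longrightarrow> inner z v = 0"
      "\<And>u v. u \<in> ?Hp \<Longrightarrow> v \<in> ?Hm \<Longrightarrow> inner u v = 0"
      "\<And>w. \<exists>z u v. z \<in> ?N \<and> u \<in> ?Hp \<and> v \<in> ?Hm \<and> w = z + u + v"
      unfolding B0 by (rule cpc.null_pos_orthogonal cpc.null_neg_orthogonal cpc.pos_neg_orthogonal cpc.splitting; assumption)+
    have "continuous_on (param_cube \<delta> \<times> ball 0 \<rho>) (\<lambda>p. L (snd p) + (\<Sum>j\<in>UNIV. fst p $ j * G j (snd p)))"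
      by (intro continuous_intros continuous_on_compose2[OF cont[OF L(1)]] continuous_on_compose2[OF cont[OF G(1)]]) auto
    thus "continuous_on (param_cube \<delta> \<times> ball 0 \<rho>) (\<lambda>(l, x). ?f l x)"
      by (simp add: case_prod_unfold perturbed_def)
  qed (use pos F0 est in auto)
  \<comment> \<open>Linear bounds in \<open>norm z\<close> for the \<open>Hp\<close> and
    \<open>Hm\<close> parts of \<open>\<psi> l z\<close>; they determine how small
    \<open>\<epsilon>\<close> must be for \<open>\<psi>\<close> to take values in the prescribed
    balls.\<close>
  define k1 k0 where "k1 = K * (1 + K / (2 * a))\<^sup>2 / (2 * a)" and "k0 = K / (2 * a) * (1 + k1)"
  have k: "0 \<le> k1" "0 \<le> k0" using pos by (simp_all add: k1_def k0_def)
  \<comment> \<open>The bounds by \<open>\<rho> / 4\<close> here, in \<open>\<theta>\<close> and in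
    \<open>\<epsilon>\<close> keep \<open>z + u + v\<close> inside the ball of radius
    \<open>\<rho>\<close>. The bound by \<open>S.A.\<sigma> / 2\<close> brings every competitor of
    \<open>\<psi>\<close> into the range of \<open>S.\<psi>_unique\<close>.\<close>
  define \<eta> where "\<eta> = min S.B.\<beta> (min (S.A.\<sigma> / 2) (\<rho> / 4))"
  define \<theta> where "\<theta> = min S.A.\<beta> (\<rho> / 4)"
  define \<epsilon> where "\<epsilon> = min (min S.B.\<sigma> (\<rho> / 4)) (min (\<eta> / (k1 + 1)) (\<theta> / (k0 + 1)))"
  have \<eta>: "0 < \<eta>" "\<eta> \<le> S.B.\<beta>" "\<eta> \<le> S.A.\<sigma> / 2" "\<eta> \<le> \<rho> / 4"
    using S.B.\<beta>_pos S.A.\<sigma>_pos pos by (auto simp: \<eta>_def)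
  have \<theta>: "0 < \<theta>" "\<theta> \<le> S.A.\<beta>" "\<theta> \<le> \<rho> / 4" using S.A.\<beta>_pos pos by (auto simp: \<theta>_def)
  have "0 < \<epsilon>" using S.B.\<sigma>_pos pos \<eta>(1) \<theta>(1) k by (simp add: \<epsilon>_def)
  moreover have "\<epsilon> \<le> S.B.\<sigma>" "\<epsilon> \<le> \<rho> / 4" "\<epsilon> \<le> \<eta> / (k1 + 1)" "\<epsilon> \<le> \<theta> / (k0 + 1)"
    by (simp_all only: \<epsilon>_def min_le_iff_disj order_refl simp_thms)
  ultimately have \<epsilon>: "0 < \<epsilon>" "\<epsilon> \<le> S.B.\<sigma>" "\<epsilon> \<le> \<rho> / 4" "\<epsilon> \<le> \<eta> / (k1 + 1)" "\<epsilon> \<le> \<theta> / (k0 + 1)" .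
  have null: "z \<in> ?N" "norm z < \<epsilon>" "norm z < S.B.\<sigma>" if "z \<in> null_ball (B 0) \<epsilon>" for z
    using that \<epsilon> by (auto simp: null_ball_def)
  have pn: "\<exists>u v. w = u + v \<and> u \<in> ?Hp \<and> norm u < \<eta> \<and> v \<in> ?Hm \<and> norm v < \<theta>"
    if "w \<in> pos_neg_ball (B 0) \<eta> \<theta>" for w
    using that by (auto simp: pos_neg_ball_def pos_ball_def neg_ball_def)
  have inV: "\<forall>z\<in>null_ball (B 0) \<epsilon>. \<forall>u\<in>pos_neg_ball (B 0) \<eta> \<theta>. z + u \<in> V"
  proof (intro ballI)
    fix z w assume z: "z \<in> null_ball (B 0) \<epsilon>" and w: "w \<in> pos_neg_ball (B 0) \<eta> \<theta>"
    obtain u v where e: "w = u + v" "norm u < \<eta>" "norm v < \<theta>" using pn[OF w] by blast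
    have "norm (z + w) < \<rho>"
      unfolding e(1) using e(2,3) null(2)[OF z] \<epsilon> \<eta> \<theta> norm_triangle_ineq[of z "u + v"] norm_triangle_ineq[of u v] pos(1) by linarith
    thus "z + w \<in> V" using \<rho>V by auto
  qed
  have gr: "gradient (?f l) x = ?F l x" if "x \<in> V" for l x by (rule GDERIV_gradient_eq) (rule gd[OF that])
  have z\<psi>V: "z + S.\<psi> l z \<in> V" if "l \<in> param_cube \<delta>" "z \<in> null_ball (B 0) \<epsilon>" for l z
    using S.norm_z_\<psi>[OF that(1) null(1,3)[OF that(2)]] \<rho>V by auto
  have red: "reduction_map L G (B 0) \<delta> \<epsilon> \<eta> \<theta> S.\<psi>"
    unfolding reduction_map_def
  proof (intro conjI ballI)
    show "continuous_on (param_cube \<delta> \<times> null_ball (B 0) \<epsilon>) (\<lambda>(l, z). S.\<psi> l z)"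
      by (rule continuous_on_subset[OF S.continuous_on_\<psi>]) (use null in auto)
    fix l :: "real ^ 'n" assume l: "l \<in> param_cube \<delta>"
    show "S.\<psi> l 0 = 0" by (rule S.\<psi>_zero[OF l])
    fix z assume z: "z \<in> null_ball (B 0) \<epsilon>"
    note n = null[OF z]
    have "norm (S.B.c l z) \<le> k1 * norm z" unfolding k1_def by (rule S.norm_Bc_le[OF l n(1,3)])
    moreover have "(k1 + 1) * norm z < \<eta>"
    proof -
      have "norm z < \<eta> / (k1 + 1)" using n(2) \<epsilon>(4) by linarith
      thus ?thesis using k by (simp add: pos_less_divide_eq mult.commute)
    qed
    moreover have "norm (S.A.c l (z + S.B.c l z)) \<le> k0 * norm z"
      using S.norm_Ac_le[OF l n(1,3)] unfolding k0_def k1_def by (simp only: mult.assoc)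
    moreover have "(k0 + 1) * norm z < \<theta>"
    proof -
      have "norm z < \<theta> / (k0 + 1)" using n(2) \<epsilon>(5) by linarith
      thus ?thesis using k by (simp add: pos_less_divide_eq mult.commute)
    qed
    ultimately have "norm (S.B.c l z) < \<eta>" "norm (S.A.c l (z + S.B.c l z)) < \<theta>"
      using norm_ge_zero[of z] unfolding distrib_right by linarith+
    thus "S.\<psi> l z \<in> pos_neg_ball (B 0) \<eta> \<theta>"
      using S.B.c_in[OF l n(1,3)] S.A.c_in[OF l S.x_base[OF l n(1,3)]]
      unfolding pos_neg_ball_def pos_ball_def neg_ball_def S.\<psi>_def by auto
    let ?g = "?F l (z + S.\<psi> l z)"
    \<comment> \<open>A gradient without components in \<open>Hp\<close> and \<open>Hm\<close>
      equals its own projection onto the null space, which is the equation in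
      \<open>reduction_map\<close>.\<close>
    have "orth_proj ?Hp ?g = 0" "orth_proj ?Hm ?g = 0"
      using S.\<psi>_critical[OF l n(1,3)] S.subspaces by (auto intro!: orth_proj_zero)
    hence "orth_proj ?N ?g = ?g" using S.proj_sum[of ?g] by simp
    thus "gradient (?f l) (z + S.\<psi> l z) - orth_proj ?N (gradient (?f l) (z + S.\<psi> l z)) = 0"
      by (simp add: gr[OF z\<psi>V[OF l z]])
  qed
  have uniq: "\<forall>\<psi>'. reduction_map L G (B 0) \<delta> \<epsilon> \<eta> \<theta> \<psi>' \<longrightarrow>
      (\<forall>l\<in>param_cube \<delta>. \<forall>z\<in>null_ball (B 0) \<epsilon>. \<psi>' l z = S.\<psi> l z)"
  proof (intro allI impI ballI)
    fix \<psi>' :: "real ^ 'n \<Rightarrow> 'a \<Rightarrow> 'a" and l :: "real ^ 'n" and z :: 'a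
    assume \<psi>': "reduction_map L G (B 0) \<delta> \<epsilon> \<eta> \<theta> \<psi>'" and l: "l \<in> param_cube \<delta>" and z: "z \<in> null_ball (B 0) \<epsilon>"
    have w: "\<psi>' l z \<in> pos_neg_ball (B 0) \<eta> \<theta>"
      and c: "gradient (?f l) (z + \<psi>' l z) - orth_proj ?N (gradient (?f l) (z + \<psi>' l z)) = 0"
      using \<psi>' l z unfolding reduction_map_def by blast+
    obtain u v where uv: "\<psi>' l z = u + v" "u \<in> ?Hp" "norm u < \<eta>" "v \<in> ?Hm" "norm v < \<theta>" using pn[OF w] by blast
    have "gradient (?f l) (z + \<psi>' l z) = ?F l (z + (u + v))" using gr inV z w uv(1) by metis
    hence "?F l (z + (u + v)) \<in> ?N" using c S.proj_in(1) by (metis eq_iff_diff_eq_0)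
    hence "inner (?F l (z + (u + v))) e = 0" if "e \<in> ?Hp \<or> e \<in> ?Hm" for e
      using that S.orthogonal by blast
    moreover have "norm u < S.A.\<sigma> / 2" "norm v < \<rho> / 2" using uv \<eta> \<theta> pos by linarith+
    ultimately have "u + v = S.\<psi> l z" by (intro S.\<psi>_unique[OF l null(1,3)[OF z] uv(2) _ uv(4)]) auto
    thus "\<psi>' l z = S.\<psi> l z" using uv(1) by simp
  qed
  obtain W \<Omega> \<Psi> where W: "open W" "0 \<in> W" and \<Omega>: "openin (top_of_set (param_cube \<delta> \<times> UNIV)) \<Omega>"
    "param_cube \<delta> \<times> W \<subseteq> \<Omega>" "\<Omega> \<subseteq> param_cube \<delta> \<times> ball 0 \<rho>"
    and hom: "homeomorphism (param_cube \<delta> \<times> (?N \<inter> ball 0 \<epsilon>) \<times> {u + v |u v. u \<in> ?Hp \<inter> ball 0 \<eta> \<and> v \<in> ?Hm \<inter> ball 0 \<theta>})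
      \<Omega> (\<lambda>(l, z, u). (l, S.\<Phi> l z u)) \<Psi>"
    by (rule S.saddle_homeomorphism[OF \<epsilon>(1,2) \<eta>(1,2) \<theta>(1,2)]) (rule that; assumption)
  have equiv: "act g ` ?N \<subseteq> ?N \<and>
      act g ` {x. \<forall>y\<in>?N. inner y x = 0} \<subseteq> {x. \<forall>y\<in>?N. inner y x = 0} \<and>
      (\<forall>l\<in>param_cube \<delta>. \<forall>z\<in>null_ball (B 0) \<epsilon>.
        S.\<psi> l (act g z) = act g (S.\<psi> l z) \<and>
        (\<forall>u\<in>pos_neg_ball (B 0) \<eta> \<theta>. S.\<Phi> l (act g z) (act g u) = act g (S.\<Phi> l z u)) \<and>
        ?f l (act g z + S.\<psi> l (act g z)) = ?f l (z + S.\<psi> l z))"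
    if G: "compact_lie_group TYPE('e) K T" "orthogonal_action K T act"
      and inv: "\<And>g. g \<in> carrier K \<Longrightarrow> act g ` V \<subseteq> V \<and> (\<forall>x\<in>V. L (act g x) = L x \<and> (\<forall>j. G j (act g x) = G j x))"
      and g: "g \<in> carrier K"
    for K :: "'g monoid" and T :: "'g topology" and act :: "'g \<Rightarrow> 'a \<Rightarrow> 'a" and g
  proof -
    have grp: "group K" using G(1) by (simp add: compact_lie_group_def topological_group_def)
    interpret U: invertible_isometry "act g" "act (inv\<^bsub>K\<^esub> g)"
      by (rule orthogonal_action_isometry[OF G(2) grp g])
    have UV: "act g ` V \<subseteq> V" and LU: "\<And>x. x \<in> V \<Longrightarrow> L (act g x) = L x"
      and GU: "\<And>x j. x \<in> V \<Longrightarrow> G j (act g x) = G j x" using inv[OF g] by auto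
    have gL: "gradient L (act g x) = act g (gradient L x)" if "x \<in> V" for x
      by (rule U.gradient_equivariant[OF V(1) UV LU C1[OF L(1)] that])
    have gG: "gradient (G j) (act g x) = act g (gradient (G j) x)" if "x \<in> V" for x j
      by (rule U.gradient_equivariant[OF V(1) UV GU C1[OF assms(7)] that])
    have FU: "?F l (act g x) = act g (?F l x)" if "x \<in> V" for l x
      using gL[OF that] gG[OF that]
      by (simp add: pgrad_def linear_add[OF U.lin] linear_sum[OF U.lin] linear_scale[OF U.lin])
    have fU: "?f l (act g x) = ?f l x" if "x \<in> V" for l x
      using LU[OF that] GU[OF that] by (simp add: perturbed_def)
    \<comment> \<open>Differentiating the equivariance of \<open>gradient L\<close> at the fixed
      point 0; the spectral spaces of \<open>B 0\<close> are therefore invariant under the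
      action.\<close>
    have comm: "B 0 (act g h) = act g (B 0 h)" for h
      using A V by (intro U.gateaux_commutes[where F = "gradient L", OF V gL]) (auto simp: hypothesis_A_def)
    note im = U.null_space_image[OF comm] U.pos_space_image_eq[OF comm] U.neg_space_image_eq[OF comm]
    have FU': "?F l (act g w) = act g (?F l w)" and fU': "?f l (act g w) = ?f l w" if "norm w < \<rho>" for l w
      using that \<rho>V FU fU by auto
    have \<psi>: "S.\<psi> l (act g z) = act g (S.\<psi> l z)" if "l \<in> param_cube \<delta>" "z \<in> null_ball (B 0) \<epsilon>" for l z
      using fU' FU' that(1) null[OF that(2)] by (intro S.\<psi>_equivariant[OF U.lin U.iso im]) auto
    have \<Phi>: "S.\<Phi> l (act g z) (act g u) = act g (S.\<Phi> l z u)"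
      if lz: "l \<in> param_cube \<delta>" "z \<in> null_ball (B 0) \<epsilon>" and u: "u \<in> pos_neg_ball (B 0) \<eta> \<theta>" for l z u
    proof -
      obtain u1 u2 where e: "u = u1 + u2" "u1 \<in> ?Hp" "norm u1 < \<eta>" "u2 \<in> ?Hm" "norm u2 < \<theta>" using pn[OF u] by blast
      show ?thesis unfolding e(1)
        using fU' FU' lz(1) null[OF lz(2)] e(2-) \<eta> \<theta>
        by (intro S.\<Phi>_equivariant[OF U.lin U.iso im]) auto
    qed
    have "?f l (act g z + S.\<psi> l (act g z)) = ?f l (z + S.\<psi> l z)"
      if "l \<in> param_cube \<delta>" "z \<in> null_ball (B 0) \<epsilon>" for l z
      using fU[OF z\<psi>V[OF that]] by (simp add: \<psi>[OF that] linear_add[OF U.lin])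
    thus ?thesis using im(1) U.null_space_perp_image[OF comm] \<psi> \<Phi> by blast
  qed
  have der: "((\<lambda>z. ?f l (z + S.\<psi> l z)) has_derivative
        (\<lambda>h. frechet_derivative L (at (z + S.\<psi> l z)) h
           + (\<Sum>j\<in>UNIV. l $ j * frechet_derivative (G j) (at (z + S.\<psi> l z)) h)))
        (at z within null_ball (B 0) \<epsilon>)" if l: "l \<in> param_cube \<delta>" and z: "z \<in> null_ball (B 0) \<epsilon>" for l z
  proof -
    let ?w = "z + S.\<psi> l z"
    have fd: "frechet_derivative f (at ?w) = (\<lambda>h. inner h (gradient f ?w))" if "C1_on V f" for f
      using C1[OF that z\<psi>V[OF l z]] unfolding gderiv_def by (rule frechet_derivative_at[symmetric])
    have "((\<lambda>z. ?f l (z + S.\<psi> l z)) has_derivative (\<lambda>h. inner h (?F l ?w))) (at z within ?N \<inter> ball 0 \<epsilon>)"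
      by (rule S.reduced_derivative[OF l null(1,3)[OF z] \<epsilon>(2)])
    thus ?thesis
      by (simp add: fd L(1) assms(7) null_ball_def pgrad_def inner_add_right inner_sum_right)
  qed
  have normal_form: "?f l (S.\<Phi> l z (up + um)) = (norm up)\<^sup>2 - (norm um)\<^sup>2 + ?f l (z + S.\<psi> l z)"
    if "l \<in> param_cube \<delta>" "z \<in> null_ball (B 0) \<epsilon>" "up \<in> pos_ball (B 0) \<eta>" "um \<in> neg_ball (B 0) \<theta>" for l z up um
    using that null[OF that(2)] \<eta> \<theta> by (intro S.f_\<Phi>) (auto simp: pos_ball_def neg_ball_def)
  have hom': "homeomorphism (param_cube \<delta> \<times> null_ball (B 0) \<epsilon> \<times> pos_neg_ball (B 0) \<eta> \<theta>) \<Omega>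
      (\<lambda>(l, z, u). (l, S.\<Phi> l z u)) \<Psi>"
    using hom unfolding null_ball_def pos_neg_ball_def pos_ball_def neg_ball_def .
  have C12: "C1_on (null_ball (B 0) \<epsilon>) (\<lambda>z. ?f l (z + S.\<psi> l z))" "C2_0_on (null_ball (B 0) \<epsilon>) (\<lambda>z. ?f l (z + S.\<psi> l z))"
    if "l \<in> param_cube \<delta>" for l
    using S.reduced_C1[OF that \<epsilon>(2)] S.reduced_C2_0[OF that \<epsilon>(2)] unfolding null_ball_def .
  show ?thesis
    apply (rule exI[where x = \<delta>], rule conjI[OF pos(2)], rule exI[where x = \<epsilon>], rule conjI[OF \<epsilon>(1)])
    apply (rule exI[where x = \<eta>], rule conjI[OF \<eta>(1)], rule exI[where x = \<theta>], rule conjI[OF \<theta>(1)])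
    apply (rule conjI[OF inV], rule exI[where x = S.\<psi>], rule conjI[OF red], rule conjI[OF uniq])
    apply (rule exI[where x = W], rule exI[where x = \<Omega>], rule exI[where x = S.\<Phi>])
    apply (intro conjI W \<Omega>(1,2))
    subgoal using \<Omega>(3) \<rho>V by (meson Sigma_mono order_refl order_trans)
    subgoal by (rule exI) (rule hom')
    subgoal by (intro ballI S.\<Phi>_zero)
    subgoal by (intro ballI normal_form)
    subgoal by (intro ballI conjI C12(1) der)
    subgoal by (intro ballI impI C12(2))
    subgoal by (intro allI impI ballI, elim conjE, rule equiv) blast+
    done
qed

end
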